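(* Let $X_\bullet$ be a simplicial smooth manifold and let $\Lambda$ be a subgroup of $\mathbb{C}$. There is an isomorphism $$\hat{H}^{r-1}(X_\bullet;\mathbb{C}/\Lambda)\cong MH^{2r}_r(X_\bullet;\Lambda;\sigma),$$ where $\sigma=\{\sigma_{\ge p}\Omega^*_{dR}(X_\bullet)\}_p$ is the truncation filtration ("filtration bête") of the de Rham complex of compatible forms.
   Context: A simplicial smooth manifold $X_\bullet=\{X_n\}_{n\ge 0}$ is a simplicial object in the category of $\mathcal{C}^\infty$-manifolds, with face maps $\varepsilon_i\colon X_n\to X_{n-1}$; $\varepsilon^i\colon\Delta^{n-1}\to\Delta^n$ denotes the $i$-th face inclusion of standard simplices. Compatible forms: $\Omega^k_{dR}(X_\bullet)$ is the set of sequences $\omega=\{\omega^{(n)}\}_{n\ge0}$ of smooth complex $k$-forms $\omega^{(n)}\in\Omega^k_{dR}(\Delta^n\times X_n)$ with $(\varepsilon^i\times \mathrm{id})^*\omega^{(n)}=(\mathrm{id}\times\varepsilon_i)^*\omega^{(n-1)}$ on $\Delta^{n-1}\times X_n$ for all $0\le i\le n$, $n\ge 1$; the differential $d$ is the exterior differential. Compatible cochains: for an abelian group $R$, $C^k(X_\bullet;R)$ is the group of sequences $\{c^{(n)}\}_{n\ge0}$ of smooth singular $k$-cochains $c^{(n)}\in S^k(\Delta^n\times X_n;R)$ with $(\varepsilon^i\times \mathrm{id})^*c^{(n)}=(\mathrm{id}\times\varepsilon_i)^*c^{(n-1)}$ for all $0\le i\le n$, $n\geq 1$; it is a complex under the singular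 coboundary. Integration of forms over simplices gives a map of complexes $\mathcal{I}'\colon\Omega^*_{dR}(X_\bullet)\to C^*(X_\bullet;\mathbb{C})$. For a complex $C^*$, $\sigma_{\ge p}C^*$ is the subcomplex equal to $C^j$ in degrees $j\ge p$ and $0$ in degrees $j<p$. Cone convention: for $f\colon A^*\to B^*$, $\mathrm{cone}(f)^n=A^n\oplus B^{n-1}$ with $d(a,b)=(d_Aa,(-1)^{n+1}f(a)+d_Bb)$. Cheeger--Simons differential characters (mod $\Lambda$): $\hat{H}^{k-1}(X_\bullet;\mathbb{C}/\Lambda)=H^k(\mathrm{cone}(\sigma_{\ge k}\Omega^*_{dR}(X_\bullet)\to C^*(X_\bullet;\mathbb{C}/\Lambda)))$, where the map is $\mathcal{I}'$ followed by reduction mod $\Lambda$. Multiplicative cohomology with respect to a filtration $\mathcal{F}=\{F^r\Omega^*_{dR}(X_\bullet)\}_r$ by subcomplexes: $MH^{2r}_n(X_\bullet;\Lambda;\mathcal{F})=H^{2r-n}(\mathrm{cone}(C^*(X_\bullet;\Lambda)\oplus F^r\Omega^*_{dR}(X_\bullet)\to C^*(X_\bullet;\mathbb{C})))$, where the map is $(c,\omega)\mapsto c-\mathcal{I}'(\omega)$. For $\mathcal{F}=\sigma$ one has $F^r\Omega^*_{dR}(X_\bullet)=\sigma_{\ge r}\Omega^*_{dR}(X_\bullet)$. *)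

theory Defs
  imports "HOL-Analysis.Analysis" "HOL-Homology.Homology"
begin

section \<open>Smooth functions on subsets of Euclidean space\<close>

text \<open>
  All dimensions are natural numbers that vary inside the statement, so points of \<open>\<real>\<^sup>d\<close> are
  functions \<open>nat \<Rightarrow> real\<close> vanishing from \<open>d\<close> on, as in \<^const>\<open>Euclidean_space\<close>, and
  smoothness is expressed by iterated partial derivatives.
\<close>

definition partial :: "nat \<Rightarrow> ((nat \<Rightarrow> real) \<Rightarrow> 'v::real_normed_vector) \<Rightarrow> (nat \<Rightarrow> real) \<Rightarrow> 'v" where
  "partial i f x = vector_derivative (\<lambda>t. f (x(i := t))) (at (x i))"

fun partials :: "nat list \<Rightarrow> ((nat \<Rightarrow> real) \<Rightarrow> 'v::real_normed_vector) \<Rightarrow> (nat \<Rightarrow> real) \<Rightarrow> 'v" where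
  "partials [] f = f"
| "partials (i # is) f = partial i (partials is f)"

definition smooth_on_open ::
    "nat \<Rightarrow> (nat \<Rightarrow> real) set \<Rightarrow> ((nat \<Rightarrow> real) \<Rightarrow> 'v::real_normed_vector) \<Rightarrow> bool" where
  "smooth_on_open d W f \<longleftrightarrow>
     openin (Euclidean_space d) W \<and>
     (\<forall>is \<in> lists {..<d}.
        continuous_map (subtopology (Euclidean_space d) W) euclidean (partials is f) \<and>
        (\<forall>x\<in>W. \<forall>i<d. (\<lambda>t. partials is f (x(i := t))) differentiable (at (x i))))"

text \<open>On an arbitrary subset, smooth means locally extendable to a smooth function on an open set.\<close>

definition smooth_on_subset ::
    "nat \<Rightarrow> (nat \<Rightarrow> real) set \<Rightarrow> ((nat \<Rightarrow> real) \<Rightarrow> 'v::real_normed_vector) \<Rightarrow> bool" where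
  "smooth_on_subset d A f \<longleftrightarrow>
     A \<subseteq> topspace (Euclidean_space d) \<and>
     (\<forall>p\<in>A. \<exists>W g. p \<in> W \<and> smooth_on_open d W g \<and> (\<forall>x \<in> A \<inter> W. f x = g x))"

text \<open>
  The partial derivative of a function that is smooth on a subset is that of any local smooth
  extension.  The value is unique if \<open>A\<close> is contained in the closure of its interior, as is the case
  for relatively open subsets of \<open>\<Delta>\<^sup>n \<times> \<real>\<^sup>m\<close>, the only sets for which it is used below.
\<close>

definition partial_on ::
    "nat \<Rightarrow> (nat \<Rightarrow> real) set \<Rightarrow> nat \<Rightarrow> ((nat \<Rightarrow> real) \<Rightarrow> 'v::real_normed_vector) \<Rightarrow> (nat \<Rightarrow> real) \<Rightarrow> 'v" where
  "partial_on d A i f p =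
     (THE v. \<exists>W g. p \<in> W \<and> smooth_on_open d W g \<and> (\<forall>x \<in> A \<inter> W. f x = g x) \<and> v = partial i g p)"


section \<open>Smooth manifolds and their products with simplices\<close>

record 'a chart =
  cdom :: "'a set"
  cmap :: "'a \<Rightarrow> nat \<Rightarrow> real"
  cdim :: nat

definition chart_inv :: "'a chart \<Rightarrow> (nat \<Rightarrow> real) \<Rightarrow> 'a" where
  "chart_inv c = inv_into (cdom c) (cmap c)"

record 'a smooth_space =
  top_of :: "'a topology"
  atlas :: "'a chart set"

abbreviation points :: "'a smooth_space \<Rightarrow> 'a set" where
  "points M \<equiv> topspace (top_of M)"

definition charts_at :: "'a smooth_space \<Rightarrow> 'a \<Rightarrow> 'a chart set" where
  "charts_at M p = {c \<in> atlas M. p \<in> cdom c}"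

definition smooth_in_charts :: "'a chart \<Rightarrow> 'b chart \<Rightarrow> ('a \<Rightarrow> 'b) \<Rightarrow> bool" where
  "smooth_in_charts c c' f \<longleftrightarrow>
     (\<forall>j < cdim c'. smooth_on_subset (cdim c) (cmap c ` (cdom c \<inter> f -` cdom c'))
                      (\<lambda>y. cmap c' (f (chart_inv c y)) j))"

definition smooth_manifold :: "'a smooth_space \<Rightarrow> bool" where
  "smooth_manifold M \<longleftrightarrow>
     Hausdorff_space (top_of M) \<and> second_countable (top_of M) \<and>
     (\<Union>c \<in> atlas M. cdom c) = points M \<and>
     (\<forall>c \<in> atlas M.
        openin (top_of M) (cdom c) \<and>
        openin (Euclidean_space (cdim c)) (cmap c ` cdom c) \<and>
        homeomorphic_map (subtopology (top_of M) (cdom c))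
          (subtopology (Euclidean_space (cdim c)) (cmap c ` cdom c)) (cmap c)) \<and>
     (\<forall>c \<in> atlas M. \<forall>c' \<in> atlas M. smooth_in_charts c c' (\<lambda>x. x))"

definition smooth_map :: "'a smooth_space \<Rightarrow> 'b smooth_space \<Rightarrow> ('a \<Rightarrow> 'b) \<Rightarrow> bool" where
  "smooth_map M N f \<longleftrightarrow>
     continuous_map (top_of M) (top_of N) f \<and>
     (\<forall>c \<in> atlas M. \<forall>c' \<in> atlas N. smooth_in_charts c c' f)"

text \<open>
  \<open>\<Delta>\<^sup>n\<close> is given by barycentric coordinates \<open>(t\<^sub>0, \<dots>, t\<^sub>n)\<close>; \<open>(t\<^sub>1, \<dots>, t\<^sub>n)\<close> are affine coordinates
  on the hyperplane it spans.  \<open>\<Delta>\<^sup>n\<close> and \<open>\<Delta>\<^sup>n \<times> M\<close> are manifolds with corners: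
  the images of their charts are not open in Euclidean space.
\<close>

definition simplex_chart :: "nat \<Rightarrow> (nat \<Rightarrow> real) chart" where
  "simplex_chart n =
     \<lparr>cdom = standard_simplex n, cmap = (\<lambda>t i. if i < n then t (Suc i) else 0), cdim = n\<rparr>"

definition simplex_space :: "nat \<Rightarrow> (nat \<Rightarrow> real) smooth_space" where
  "simplex_space n =
     \<lparr>top_of = subtopology (powertop_real UNIV) (standard_simplex n), atlas = {simplex_chart n}\<rparr>"

definition simplex_times_chart :: "nat \<Rightarrow> 'a chart \<Rightarrow> ((nat \<Rightarrow> real) \<times> 'a) chart" where
  "simplex_times_chart n c =
     \<lparr>cdom = standard_simplex n \<times> cdom c,
      cmap = (\<lambda>(t, x) i. if i < n then t (Suc i) else cmap c x (i - n)),
      cdim = n + cdim c\<rparr>"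

definition simplex_times :: "nat \<Rightarrow> 'a smooth_space \<Rightarrow> ((nat \<Rightarrow> real) \<times> 'a) smooth_space" where
  "simplex_times n M =
     \<lparr>top_of = prod_topology (top_of (simplex_space n)) (top_of M),
      atlas = simplex_times_chart n ` atlas M\<rparr>"


section \<open>Tangent vectors and differential forms\<close>

text \<open>
  The differential of \<open>f\<close> at \<open>p\<close> in the charts \<open>c\<close> and \<open>c'\<close>, that is, the Jacobian matrix of
  \<open>c' \<circ> f \<circ> c\<inverse>\<close> applied to a coordinate vector.
\<close>

definition coord_diff ::
    "'a chart \<Rightarrow> 'b chart \<Rightarrow> ('a \<Rightarrow> 'b) \<Rightarrow> 'a \<Rightarrow> (nat \<Rightarrow> real) \<Rightarrow> nat \<Rightarrow> real" where
  "coord_diff c c' f p u =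
     (\<lambda>j. if j < cdim c' then
            (\<Sum>i < cdim c. partial_on (cdim c) (cmap c ` (cdom c \<inter> f -` cdom c')) i
                             (\<lambda>y. cmap c' (f (chart_inv c y)) j) (cmap c p) * u i)
          else 0)"

text \<open>
  A tangent vector at \<open>p\<close> is the family of its coordinate vectors in all charts at \<open>p\<close>, which are
  related by the Jacobians of the chart transitions.
\<close>

type_synonym 'a tvec = "'a chart \<Rightarrow> nat \<Rightarrow> real"

definition tangent_space :: "'a smooth_space \<Rightarrow> 'a \<Rightarrow> 'a tvec set" where
  "tangent_space M p =
     {v. (\<forall>c \<in> charts_at M p. \<forall>c' \<in> charts_at M p. v c' = coord_diff c c' (\<lambda>x. x) p (v c)) \<and>
         (\<forall>c. c \<notin> charts_at M p \<longrightarrow> v c = (\<lambda>_. 0))}"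

definition chart_at :: "'a smooth_space \<Rightarrow> 'a \<Rightarrow> 'a chart" where
  "chart_at M p = (SOME c. c \<in> charts_at M p)"

text \<open>By the chain rule the choice of the chart at \<open>p\<close> is immaterial for \<open>v\<close> tangent at \<open>p\<close>.\<close>

definition tangent_map ::
    "'a smooth_space \<Rightarrow> 'b smooth_space \<Rightarrow> ('a \<Rightarrow> 'b) \<Rightarrow> 'a \<Rightarrow> 'a tvec \<Rightarrow> 'b tvec" where
  "tangent_map M N f p v =
     (\<lambda>c'. if c' \<in> charts_at N (f p) then coord_diff (chart_at M p) c' f p (v (chart_at M p))
           else (\<lambda>_. 0))"

text \<open>The tangent vector at \<open>p\<close> whose coordinate vector in the chart \<open>c\<close> is \<open>u\<close>.\<close>

definition chart_vector :: "'a smooth_space \<Rightarrow> 'a chart \<Rightarrow> 'a \<Rightarrow> (nat \<Rightarrow> real) \<Rightarrow> 'a tvec" where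
  "chart_vector M c p u =
     (\<lambda>c'. if c' \<in> charts_at M p then coord_diff c c' (\<lambda>x. x) p u else (\<lambda>_. 0))"

text \<open>
  A complex \<open>k\<close>-form assigns a number to a point and a list of \<open>k\<close> tangent vectors there.
  Outside of these arguments it takes the value \<open>0\<close>, so that equality of forms is equality of functions.
\<close>

type_synonym 'a form = "'a \<Rightarrow> 'a tvec list \<Rightarrow> complex"

definition tangent_lists :: "'a smooth_space \<Rightarrow> nat \<Rightarrow> 'a \<Rightarrow> 'a tvec list set" where
  "tangent_lists M k p = {vs. length vs = k \<and> set vs \<subseteq> tangent_space M p}"

definition multilinear_form :: "'a smooth_space \<Rightarrow> nat \<Rightarrow> 'a \<Rightarrow> ('a tvec list \<Rightarrow> complex) \<Rightarrow> bool" where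
  "multilinear_form M k p \<phi> \<longleftrightarrow>
     (\<forall>vs \<in> tangent_lists M k p. \<forall>i<k. \<forall>u \<in> tangent_space M p. \<forall>w \<in> tangent_space M p. \<forall>a b.
        \<phi> (vs[i := (\<lambda>c j. a * u c j + b * w c j)])
          = complex_of_real a * \<phi> (vs[i := u]) + complex_of_real b * \<phi> (vs[i := w]))"

definition alternating_form :: "'a smooth_space \<Rightarrow> nat \<Rightarrow> 'a \<Rightarrow> ('a tvec list \<Rightarrow> complex) \<Rightarrow> bool" where
  "alternating_form M k p \<phi> \<longleftrightarrow>
     (\<forall>vs \<in> tangent_lists M k p. \<forall>i<k. \<forall>j<k. i \<noteq> j \<and> vs ! i = vs ! j \<longrightarrow> \<phi> vs = 0)"

text \<open>
  The function \<open>y \<mapsto> \<omega>(U\<^sub>1, \<dots>, U\<^sub>k)\<close> in the coordinates \<open>y\<close> of the chart \<open>c\<close>, where \<open>U\<^sub>a\<close> is the vector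
  field with constant coordinates \<open>u\<^sub>a\<close>; for basis vectors these are the coefficients of \<open>\<omega>\<close>.
\<close>

definition local_rep ::
    "'a smooth_space \<Rightarrow> 'a chart \<Rightarrow> 'a form \<Rightarrow> (nat \<Rightarrow> real) list \<Rightarrow> (nat \<Rightarrow> real) \<Rightarrow> complex" where
  "local_rep M c \<omega> us y = \<omega> (chart_inv c y) (map (chart_vector M c (chart_inv c y)) us)"

definition smooth_form :: "'a smooth_space \<Rightarrow> nat \<Rightarrow> 'a form \<Rightarrow> bool" where
  "smooth_form M k \<omega> \<longleftrightarrow>
     (\<forall>p \<in> points M. multilinear_form M k p (\<omega> p) \<and> alternating_form M k p (\<omega> p)) \<and>
     (\<forall>c \<in> atlas M. \<forall>us. length us = k \<and> set us \<subseteq> topspace (Euclidean_space (cdim c)) \<longrightarrow>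
        smooth_on_subset (cdim c) (cmap c ` cdom c) (local_rep M c \<omega> us)) \<and>
     (\<forall>p vs. \<not> (p \<in> points M \<and> vs \<in> tangent_lists M k p) \<longrightarrow> \<omega> p vs = 0)"

definition pullback_form ::
    "'a smooth_space \<Rightarrow> 'b smooth_space \<Rightarrow> nat \<Rightarrow> ('a \<Rightarrow> 'b) \<Rightarrow> 'b form \<Rightarrow> 'a form" where
  "pullback_form M N k f \<omega> =
     (\<lambda>p vs. if p \<in> points M \<and> vs \<in> tangent_lists M k p
             then \<omega> (f p) (map (tangent_map M N f p) vs) else 0)"

definition omit_nth :: "nat \<Rightarrow> 'b list \<Rightarrow> 'b list" where
  "omit_nth j xs = take j xs @ drop (Suc j) xs"

text \<open>
  \<open>d\<omega>(V\<^sub>0, \<dots>, V\<^sub>k) = \<Sum>\<^sub>j (-1)\<^sup>j V\<^sub>j \<omega>(V\<^sub>0, \<dots>, V\<^sub>j\<^sub>-\<^sub>1, V\<^sub>j\<^sub>+\<^sub>1, \<dots>, V\<^sub>k)\<close> for the vector fields with constant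
  coordinates in a chart, whose Lie brackets vanish.  The result does not depend on the chart.
\<close>

definition ext_deriv :: "'a smooth_space \<Rightarrow> nat \<Rightarrow> 'a form \<Rightarrow> 'a form" where
  "ext_deriv M k \<omega> =
     (\<lambda>p vs. if p \<in> points M \<and> vs \<in> tangent_lists M (Suc k) p then
        (let c = chart_at M p in
         \<Sum>j\<le>k. (-1) ^ j * (\<Sum>i < cdim c. complex_of_real ((vs ! j) c i) *
           partial_on (cdim c) (cmap c ` cdom c) i
             (local_rep M c \<omega> (map (\<lambda>v. v c) (omit_nth j vs))) (cmap c p)))
      else 0)"

text \<open>
  The integral over \<open>\<Delta>\<^sup>k\<close> of a \<open>k\<close>-form, that is, the Lebesgue integral of its coefficient
  with respect to \<open>dt\<^sub>1 \<and> \<dots> \<and> dt\<^sub>k\<close>.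
\<close>

definition integral_simplex :: "nat \<Rightarrow> (nat \<Rightarrow> real) form \<Rightarrow> complex" where
  "integral_simplex k \<eta> =
     (\<integral>x. (let y = (\<lambda>i. if i < k then x i else 0) in
            if y \<in> cmap (simplex_chart k) ` standard_simplex k
            then local_rep (simplex_space k) (simplex_chart k) \<eta>
                   (map (\<lambda>a i. if i = a then 1 else 0) [0..<k]) y
            else 0) \<partial>(Pi\<^sub>M {..<k} (\<lambda>_. lborel)))"


section \<open>Simplicial manifolds\<close>

text \<open>
  Face maps \<open>sface X n i : X\<^sub>n \<rightarrow> X\<^sub>n\<^sub>-\<^sub>1\<close> for \<open>i \<le> n\<close>, \<open>n \<ge> 1\<close>, and degeneracies
  \<open>sdegen X n i : X\<^sub>n \<rightarrow> X\<^sub>n\<^sub>+\<^sub>1\<close> for \<open>i \<le> n\<close>.  All \<open>X\<^sub>n\<close> have their points in one type, which may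
  be thought of as containing their disjoint union.
\<close>

record 'a simplicial_space =
  level :: "nat \<Rightarrow> 'a smooth_space"
  sface :: "nat \<Rightarrow> nat \<Rightarrow> 'a \<Rightarrow> 'a"
  sdegen :: "nat \<Rightarrow> nat \<Rightarrow> 'a \<Rightarrow> 'a"

definition simplicial_smooth_manifold :: "'a simplicial_space \<Rightarrow> bool" where
  "simplicial_smooth_manifold X \<longleftrightarrow>
     (\<forall>n. smooth_manifold (level X n)) \<and>
     (\<forall>n. \<forall>i \<le> Suc n. smooth_map (level X (Suc n)) (level X n) (sface X (Suc n) i)) \<and>
     (\<forall>n. \<forall>i \<le> n. smooth_map (level X n) (level X (Suc n)) (sdegen X n i)) \<and>
     (\<forall>n i j. \<forall>x \<in> points (level X (Suc (Suc n))). i < j \<and> j \<le> Suc (Suc n) \<longrightarrow>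
        sface X (Suc n) i (sface X (Suc (Suc n)) j x)
          = sface X (Suc n) (j - 1) (sface X (Suc (Suc n)) i x)) \<and>
     (\<forall>n i j. \<forall>x \<in> points (level X n). i \<le> j \<and> j \<le> n \<longrightarrow>
        sdegen X (Suc n) i (sdegen X n j x) = sdegen X (Suc n) (Suc j) (sdegen X n i x)) \<and>
     (\<forall>n i j. \<forall>x \<in> points (level X (Suc n)). i < j \<and> j \<le> Suc n \<longrightarrow>
        sface X (Suc (Suc n)) i (sdegen X (Suc n) j x) = sdegen X n (j - 1) (sface X (Suc n) i x)) \<and>
     (\<forall>n j. \<forall>x \<in> points (level X n). j \<le> n \<longrightarrow>
        sface X (Suc n) j (sdegen X n j x) = x \<and> sface X (Suc n) (Suc j) (sdegen X n j x) = x) \<and>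
     (\<forall>n i j. \<forall>x \<in> points (level X (Suc n)). Suc j < i \<and> i \<le> Suc (Suc n) \<longrightarrow>
        sface X (Suc (Suc n)) i (sdegen X (Suc n) j x) = sdegen X n j (sface X (Suc n) (i - 1) x))"

abbreviation total_space :: "'a simplicial_space \<Rightarrow> nat \<Rightarrow> ((nat \<Rightarrow> real) \<times> 'a) smooth_space" where
  "total_space X n \<equiv> simplex_times n (level X n)"

text \<open>\<open>\<epsilon>\<^sup>i \<times> id : \<Delta>\<^sup>n \<times> X\<^sub>n\<^sub>+\<^sub>1 \<rightarrow> \<Delta>\<^sup>n\<^sup>+\<^sup>1 \<times> X\<^sub>n\<^sub>+\<^sub>1\<close> and \<open>id \<times> \<epsilon>\<^sub>i : \<Delta>\<^sup>n \<times> X\<^sub>n\<^sub>+\<^sub>1 \<rightarrow> \<Delta>\<^sup>n \<times> X\<^sub>n\<close>.\<close>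

definition face_incl :: "nat \<Rightarrow> (nat \<Rightarrow> real) \<times> 'a \<Rightarrow> (nat \<Rightarrow> real) \<times> 'a" where
  "face_incl i = map_prod (simplical_face i) (\<lambda>x. x)"

definition face_proj :: "'a simplicial_space \<Rightarrow> nat \<Rightarrow> nat \<Rightarrow> (nat \<Rightarrow> real) \<times> 'a \<Rightarrow> (nat \<Rightarrow> real) \<times> 'a" where
  "face_proj X n i = map_prod (\<lambda>t. t) (sface X (Suc n) i)"


section \<open>Complexes of abelian groups\<close>

text \<open>Groups are written multiplicatively in \<^theory>\<open>HOL-Algebra.Group\<close>.\<close>

record 'g cochain_complex =
  grp :: "int \<Rightarrow> 'g monoid"
  diff :: "int \<Rightarrow> 'g \<Rightarrow> 'g"

definition cohomology :: "'g cochain_complex \<Rightarrow> int \<Rightarrow> 'g set monoid" where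
  "cohomology C n =
     (grp C n)\<lparr>carrier := kernel (grp C n) (grp C (n + 1)) (diff C n)\<rparr>
       Mod (diff C (n - 1) ` carrier (grp C (n - 1)))"

definition truncation :: "int \<Rightarrow> 'g cochain_complex \<Rightarrow> 'g cochain_complex" where
  "truncation p C =
     C\<lparr>grp := (\<lambda>j. if j \<ge> p then grp C j else (grp C j)\<lparr>carrier := {\<one>\<^bsub>grp C j\<^esub>}\<rparr>)\<rparr>"

definition direct_sum :: "'g cochain_complex \<Rightarrow> 'h cochain_complex \<Rightarrow> ('g \<times> 'h) cochain_complex" where
  "direct_sum A B =
     \<lparr>grp = (\<lambda>n. grp A n \<times>\<times> grp B n), diff = (\<lambda>n. map_prod (diff A n) (diff B n))\<rparr>"

definition mapping_cone ::
    "'g cochain_complex \<Rightarrow> 'h cochain_complex \<Rightarrow> (int \<Rightarrow> 'g \<Rightarrow> 'h) \<Rightarrow> ('g \<times> 'h) cochain_complex" where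
  "mapping_cone A B f =
     \<lparr>grp = (\<lambda>n. grp A n \<times>\<times> grp B (n - 1)),
      diff = (\<lambda>n (a, b). (diff A n a,
        (if even (n + 1) then f n a else inv\<^bsub>grp B n\<^esub> (f n a)) \<otimes>\<^bsub>grp B n\<^esub> diff B (n - 1) b))\<rparr>"


section \<open>Compatible forms and compatible cochains\<close>

definition compatible_forms :: "'a simplicial_space \<Rightarrow> nat \<Rightarrow> (nat \<Rightarrow> ((nat \<Rightarrow> real) \<times> 'a) form) set" where
  "compatible_forms X k =
     {\<omega>. (\<forall>n. smooth_form (total_space X n) k (\<omega> n)) \<and>
         (\<forall>n. \<forall>i \<le> Suc n.
            pullback_form (simplex_times n (level X (Suc n))) (total_space X (Suc n)) k (face_incl i) (\<omega> (Suc n))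
          = pullback_form (simplex_times n (level X (Suc n))) (total_space X n) k (face_proj X n i) (\<omega> n))}"

definition de_rham_complex ::
    "'a simplicial_space \<Rightarrow> (nat \<Rightarrow> ((nat \<Rightarrow> real) \<times> 'a) form) cochain_complex" where
  "de_rham_complex X =
     \<lparr>grp = (\<lambda>k. \<lparr>carrier = (if k < 0 then {\<lambda>n p vs. 0} else compatible_forms X (nat k)),
                  monoid.mult = (\<lambda>\<omega> \<eta> n p vs. \<omega> n p vs + \<eta> n p vs), one = (\<lambda>n p vs. 0)\<rparr>),
      diff = (\<lambda>k \<omega> n. if k < 0 then (\<lambda>p vs. 0) else ext_deriv (total_space X n) (nat k) (\<omega> n))\<rparr>"

definition smooth_simplex :: "nat \<Rightarrow> 'a smooth_space \<Rightarrow> ((nat \<Rightarrow> real) \<Rightarrow> 'a) \<Rightarrow> bool" where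
  "smooth_simplex k M \<sigma> \<longleftrightarrow> singular_simplex k (top_of M) \<sigma> \<and> smooth_map (simplex_space k) M \<sigma>"

text \<open>
  An \<open>R\<close>-valued smooth singular cochain is a function on the smooth singular simplices, here
  extended by the neutral element.
\<close>

type_synonym ('a, 'r) cochain = "((nat \<Rightarrow> real) \<Rightarrow> 'a) \<Rightarrow> 'r"

definition smooth_cochain :: "'r monoid \<Rightarrow> nat \<Rightarrow> 'a smooth_space \<Rightarrow> ('a, 'r) cochain \<Rightarrow> bool" where
  "smooth_cochain R k M c \<longleftrightarrow>
     (\<forall>\<sigma>. if smooth_simplex k M \<sigma> then c \<sigma> \<in> carrier R else c \<sigma> = \<one>\<^bsub>R\<^esub>)"

definition pullback_cochain ::
    "'r monoid \<Rightarrow> 'a smooth_space \<Rightarrow> nat \<Rightarrow> ('a \<Rightarrow> 'b) \<Rightarrow> ('b, 'r) cochain \<Rightarrow> ('a, 'r) cochain" where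
  "pullback_cochain R M k f c =
     (\<lambda>\<sigma>. if smooth_simplex k M \<sigma> then c (simplex_map k f \<sigma>) else \<one>\<^bsub>R\<^esub>)"

definition coboundary :: "'r monoid \<Rightarrow> 'a smooth_space \<Rightarrow> nat \<Rightarrow> ('a, 'r) cochain \<Rightarrow> ('a, 'r) cochain" where
  "coboundary R M k c =
     (\<lambda>\<sigma>. if smooth_simplex (Suc k) M \<sigma>
          then finprod R (\<lambda>i. if even i then c (singular_face (Suc k) i \<sigma>)
                              else inv\<^bsub>R\<^esub> (c (singular_face (Suc k) i \<sigma>))) {..Suc k}
          else \<one>\<^bsub>R\<^esub>)"

definition compatible_cochains ::
    "'r monoid \<Rightarrow> 'a simplicial_space \<Rightarrow> nat \<Rightarrow> (nat \<Rightarrow> ((nat \<Rightarrow> real) \<times> 'a, 'r) cochain) set" where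
  "compatible_cochains R X k =
     {c. (\<forall>n. smooth_cochain R k (total_space X n) (c n)) \<and>
         (\<forall>n. \<forall>i \<le> Suc n.
            pullback_cochain R (simplex_times n (level X (Suc n))) k (face_incl i) (c (Suc n))
          = pullback_cochain R (simplex_times n (level X (Suc n))) k (face_proj X n i) (c n))}"

definition cochains ::
    "'r monoid \<Rightarrow> 'a simplicial_space \<Rightarrow> (nat \<Rightarrow> ((nat \<Rightarrow> real) \<times> 'a, 'r) cochain) cochain_complex" where
  "cochains R X =
     \<lparr>grp = (\<lambda>k. \<lparr>carrier = (if k < 0 then {\<lambda>n \<sigma>. \<one>\<^bsub>R\<^esub>} else compatible_cochains R X (nat k)),
                  monoid.mult = (\<lambda>c c' n \<sigma>. c n \<sigma> \<otimes>\<^bsub>R\<^esub> c' n \<sigma>), one = (\<lambda>n \<sigma>. \<one>\<^bsub>R\<^esub>)\<rparr>),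
      diff = (\<lambda>k c n. if k < 0 then (\<lambda>\<sigma>. \<one>\<^bsub>R\<^esub>) else coboundary R (total_space X n) (nat k) (c n))\<rparr>"

definition integration_map ::
    "'a simplicial_space \<Rightarrow> int \<Rightarrow> (nat \<Rightarrow> ((nat \<Rightarrow> real) \<times> 'a) form)
       \<Rightarrow> nat \<Rightarrow> ((nat \<Rightarrow> real) \<times> 'a, complex) cochain" where
  "integration_map X k \<omega> =
     (\<lambda>n \<sigma>. if k \<ge> 0 \<and> smooth_simplex (nat k) (total_space X n) \<sigma>
            then integral_simplex (nat k) (pullback_form (simplex_space (nat k)) (total_space X n) (nat k) \<sigma> (\<omega> n))
            else 0)"


section \<open>Differential characters and multiplicative cohomology\<close>

definition complex_group :: "complex monoid" where
  "complex_group = \<lparr>carrier = UNIV, monoid.mult = (+), one = 0\<rparr>"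

definition reduce_mod ::
    "complex set \<Rightarrow> (nat \<Rightarrow> ((nat \<Rightarrow> real) \<times> 'a, complex) cochain)
       \<Rightarrow> nat \<Rightarrow> ((nat \<Rightarrow> real) \<times> 'a, complex set) cochain" where
  "reduce_mod \<Lambda> c = (\<lambda>n \<sigma>. \<Lambda> #>\<^bsub>complex_group\<^esub> c n \<sigma>)"

text \<open>
  \<open>differential_characters X \<Lambda> m\<close> is the group with superscript \<open>m\<close>, defined by the cone
  in degree \<open>m + 1\<close>.
\<close>

definition differential_characters ::
    "'a simplicial_space \<Rightarrow> complex set \<Rightarrow> int \<Rightarrow>
       ((nat \<Rightarrow> ((nat \<Rightarrow> real) \<times> 'a) form) \<times> (nat \<Rightarrow> ((nat \<Rightarrow> real) \<times> 'a, complex set) cochain)) set monoid" where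
  "differential_characters X \<Lambda> m =
     cohomology
       (mapping_cone (truncation (m + 1) (de_rham_complex X)) (cochains (complex_group Mod \<Lambda>) X)
             (\<lambda>k \<omega>. reduce_mod \<Lambda> (integration_map X k \<omega>)))
       (m + 1)"

definition truncation_filtration ::
    "'a simplicial_space \<Rightarrow> int \<Rightarrow> (nat \<Rightarrow> ((nat \<Rightarrow> real) \<times> 'a) form) cochain_complex" where
  "truncation_filtration X p = truncation p (de_rham_complex X)"

text \<open>\<open>multiplicative_cohomology X \<Lambda> F r n\<close> is \<open>MH\<^sup>2\<^sup>r\<^sub>n(X; \<Lambda>; F)\<close>.\<close>

definition multiplicative_cohomology ::
    "'a simplicial_space \<Rightarrow> complex set \<Rightarrow> (int \<Rightarrow> (nat \<Rightarrow> ((nat \<Rightarrow> real) \<times> 'a) form) cochain_complex) \<Rightarrow>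
       int \<Rightarrow> int \<Rightarrow>
       (((nat \<Rightarrow> ((nat \<Rightarrow> real) \<times> 'a, complex) cochain) \<times> (nat \<Rightarrow> ((nat \<Rightarrow> real) \<times> 'a) form))
         \<times> (nat \<Rightarrow> ((nat \<Rightarrow> real) \<times> 'a, complex) cochain)) set monoid" where
  "multiplicative_cohomology X \<Lambda> F r n =
     cohomology
       (mapping_cone (direct_sum (cochains (complex_group\<lparr>carrier := \<Lambda>\<rparr>) X) (F r)) (cochains complex_group X)
             (\<lambda>k (c, \<omega>) m \<sigma>. c m \<sigma> - integration_map X k \<omega> m \<sigma>))
       (2 * r - n)"

end

theory Submission
  imports Defs
begin

text \<open>
  A class in \<open>MH\<close> is represented by \<open>((c, \<omega>), b)\<close> with \<open>\<plusminus>(c - I \<omega>) + \<delta> b = 0\<close>, and \<open>((c, \<omega>), b) \<mapsto> (\<omega>, [-b])\<close>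
  sends cycles to cycles of the cone that defines differential characters.  Conversely, a compatible
  cochain with values in \<open>\<complex>/\<Lambda>\<close> lifts to \<open>\<complex>\<close> by composition with any set-theoretic section, and the lift
  \<open>-b\<close> of the cochain in a cycle determines \<open>c = I \<omega> \<mp> \<delta> b\<close>, which is \<open>\<Lambda>\<close>-valued.  It is a compatible
  cocycle because integration is natural (the chain rule on manifolds with corners) and because
  \<open>\<delta> (I \<omega>) = 0\<close> for closed \<open>\<omega>\<close> (Stokes' theorem on the standard simplex).  In these degrees the truncation
  leaves no forms in the boundaries, so both quotients are taken by matching subgroups.
\<close>

section \<open>Calculus on coordinate spaces\<close>

text \<open>On \<open>\<Delta>\<^sup>n \<times> M\<close> smoothness means local extendability, and
  the derivative at a boundary point is a definite description ranging over all extensions. The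
  device that makes this computable is \<open>regular\<close>: every point of a chart region is a
  limit of interior points. It makes the derivative independent of the extension, gives the chain
  rule for \<open>partial_on\<close>, and lets identities between derivatives be checked at interior
  points, where second derivatives exist, and be carried to the boundary by continuity. Stokes'
  theorem is applied to cocycles, so the form in question is closed. The analytic core is thus that
  the coefficients of a closed form pulled back to a simplex have vanishing alternating sum of
  partial derivatives. The rest of Stokes is one-variable integration along each coordinate
  direction. The minus sign in \<open>[-b]\<close> comes from the two cone maps:
  \<open>I \<omega>\<close> occurs as \<open>c - I \<omega>\<close> in one cone and as
  \<open>I \<omega>\<close> in the other, and modulo \<Lambda> the cochain \<open>c\<close>
  disappears.\<close>

definition coords :: "nat \<Rightarrow> (nat \<Rightarrow> real) set" where
  "coords d = {x. \<forall>i\<ge>d. x i = 0}"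

text \<open>Boxes in the first \<open>d\<close> coordinates form a neighbourhood base of
  \<open>coords d\<close>, and a path that changes one coordinate at a time from the centre to a
  point of the box stays in it.\<close>

definition cube :: "nat \<Rightarrow> (nat \<Rightarrow> real) \<Rightarrow> real \<Rightarrow> (nat \<Rightarrow> real) set" where
  "cube d x e = {y \<in> coords d. \<forall>i<d. \<bar>y i - x i\<bar> < e}"

text \<open>Records existence together with the value; \<open>partial\<close> is a total function
  and carries no information where the coordinate line is not differentiable.\<close>

definition has_partial ::
    "nat \<Rightarrow> ((nat \<Rightarrow> real) \<Rightarrow> 'v::real_normed_vector) \<Rightarrow> 'v \<Rightarrow> (nat \<Rightarrow> real) \<Rightarrow> bool" where
  "has_partial i f D x \<longleftrightarrow> ((\<lambda>t. f (x(i := t))) has_vector_derivative D) (at (x i))"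

section \<open>Topology of the coordinate spaces\<close>

lemma topspace_coords: "topspace (Euclidean_space d) = coords d"
  by (simp add: topspace_Euclidean_space coords_def)

lemma Euclidean_space_coords: "Euclidean_space d = top_of_set (coords d)"
  by (simp add: Euclidean_space_def euclidean_product_topology coords_def)

lemma coords_upd: "x \<in> coords d \<Longrightarrow> i < d \<Longrightarrow> x(i := t) \<in> coords d"
  by (auto simp: coords_def)

lemma coords_ge: "x \<in> coords d \<Longrightarrow> d \<le> i \<Longrightarrow> x i = 0"
  by (auto simp: coords_def)

lemma openin_cube: "openin (Euclidean_space d) (cube d x e)"
proof -
  have "open {f::nat \<Rightarrow> real. \<forall>i\<in>{..<d}. f (id i) \<in> ball (x i) e}"
    by (rule product_topology_basis') auto
  moreover have "cube d x e = coords d \<inter> {f::nat \<Rightarrow> real. \<forall>i\<in>{..<d}. f (id i) \<in> ball (x i) e}"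
    by (auto simp: cube_def dist_real_def abs_minus_commute)
  ultimately show ?thesis
    by (auto simp: Euclidean_space_coords openin_open)
qed

text \<open>A basic open set around \<open>x\<close> leaves a positive radius in each coordinate.
  Only the first \<open>d\<close> radii count, because all points of \<open>coords d\<close> agree
  in the remaining coordinates, so their minimum works.\<close>

lemma openin_imp_cube:
  assumes "openin (Euclidean_space d) W" "x \<in> W"
  obtains e where "e > 0" "cube d x e \<subseteq> W"
proof -
  obtain T where T: "open T" "W = coords d \<inter> T"
    using assms by (auto simp: Euclidean_space_coords openin_open)
  then have "openin (product_topology (\<lambda>i. euclidean) UNIV) T" "x \<in> T"
    using assms by (auto simp: euclidean_product_topology)
  from product_topology_open_contains_basis[OF this]
  obtain X where X: "x \<in> (\<Pi>\<^sub>E i\<in>UNIV. X i)" "\<forall>i. open (X i)" "(\<Pi>\<^sub>E i\<in>UNIV. X i) \<subseteq> T"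
    by (metis open_openin)
  have "\<exists>e>0. \<forall>y. \<bar>y - x i\<bar> < e \<longrightarrow> y \<in> X i" for i
    using X by (auto simp: open_dist dist_real_def PiE_iff)
  then obtain r where r: "\<And>i. r i > 0" "\<And>i y. \<bar>y - x i\<bar> < r i \<Longrightarrow> y \<in> X i"
    by metis
  have Xd: "x i \<in> X i" for i using X by auto
  \<comment> \<open>The element \<open>1\<close> keeps the set nonempty when
    \<open>d = 0\<close>.\<close>
  define e where "e = Min (insert 1 (r ` {..<d}))"
  have "e > 0" unfolding e_def using r by (subst Min_gr_iff) auto
  have xc: "x \<in> coords d" using T assms by auto
  moreover have "cube d x e \<subseteq> W"
  proof
    fix y assume y: "y \<in> cube d x e"
    have "y i \<in> X i" for i
    proof (cases "i < d")
      case True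
      then have "e \<le> r i" unfolding e_def by (auto intro: Min_le)
      then show ?thesis using y True r(2)[of "y i" i] by (force simp: cube_def)
    next
      case False
      then have "y i = x i" using y xc by (auto simp: cube_def coords_def)
      then show ?thesis using Xd by simp
    qed
    then have "y \<in> T" using X by auto
    then show "y \<in> W" using T y by (auto simp: cube_def)
  qed
  ultimately show ?thesis using \<open>e > 0\<close> that by blast
qed

lemma cube_center: "x \<in> coords d \<Longrightarrow> e > 0 \<Longrightarrow> x \<in> cube d x e"
  by (auto simp: cube_def)

lemma cube_mono: "e \<le> e' \<Longrightarrow> cube d x e \<subseteq> cube d x e'"
  by (auto simp: cube_def)

lemma openin_coords_subset: "openin (Euclidean_space d) W \<Longrightarrow> W \<subseteq> coords d"
  by (metis openin_subset topspace_coords)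

lemma continuous_on_cubeD:
  fixes f :: "(nat \<Rightarrow> real) \<Rightarrow> 'v::metric_space"
  assumes "W \<subseteq> coords d" "continuous_on W f" "x \<in> W" "e > 0"
  obtains \<delta> where "\<delta> > 0" "\<And>y. y \<in> W \<Longrightarrow> y \<in> cube d x \<delta> \<Longrightarrow> dist (f y) (f x) < e"
proof -
  obtain T where T: "open T" "W \<inter> f -` ball (f x) e = T \<inter> W"
    using assms(2) continuous_on_open_invariant[of W f] open_ball by (metis Int_commute)
  have "openin (Euclidean_space d) (coords d \<inter> T)" "x \<in> coords d \<inter> T"
    using T assms by (auto simp: Euclidean_space_coords openin_open)
  then obtain r where "r > 0" "cube d x r \<subseteq> coords d \<inter> T"
    by (rule openin_imp_cube)
  moreover have "dist (f y) (f x) < e" if "y \<in> W" "y \<in> T" for y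
  proof -
    have "y \<in> W \<inter> f -` ball (f x) e" using that T(2) by blast
    then show ?thesis by (simp add: dist_commute)
  qed
  ultimately show ?thesis
    by (intro that[of r]) auto
qed

lemma continuous_on_cubeI:
  fixes f :: "(nat \<Rightarrow> real) \<Rightarrow> 'v::metric_space"
  assumes "W \<subseteq> coords d"
    and "\<And>x e. x \<in> W \<Longrightarrow> e > 0 \<Longrightarrow> \<exists>\<delta>>0. \<forall>y\<in>W \<inter> cube d x \<delta>. dist (f y) (f x) < e"
  shows "continuous_on W f"
  unfolding continuous_on_topological
proof (intro ballI allI impI)
  fix x B assume x: "x \<in> W" and B: "open B" "f x \<in> B"
  then obtain e where "e > 0" "ball (f x) e \<subseteq> B" by (auto simp: open_contains_ball)
  with assms(2)[OF x] obtain \<delta> where \<delta>: "\<delta> > 0" "\<forall>y\<in>W \<inter> cube d x \<delta>. f y \<in> B"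
    by (force simp: dist_commute)
  obtain T where "open T" "cube d x \<delta> = coords d \<inter> T"
    using openin_cube by (metis Euclidean_space_coords openin_open)
  then show "\<exists>A. open A \<and> x \<in> A \<and> (\<forall>y\<in>W. y \<in> A \<longrightarrow> f y \<in> B)"
    using \<delta> x assms(1) cube_center[of x d \<delta>] by (intro exI[of _ T]) blast
qed

section \<open>Partial derivatives and smooth functions on open sets\<close>

lemma has_partial_imp: "has_partial i f D x \<Longrightarrow> partial i f x = D"
  by (simp add: has_partial_def partial_def vector_derivative_at)

lemma line_in_open:
  assumes "openin (Euclidean_space d) W" "x \<in> W" "i < d"
  shows "\<forall>\<^sub>F t in nhds (x i). x(i := t) \<in> W"
proof -
  obtain e where e: "e > 0" "cube d x e \<subseteq> W" using assms openin_imp_cube by blast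
  have "x(i := t) \<in> W" if "dist t (x i) < e" for t
  proof -
    have "x \<in> coords d" using assms openin_coords_subset by blast
    then have "x(i := t) \<in> cube d x e"
      using that e(1) assms by (auto simp: cube_def coords_upd dist_real_def)
    then show ?thesis using e by blast
  qed
  then show ?thesis using e(1) unfolding eventually_nhds_metric by blast
qed

lemma has_partial_cong:
  assumes "has_partial i f D x" "openin (Euclidean_space d) W" "x \<in> W" "i < d"
    and "\<And>y. y \<in> W \<Longrightarrow> f y = g y"
  shows "has_partial i g D x"
proof -
  have "\<forall>\<^sub>F t in nhds (x i). f (x(i := t)) = g (x(i := t))"
    using line_in_open[OF assms(2-4)] by eventually_elim (use assms(5) in auto)
  then show ?thesis using assms(1) unfolding has_partial_def
    by (subst (asm) has_vector_derivative_cong_ev[where g="\<lambda>t. g (x(i := t))"])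
       (auto elim: eventually_mono dest: eventually_nhds_x_imp_x)
qed

text \<open>For open \<open>W\<close> the nested subtopologies collapse to the subspace topology of
  the function space, which makes \<open>continuous_on\<close> available.\<close>

lemma smooth_on_open_alt:
  "smooth_on_open d W f \<longleftrightarrow> openin (Euclidean_space d) W \<and>
     (\<forall>is \<in> lists {..<d}. continuous_on W (partials is f) \<and>
        (\<forall>x\<in>W. \<forall>i<d. has_partial i (partials is f) (partial i (partials is f) x) x))"
proof -
  have "subtopology (Euclidean_space d) W = top_of_set W" if "openin (Euclidean_space d) W"
    using openin_coords_subset[OF that]
    by (simp add: Euclidean_space_coords subtopology_subtopology Int_absorb1)
  then show ?thesis
    unfolding smooth_on_open_def has_partial_def partial_def
    by (auto simp: vector_derivative_works)
qed

lemma smooth_on_open_openin: "smooth_on_open d W f \<Longrightarrow> openin (Euclidean_space d) W"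
  by (simp add: smooth_on_open_def)

lemma smooth_on_open_has_partial:
  assumes "smooth_on_open d W f" "x \<in> W" "i < d"
  shows "has_partial i f (partial i f x) x"
  using assms lists.Nil[of "{..<d}"] unfolding smooth_on_open_alt by (metis partials.simps(1))

lemma smooth_on_open_continuous: "smooth_on_open d W f \<Longrightarrow> continuous_on W f"
  using lists.Nil[of "{..<d}"] unfolding smooth_on_open_alt by (metis partials.simps(1))

lemma partials_append: "partials (is @ js) f = partials is (partials js f)"
  by (induction "is") auto

lemma smooth_on_open_partial:
  assumes "smooth_on_open d W f" "i < d"
  shows "smooth_on_open d W (partial i f)"
proof -
  \<comment> \<open>The last index of the list is differentiated first, so \<open>i\<close> is
    appended at the end.\<close>
  have "partials is (partial i f) = partials (is @ [i]) f" for "is"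
    by (simp add: partials_append)
  moreover have "is @ [i] \<in> lists {..<d}" if "is \<in> lists {..<d}" for "is"
    using that assms(2) by auto
  ultimately show ?thesis
    using assms(1) unfolding smooth_on_open_alt by metis
qed

text \<open>Smoothness by coinduction: \<open>S\<close> consists of continuous functions and is
  closed under partial differentiation on \<open>W\<close>, so by induction on the index list every
  iterated partial derivative of \<open>f\<close> agrees on \<open>W\<close> with a member of
  \<open>S\<close>.\<close>

lemma smooth_on_open_coinduct:
  assumes W: "openin (Euclidean_space d) W" and f: "f \<in> S"
    and S: "\<And>f. f \<in> S \<Longrightarrow> continuous_on W f"
    and S': "\<And>f i. f \<in> S \<Longrightarrow> i < d \<Longrightarrow> \<exists>f'\<in>S. \<forall>x\<in>W. has_partial i f (f' x) x"
  shows "smooth_on_open d W f"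
proof -
  have *: "\<exists>f'\<in>S. \<forall>x\<in>W. partials is f x = f' x" if "is \<in> lists {..<d}" for "is"
    using that
  proof (induction "is")
    case Nil then show ?case using f by auto
  next
    case (Cons i "is")
    then obtain f' where f': "f' \<in> S" "\<forall>x\<in>W. partials is f x = f' x" by auto
    have "i < d" using Cons by auto
    obtain f'' where f'': "f'' \<in> S" "\<forall>x\<in>W. has_partial i f' (f'' x) x"
      using S'[OF f'(1) \<open>i < d\<close>] by blast
    have "has_partial i (partials is f) (f'' x) x" if "x \<in> W" for x
      using has_partial_cong[OF _ W that \<open>i < d\<close>, of f' "f'' x" "partials is f"] f'' f' that by auto
    then show ?case using f''(1) by (auto dest: has_partial_imp)
  qed
  show ?thesis
    unfolding smooth_on_open_alt
  proof (intro conjI ballI allI impI W)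
    fix "is" assume "is \<in> lists {..<d}"
    then obtain f' where f': "f' \<in> S" "\<forall>x\<in>W. partials is f x = f' x" using * by blast
    show "continuous_on W (partials is f)"
      using S[OF f'(1)] f'(2) by (simp cong: continuous_on_cong)
    fix x i assume x: "x \<in> W" and i: "i < d"
    obtain f'' where "has_partial i f' (f'' x) x" using S'[OF f'(1) i] x by blast
    then have "has_partial i (partials is f) (f'' x) x"
      using has_partial_cong[OF _ W x i, of f' "f'' x" "partials is f"] f' by auto
    then show "has_partial i (partials is f) (partial i (partials is f) x) x"
      using has_partial_imp by metis
  qed
qed

lemma smooth_on_open_mono:
  assumes "smooth_on_open d W f" "openin (Euclidean_space d) V" "V \<subseteq> W"
  shows "smooth_on_open d V f"
  using assms unfolding smooth_on_open_alt by (meson continuous_on_subset subsetD)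

lemma smooth_on_open_const:
  assumes "openin (Euclidean_space d) W"
  shows "smooth_on_open d W (\<lambda>_. c)"
  by (rule smooth_on_open_coinduct[where S="range (\<lambda>c _. c)"])
     (use assms in \<open>auto simp: has_partial_def intro!: exI[of _ 0]\<close>)

lemma smooth_on_open_coord:
  assumes "openin (Euclidean_space d) W"
  shows "smooth_on_open d W (\<lambda>x. x j)"
proof (rule smooth_on_open_coinduct[where S="insert (\<lambda>x. x j) (range (\<lambda>c _. c))"])
  fix f :: "(nat \<Rightarrow> real) \<Rightarrow> real" and i assume f: "f \<in> insert (\<lambda>x. x j) (range (\<lambda>c _. c))"
  show "continuous_on W f"
    using f by (auto intro: continuous_on_subset[OF continuous_on_product_coordinates])
  have "has_partial i (\<lambda>x. x j) (if i = j then 1 else 0) x" for x :: "nat \<Rightarrow> real"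
    by (auto simp: has_partial_def fun_upd_def)
  moreover have "has_partial i (\<lambda>_. c::real) 0 x" for c x
    by (auto simp: has_partial_def)
  ultimately have "\<forall>x\<in>W. has_partial i f (if f = (\<lambda>x. x j) \<and> i = j then 1 else 0) x"
    using f by (cases "f = (\<lambda>x. x j)") auto
  then show "\<exists>f'\<in>insert (\<lambda>x. x j) (range (\<lambda>c _. c)). \<forall>x\<in>W. has_partial i f (f' x) x"
    by (rule bexI[of _ "\<lambda>_. if f = (\<lambda>x. x j) \<and> i = j then 1 else 0"]) auto
qed (use assms in auto)

text \<open>Telescoping through the points that agree with \<open>y\<close> in the first \<open>j\<close> coordinates and with \<open>x\<close> in the others.\<close>

lemma hadamard_quotients:
  fixes h :: "(nat \<Rightarrow> real) \<Rightarrow> 'v::real_normed_vector"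
  assumes W: "openin (Euclidean_space d) W" "x \<in> W"
    and p: "\<And>j y. j < d \<Longrightarrow> y \<in> W \<Longrightarrow> has_partial j h (p j y) y"
    and cont: "\<And>j. j < d \<Longrightarrow> continuous_on W (p j)"
  obtains q where "\<And>y. y \<in> coords d \<Longrightarrow> h y - h x = (\<Sum>j<d. (y j - x j) *\<^sub>R q j y)"
    "\<And>j e. j < d \<Longrightarrow> e > 0 \<Longrightarrow> \<exists>\<delta>>0. \<forall>y\<in>cube d x \<delta>. norm (q j y - p j x) < e"
proof
  define z where "z j y = (\<lambda>i. if i < j then y i else x i)" for j and y :: "nat \<Rightarrow> real"
  \<comment> \<open>The quotient is undefined on the hyperplane \<open>y j = x j\<close>; the value
    \<open>p j x\<close> chosen there makes \<open>q j\<close> continuous at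
    \<open>x\<close>.\<close>
  define q where "q j y = (if y j = x j then p j x else (h (z (Suc j) y) - h (z j y)) /\<^sub>R (y j - x j))"
    for j y
  have xc: "x \<in> coords d" using W openin_coords_subset by blast
  have zS: "z (Suc j) y = (z j y)(j := y j)" for j y
    by (auto simp: z_def)
  have z0: "z j y = (z j y)(j := x j)" for j y
    by (auto simp: z_def)
  show "h y - h x = (\<Sum>j<d. (y j - x j) *\<^sub>R q j y)" if "y \<in> coords d" for y
  proof -
    have "z d y = y" "z 0 y = x"
      using that xc by (auto simp: z_def coords_def)
    then have "h y - h x = (\<Sum>j<d. h (z (Suc j) y) - h (z j y))"
      by (simp add: sum_lessThan_telescope[of "\<lambda>j. h (z j y)"])
    also have "\<dots> = (\<Sum>j<d. (y j - x j) *\<^sub>R q j y)"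
      by (intro sum.cong refl) (auto simp: q_def zS z0[symmetric] intro: arg_cong[where f=h] z0)
    finally show ?thesis .
  qed
  show "\<exists>\<delta>>0. \<forall>y\<in>cube d x \<delta>. norm (q j y - p j x) < e" if j: "j < d" and e: "e > 0" for j e
  proof -
    obtain \<delta>1 where \<delta>1: "\<delta>1 > 0" "\<And>y. y \<in> W \<Longrightarrow> y \<in> cube d x \<delta>1 \<Longrightarrow> dist (p j y) (p j x) < e/2"
      using continuous_on_cubeD[OF openin_coords_subset[OF W(1)] cont[OF j] W(2), of "e/2"] e by auto
    obtain \<delta>2 where \<delta>2: "\<delta>2 > 0" "cube d x \<delta>2 \<subseteq> W" using openin_imp_cube[OF W] .
    define \<delta> where "\<delta> = min \<delta>1 \<delta>2"
    have \<delta>: "\<delta> > 0" "\<And>y. y \<in> cube d x \<delta> \<Longrightarrow> y \<in> W \<and> norm (p j y - p j x) < e/2"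
      using \<delta>1 \<delta>2 cube_mono[of \<delta> \<delta>1] cube_mono[of \<delta> \<delta>2] unfolding \<delta>_def dist_norm by (auto simp: subset_iff)
    have "norm (q j y - p j x) < e" if y: "y \<in> cube d x \<delta>" for y
    proof (cases "y j = x j")
      case True then show ?thesis using e by (simp add: q_def)
    next
      case False
      let ?w = "\<lambda>t. (z j y)(j := t)"
      let ?S = "closed_segment (x j) (y j)"
      have w: "?w t \<in> cube d x \<delta>" if "t \<in> ?S" for t
      proof -
        have "\<bar>t - x j\<bar> \<le> \<bar>y j - x j\<bar>" using that
          by (auto simp: closed_segment_eq_real_ivl split: if_splits)
        moreover have "\<bar>y j - x j\<bar> < \<delta>" using y j by (auto simp: cube_def)
        ultimately show ?thesis using y xc j \<delta>(1)
          by (auto simp: cube_def z_def coords_def)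
      qed
      \<comment> \<open>After subtraction of the linear term \<open>t *\<^sub>R p j x\<close> the
        derivative along the segment has norm at most \<open>e/2\<close>. The mean value inequality,
        which holds for vector-valued functions, then bounds the distance of the quotient from
        \<open>p j x\<close>.\<close>
      have d1: "((\<lambda>t. h (?w t) - t *\<^sub>R p j x) has_derivative (\<lambda>s. s *\<^sub>R (p j (?w t) - p j x)))
              (at t within ?S)" if "t \<in> ?S" for t
      proof -
        have "has_partial j h (p j (?w t)) (?w t)" using p[OF j] \<delta>(2) w[OF that] by blast
        then have "((\<lambda>t. h (?w t)) has_vector_derivative p j (?w t)) (at t)"
          by (simp add: has_partial_def)
        then have "((\<lambda>t. h (?w t) - t *\<^sub>R p j x) has_vector_derivative p j (?w t) - p j x) (at t)"
          by (auto intro!: derivative_eq_intros)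
        then show ?thesis unfolding has_vector_derivative_def by (rule has_derivative_at_withinI)
      qed
      have "norm ((h (?w (y j)) - y j *\<^sub>R p j x) - (h (?w (x j)) - x j *\<^sub>R p j x)) \<le> e/2 * norm (y j - x j)"
      proof (rule differentiable_bound[OF _ d1])
        show "onorm (\<lambda>s. s *\<^sub>R (p j (?w t) - p j x)) \<le> e/2" if "t \<in> ?S" for t
        proof (rule onorm_le)
          fix s :: real
          have "norm (p j (?w t) - p j x) \<le> e/2" using \<delta>(2)[OF w[OF that]] by simp
          then have "\<bar>s\<bar> * norm (p j (?w t) - p j x) \<le> \<bar>s\<bar> * (e/2)"
            by (intro mult_left_mono) auto
          then show "norm (s *\<^sub>R (p j (?w t) - p j x)) \<le> e/2 * norm s"
            by (simp only: norm_scaleR real_norm_def mult.commute)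
        qed
      qed auto
      then have le: "norm ((h (?w (y j)) - h (?w (x j))) - (y j - x j) *\<^sub>R p j x) \<le> e/2 * \<bar>y j - x j\<bar>"
        by (simp add: algebra_simps)
      have "q j y - p j x = ((h (?w (y j)) - h (?w (x j))) - (y j - x j) *\<^sub>R p j x) /\<^sub>R (y j - x j)"
        using False by (simp add: q_def zS z0[symmetric] scaleR_diff_right)
      then have "norm (q j y - p j x)
          = norm ((h (?w (y j)) - h (?w (x j))) - (y j - x j) *\<^sub>R p j x) / \<bar>y j - x j\<bar>"
        by (simp add: divide_inverse_commute)
      also have "\<dots> \<le> e/2"
        using le False by (subst pos_divide_le_eq) auto
      finally have "norm (q j y - p j x) \<le> e/2" .
      then show ?thesis using e by simp
    qed
    then show ?thesis using \<delta>(1) by blast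
  qed
qed

text \<open>By the Hadamard quotients, the difference quotient of \<open>h\<close> along \<gamma> is
  the sum of the difference quotients of the coordinates times \<open>q j (\<gamma> t)\<close>, and
  both factors converge. The set \<open>S\<close> admits one-sided derivatives.\<close>

lemma chain_rule_curve:
  fixes h :: "(nat \<Rightarrow> real) \<Rightarrow> 'v::real_normed_vector"
  assumes h: "smooth_on_open d W h"
    and \<gamma>: "\<gamma> t0 \<in> W" "\<forall>\<^sub>F t in at t0 within S. \<gamma> t \<in> coords d"
    and \<gamma>': "\<And>j. j < d \<Longrightarrow> ((\<lambda>t. \<gamma> t j) has_vector_derivative \<gamma>' j) (at t0 within S)"
  shows "((\<lambda>t. h (\<gamma> t)) has_vector_derivative (\<Sum>j<d. \<gamma>' j *\<^sub>R partial j h (\<gamma> t0))) (at t0 within S)"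
proof -
  let ?x = "\<gamma> t0"
  obtain q where q: "\<And>y. y \<in> coords d \<Longrightarrow> h y - h ?x = (\<Sum>j<d. (y j - ?x j) *\<^sub>R q j y)"
    "\<And>j e. j < d \<Longrightarrow> e > 0 \<Longrightarrow> \<exists>\<delta>>0. \<forall>y\<in>cube d ?x \<delta>. norm (q j y - partial j h ?x) < e"
  proof (rule hadamard_quotients[OF smooth_on_open_openin[OF h] \<gamma>(1)])
    show "has_partial j h (partial j h y) y" if "j < d" "y \<in> W" for j y
      using smooth_on_open_has_partial[OF h] that by blast
    show "continuous_on W (partial j h)" if "j < d" for j
      using smooth_on_open_continuous[OF smooth_on_open_partial[OF h that]] .
  qed blast
  have c\<gamma>: "tendsto (\<lambda>t. \<gamma> t j) (?x j) (at t0 within S)" if "j < d" for j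
    using has_vector_derivative_continuous[OF \<gamma>'[OF that]] by (simp add: continuous_within)
  have incube: "\<forall>\<^sub>F t in at t0 within S. \<gamma> t \<in> cube d ?x \<delta>" if "\<delta> > 0" for \<delta>
  proof -
    have "\<forall>\<^sub>F t in at t0 within S. \<forall>j\<in>{..<d}. \<bar>\<gamma> t j - ?x j\<bar> < \<delta>"
      using tendstoD[OF c\<gamma> that] by (intro eventually_ball_finite) (auto simp: dist_real_def)
    with \<gamma>(2) show ?thesis by eventually_elim (auto simp: cube_def)
  qed
  have qt: "tendsto (\<lambda>t. q j (\<gamma> t)) (partial j h ?x) (at t0 within S)" if j: "j < d" for j
  proof (rule tendstoI)
    fix e :: real assume "e > 0"
    then obtain \<delta> where "\<delta> > 0" "\<forall>y\<in>cube d ?x \<delta>. norm (q j y - partial j h ?x) < e"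
      using q(2)[OF j] by blast
    then show "\<forall>\<^sub>F t in at t0 within S. dist (q j (\<gamma> t)) (partial j h ?x) < e"
      using incube[of \<delta>] by (auto elim!: eventually_mono simp: dist_norm)
  qed
  have dq: "tendsto (\<lambda>t. (\<gamma> t j - ?x j) / (t - t0)) (\<gamma>' j) (at t0 within S)" if "j < d" for j
    using \<gamma>'[OF that] by (simp add: has_real_derivative_iff_has_vector_derivative[symmetric] has_field_derivative_iff)
  have lim: "tendsto (\<lambda>t. \<Sum>j<d. ((\<gamma> t j - ?x j) / (t - t0)) *\<^sub>R q j (\<gamma> t)) ((\<Sum>j<d. \<gamma>' j *\<^sub>R partial j h ?x)) (at t0 within S)"
    by (intro tendsto_sum tendsto_scaleR dq qt) auto
  let ?D = "\<Sum>j<d. \<gamma>' j *\<^sub>R partial j h ?x"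
  have "tendsto (\<lambda>t. (h (\<gamma> t) - h ?x) /\<^sub>R (t - t0)) (?D) (at t0 within S)"
    using lim
  proof (rule Lim_transform_eventually)
    show "\<forall>\<^sub>F t in at t0 within S. (\<Sum>j<d. ((\<gamma> t j - ?x j) / (t - t0)) *\<^sub>R q j (\<gamma> t)) = (h (\<gamma> t) - h ?x) /\<^sub>R (t - t0)"
      using \<gamma>(2) by eventually_elim (simp add: q(1) scaleR_sum_right divide_inverse_commute)
  qed
  then have "tendsto (\<lambda>t. norm ((h (\<gamma> t) - h ?x) /\<^sub>R (t - t0) - ?D)) (0) (at t0 within S)"
    by (simp add: LIM_zero_iff tendsto_norm_zero_iff)
  then have "tendsto (\<lambda>t. norm ((h (\<gamma> t) - h ?x) - (t - t0) *\<^sub>R ?D) / norm (t - t0)) (0) (at t0 within S)"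
  proof (rule Lim_transform_eventually)
    have "norm (v /\<^sub>R s - ?D) = norm (v - s *\<^sub>R ?D) / norm s" if "s \<noteq> 0" for v and s :: real
    proof -
      have "v - s *\<^sub>R ?D = s *\<^sub>R (v /\<^sub>R s - ?D)" using that by (simp add: scaleR_diff_right)
      then show ?thesis using that by simp
    qed
    then show "\<forall>\<^sub>F t in at t0 within S. norm ((h (\<gamma> t) - h ?x) /\<^sub>R (t - t0) - ?D)
        = norm ((h (\<gamma> t) - h ?x) - (t - t0) *\<^sub>R ?D) / norm (t - t0)"
      by (auto simp: eventually_at_filter)
  qed
  then show ?thesis
    by (simp add: has_vector_derivative_def has_derivative_iff_norm bounded_linear_scaleR_left)
qed

text \<open>Schwarz's theorem. Two applications of the mean value theorem write the second
  difference of \<open>g\<close> over a small square as the area times either mixed derivative at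
  some point of a neighbouring cube. Continuity of both mixed derivatives finishes the argument as
  the square shrinks.\<close>

lemma partial_commute:
  fixes g :: "(nat \<Rightarrow> real) \<Rightarrow> real"
  assumes g: "smooth_on_open d W g" and x: "x \<in> W" and ij: "i < d" "j < d"
  shows "partial i (partial j g) x = partial j (partial i g) x"
proof (cases "i = j")
  case False
  have W: "openin (Euclidean_space d) W" using g smooth_on_open_openin by blast
  then have xc: "x \<in> coords d" using x openin_coords_subset by blast
  obtain r where r: "r > 0" "cube d x r \<subseteq> W" using openin_imp_cube[OF W x] .
  let ?pt = "\<lambda>s t. x(i := x i + s, j := x j + t)"
  have pt: "?pt s t \<in> cube d x e" if "\<bar>s\<bar> < e" "\<bar>t\<bar> < e" for s t e
    using that xc ij by (auto simp: cube_def coords_def)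
  have der: "((\<lambda>t. f (y(k := a + t))) has_real_derivative partial k f (y(k := a + t))) (at t)"
    if "smooth_on_open d W f" "k < d" "y(k := a + t) \<in> W" for f :: "_ \<Rightarrow> real" and k y a t
  proof -
    have "((\<lambda>u. f (y(k := u))) has_real_derivative partial k f (y(k := a + t))) (at (a + t))"
      using smooth_on_open_has_partial[OF that(1,3,2)]
      by (simp add: has_partial_def has_real_derivative_iff_has_vector_derivative)
    then show ?thesis
      using DERIV_shift[of "\<lambda>u. f (y(k := u))" _ t a] by (simp add: add.commute)
  qed
  have mvt: "\<exists>w\<in>cube d x e. partial a (partial b g) w * (s * s) =
        g (x(a := x a + s, b := x b + s)) - g (x(a := x a + s)) - g (x(b := x b + s)) + g x"
    if s: "0 < s" "s < e" "e \<le> r" and ab: "a < d" "b < d" "a \<noteq> b" for a b s e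
  proof -
    have inc: "x(a := x a + u, b := x b + v) \<in> cube d x e" if "0 \<le> u" "u \<le> s" "0 \<le> v" "v \<le> s" for u v
      using that s xc ab by (auto simp: cube_def coords_def)
    then have inW: "x(a := x a + u, b := x b + v) \<in> W" if "0 \<le> u" "u \<le> s" "0 \<le> v" "v \<le> s" for u v
      using that r s cube_mono[of e r d x] by blast
    let ?\<phi> = "\<lambda>v. g (x(a := x a + s, b := x b + v)) - g (x(a := x a + 0, b := x b + v))"
    let ?\<phi>' = "\<lambda>v. partial b g (x(a := x a + s, b := x b + v)) - partial b g (x(a := x a + 0, b := x b + v))"
    have D1: "(?\<phi> has_real_derivative ?\<phi>' v) (at v)" if "0 \<le> v" "v \<le> s" for v
      using der[OF g ab(2), of "x(a := x a + s)" "x b" v] der[OF g ab(2), of "x(a := x a + 0)" "x b" v]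
        inW[of s v] inW[of 0 v] that s by (intro DERIV_diff) simp_all
    have "\<exists>v>0. v < s \<and> ?\<phi> s - ?\<phi> 0 = (s - 0) * ?\<phi>' v"
      using s by (intro MVT2 D1) auto
    then obtain v where v: "0 < v" "v < s" "?\<phi> s - ?\<phi> 0 = s * ?\<phi>' v" by auto
    let ?\<psi> = "\<lambda>u. partial b g (x(b := x b + v, a := x a + u))"
    let ?\<psi>' = "\<lambda>u. partial a (partial b g) (x(b := x b + v, a := x a + u))"
    have tw: "x(b := p, a := q) = x(a := q, b := p)" for p q
      using ab by (simp add: fun_upd_twist)
    have D2: "(?\<psi> has_real_derivative ?\<psi>' u) (at u)" if "0 \<le> u" "u \<le> s" for u
      using der[OF smooth_on_open_partial[OF g ab(2)] ab(1), of "x(b := x b + v)" "x a" u]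
        inW[of u v] that s v by (simp add: tw)
    have "\<exists>u>0. u < s \<and> ?\<psi> s - ?\<psi> 0 = (s - 0) * ?\<psi>' u"
      using s by (intro MVT2 D2) auto
    then obtain u where u: "0 < u" "u < s" "?\<psi> s - ?\<psi> 0 = s * ?\<psi>' u" by auto
    have "?\<phi> s - ?\<phi> 0 = s * (s * ?\<psi>' u)"
      using v(3) u(3) by (simp add: tw)
    then show ?thesis
      using inc[of u v] u v ab fun_upd_idem[of "x(a := x a + s)" b "x b"]
      by (intro bexI[of _ "x(b := x b + v, a := x a + u)"]) (auto simp: tw algebra_simps)
  qed
  have "dist (partial i (partial j g) x) (partial j (partial i g) x) < e" if e: "e > 0" for e
  proof -
    have c: "continuous_on W (partial i (partial j g))" "continuous_on W (partial j (partial i g))"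
      using smooth_on_open_continuous smooth_on_open_partial g ij by blast+
    obtain d1 where d1: "d1 > 0" "\<And>y. y \<in> W \<Longrightarrow> y \<in> cube d x d1 \<Longrightarrow>
        dist (partial i (partial j g) y) (partial i (partial j g) x) < e/2"
      using continuous_on_cubeD[OF openin_coords_subset[OF W] c(1) x, of "e/2"] e by auto
    obtain d2 where d2: "d2 > 0" "\<And>y. y \<in> W \<Longrightarrow> y \<in> cube d x d2 \<Longrightarrow>
        dist (partial j (partial i g) y) (partial j (partial i g) x) < e/2"
      using continuous_on_cubeD[OF openin_coords_subset[OF W] c(2) x, of "e/2"] e by auto
    define m where "m = min r (min d1 d2)"
    have m: "m > 0" "m \<le> r" "m \<le> d1" "m \<le> d2" using r d1 d2 by (auto simp: m_def)
    obtain w1 where w1: "w1 \<in> cube d x m" "partial i (partial j g) w1 * (m/2 * (m/2)) =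
        g (x(i := x i + m/2, j := x j + m/2)) - g (x(i := x i + m/2)) - g (x(j := x j + m/2)) + g x"
      using mvt[of "m/2" m i j] m ij False by auto
    obtain w2 where w2: "w2 \<in> cube d x m" "partial j (partial i g) w2 * (m/2 * (m/2)) =
        g (x(j := x j + m/2, i := x i + m/2)) - g (x(j := x j + m/2)) - g (x(i := x i + m/2)) + g x"
      using mvt[of "m/2" m j i] m ij False by auto
    have "partial i (partial j g) w1 * (m/2 * (m/2)) = partial j (partial i g) w2 * (m/2 * (m/2))"
      using w1(2) w2(2) fun_upd_twist[OF False, of x] by simp
    then have "partial i (partial j g) w1 = partial j (partial i g) w2" using m(1) by simp
    moreover have "dist (partial i (partial j g) w1) (partial i (partial j g) x) < e/2"
      using d1(2)[of w1] w1(1) m r(2) cube_mono[of m r d x] cube_mono[of m d1 d x] by blast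
    moreover have "dist (partial j (partial i g) w2) (partial j (partial i g) x) < e/2"
      using d2(2)[of w2] w2(1) m r(2) cube_mono[of m r d x] cube_mono[of m d2 d x] by blast
    ultimately show ?thesis unfolding dist_real_def by linarith
  qed
  then show ?thesis by (metis dist_eq_0_iff less_irrefl zero_less_dist_iff)
qed simp

text \<open>If all first partial derivatives of the generators lie in the algebra they generate, the
  algebra is closed under partial derivatives, hence consists of smooth functions.\<close>

inductive_set fun_algebra :: "('a \<Rightarrow> 'v::real_normed_field) set \<Rightarrow> ('a \<Rightarrow> 'v) set"
  for B :: "('a \<Rightarrow> 'v) set" where
  gen: "b \<in> B \<Longrightarrow> b \<in> fun_algebra B"
| add: "f \<in> fun_algebra B \<Longrightarrow> g \<in> fun_algebra B \<Longrightarrow> (\<lambda>x. f x + g x) \<in> fun_algebra B"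
| mult: "f \<in> fun_algebra B \<Longrightarrow> g \<in> fun_algebra B \<Longrightarrow> (\<lambda>x. f x * g x) \<in> fun_algebra B"

lemma fun_algebra_sum:
  assumes "(\<lambda>_. 0) \<in> fun_algebra B" "\<And>i. i \<in> I \<Longrightarrow> f i \<in> fun_algebra B"
  shows "(\<lambda>x. \<Sum>i\<in>I. f i x) \<in> fun_algebra B"
  using assms(2) by (induction I rule: infinite_finite_induct) (use assms(1) in \<open>auto intro: fun_algebra.add\<close>)

lemma smooth_on_open_fun_algebra:
  assumes W: "openin (Euclidean_space d) W" and f: "f \<in> fun_algebra B"
    and c: "\<And>b. b \<in> B \<Longrightarrow> continuous_on W b"
    and D: "\<And>b i. b \<in> B \<Longrightarrow> i < d \<Longrightarrow> \<exists>b'\<in>fun_algebra B. \<forall>x\<in>W. has_partial i b (b' x) x"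
  shows "smooth_on_open d W f"
proof (rule smooth_on_open_coinduct[OF W f])
  show "continuous_on W f" if "f \<in> fun_algebra B" for f
    using that by induction (auto intro: c continuous_intros)
  show "\<exists>f'\<in>fun_algebra B. \<forall>x\<in>W. has_partial i f (f' x) x" if "f \<in> fun_algebra B" and i: "i < d" for f i
    using that(1)
  proof induction
    case (gen b) then show ?case using D i by blast
  next
    case (add f g)
    then obtain f' g' where "f' \<in> fun_algebra B" "g' \<in> fun_algebra B"
      "\<forall>x\<in>W. has_partial i f (f' x) x" "\<forall>x\<in>W. has_partial i g (g' x) x" by auto
    then show ?case
      by (intro bexI[of _ "\<lambda>x. f' x + g' x"] fun_algebra.add)
         (auto simp: has_partial_def intro: has_vector_derivative_add)
  next
    case (mult f g)
    then obtain f' g' where *: "f' \<in> fun_algebra B" "g' \<in> fun_algebra B"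
      "\<forall>x\<in>W. has_partial i f (f' x) x" "\<forall>x\<in>W. has_partial i g (g' x) x" by auto
    have "has_partial i (\<lambda>x. f x * g x) (f x * g' x + f' x * g x) x" if "x \<in> W" for x
      using has_vector_derivative_mult[of "\<lambda>t. f (x(i := t))" "f' x" "x i" UNIV "\<lambda>t. g (x(i := t))" "g' x"] * that
      by (simp add: has_partial_def)
    then show ?case using * mult
      by (intro bexI[of _ "\<lambda>x. f x * g' x + f' x * g x"] fun_algebra.add fun_algebra.mult) auto
  qed
qed

lemma smooth_on_open_algebra:
  assumes "openin (Euclidean_space d) W" "f \<in> fun_algebra {f. smooth_on_open d W f}"
  shows "smooth_on_open d W f"
  using assms(1) assms(2)
proof (rule smooth_on_open_fun_algebra)
  show "\<exists>b'\<in>fun_algebra {f. smooth_on_open d W f}. \<forall>x\<in>W. has_partial i b (b' x) x"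
    if "b \<in> {f. smooth_on_open d W f}" "i < d" for b i
    using that smooth_on_open_partial[of d W b i] smooth_on_open_has_partial[of d W b]
    by (intro bexI[of _ "partial i b"]) (auto intro: fun_algebra.gen)
qed (auto intro: smooth_on_open_continuous)

section \<open>Closure properties of smooth functions on open sets\<close>

lemma smooth_on_open_add:
  fixes f g :: "_ \<Rightarrow> 'v::real_normed_field"
  assumes "smooth_on_open d W f" "smooth_on_open d W g"
  shows "smooth_on_open d W (\<lambda>x. f x + g x)"
  using assms by (intro smooth_on_open_algebra) (auto intro: fun_algebra.intros smooth_on_open_openin)

lemma smooth_on_open_mult:
  fixes f g :: "_ \<Rightarrow> 'v::real_normed_field"
  assumes "smooth_on_open d W f" "smooth_on_open d W g"
  shows "smooth_on_open d W (\<lambda>x. f x * g x)"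
  using assms by (intro smooth_on_open_algebra) (auto intro: fun_algebra.intros smooth_on_open_openin)

lemma smooth_on_open_sum:
  fixes f :: "_ \<Rightarrow> _ \<Rightarrow> 'v::real_normed_field"
  assumes "openin (Euclidean_space d) W" "\<And>i. i \<in> I \<Longrightarrow> smooth_on_open d W (f i)"
  shows "smooth_on_open d W (\<lambda>x. \<Sum>i\<in>I. f i x)"
  using assms by (intro smooth_on_open_algebra fun_algebra_sum) (auto intro: fun_algebra.gen smooth_on_open_const)

text \<open>In the chain rule, derivatives of real coordinate functions multiply values in a larger
  field; this embeds them into the algebra of functions with such values.\<close>

lemma smooth_on_open_of_real:
  assumes "smooth_on_open d W f"
  shows "smooth_on_open d W (\<lambda>x. of_real (f x) :: 'v::real_normed_field)"
proof (rule smooth_on_open_coinduct[where S="{\<lambda>x. of_real (f x) |f. smooth_on_open d W f}"])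
  fix h :: "_ \<Rightarrow> 'v" and i assume "h \<in> {\<lambda>x. of_real (f x) |f. smooth_on_open d W f}"
  then obtain f where f: "smooth_on_open d W f" "h = (\<lambda>x. of_real (f x))" by auto
  then show "continuous_on W h" by (auto intro: continuous_on_of_real smooth_on_open_continuous)
  assume i: "i < d"
  have "has_partial i h (of_real (partial i f x)) x" if "x \<in> W" for x
    using has_vector_derivative_of_real[of "\<lambda>t. f (x(i := t))" "partial i f x" "at (x i)"]
      smooth_on_open_has_partial[OF f(1) that i] f(2)
    by (simp add: has_partial_def has_real_derivative_iff_has_vector_derivative)
  then show "\<exists>f'\<in>{\<lambda>x. of_real (f x) |f. smooth_on_open d W f}. \<forall>x\<in>W. has_partial i h (f' x) x"
    using smooth_on_open_partial[OF f(1) i] by (intro bexI[of _ "\<lambda>x. of_real (partial i f x)"]) auto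
qed (use assms smooth_on_open_openin in auto)

lemma has_partial_compose:
  fixes h :: "(nat \<Rightarrow> real) \<Rightarrow> 'v::real_normed_vector"
  assumes h: "smooth_on_open d' V h" and W: "openin (Euclidean_space d) W"
    and G: "\<And>j. j < d' \<Longrightarrow> smooth_on_open d W (\<lambda>x. G x j)"
    and GV: "\<And>x. x \<in> W \<Longrightarrow> G x \<in> V" and x: "x \<in> W" and i: "i < d"
  shows "has_partial i (\<lambda>x. h (G x)) (\<Sum>j<d'. partial i (\<lambda>x. G x j) x *\<^sub>R partial j h (G x)) x"
proof -
  have V: "V \<subseteq> coords d'" using openin_coords_subset[OF smooth_on_open_openin[OF h]] .
  have "\<forall>\<^sub>F t in at (x i). G (x(i := t)) \<in> coords d'"
    using line_in_open[OF W x i] V GV unfolding eventually_at_filter by (auto elim!: eventually_mono)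
  then show ?thesis
    using chain_rule_curve[OF h, of "\<lambda>t. G (x(i := t))" "x i" UNIV "\<lambda>j. partial i (\<lambda>x. G x j) x"]
      smooth_on_open_has_partial[OF G x i] GV[OF x]
    by (simp add: has_partial_def)
qed

text \<open>By the chain rule a partial derivative of \<open>h (G x)\<close> is a sum of products of
  two kinds of functions: smooth functions on \<open>V\<close> composed with \<open>G\<close>, and
  smooth functions on \<open>W\<close>. The algebra generated by both kinds is therefore closed
  under partial differentiation.\<close>

lemma smooth_on_open_compose:
  fixes h :: "(nat \<Rightarrow> real) \<Rightarrow> 'v::real_normed_field"
  assumes h: "smooth_on_open d' V h" and W: "openin (Euclidean_space d) W"
    and G: "\<And>j. j < d' \<Longrightarrow> smooth_on_open d W (\<lambda>x. G x j)"
    and GV: "\<And>x. x \<in> W \<Longrightarrow> G x \<in> V"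
  shows "smooth_on_open d W (\<lambda>x. h (G x))"
proof (rule smooth_on_open_fun_algebra[OF W, where
        B="{\<lambda>x. h (G x) |h. smooth_on_open d' V h} \<union> {f. smooth_on_open d W f}"])
  let ?B = "{\<lambda>x. h (G x) |h. smooth_on_open d' V (h::_\<Rightarrow>'v)} \<union> {f. smooth_on_open d W f}"
  show "(\<lambda>x. h (G x)) \<in> fun_algebra ?B" using h by (auto intro: fun_algebra.gen)
  have V: "V \<subseteq> coords d'" using openin_coords_subset[OF smooth_on_open_openin[OF h]] .
  have cG: "continuous_on W G"
  proof (rule continuous_on_coordinatewise_then_product)
    fix j show "continuous_on W (\<lambda>x. G x j)"
    proof (cases "j < d'")
      case True then show ?thesis using G smooth_on_open_continuous by blast
    next
      case False
      then have "\<And>x. x \<in> W \<Longrightarrow> G x j = 0" using GV V coords_ge by (meson not_le subsetD)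
      then show ?thesis by (simp cong: continuous_on_cong)
    qed
  qed
  fix b assume b: "b \<in> ?B"
  show "continuous_on W b"
    using b continuous_on_compose2[OF smooth_on_open_continuous cG, of d' V] GV
    by (auto intro: smooth_on_open_continuous)
  fix i assume i: "i < d"
  show "\<exists>b'\<in>fun_algebra ?B. \<forall>x\<in>W. has_partial i b (b' x) x"
    using b
  proof
    assume "b \<in> {\<lambda>x. h (G x) |h. smooth_on_open d' V h}"
    then obtain k where k: "smooth_on_open d' V k" "b = (\<lambda>x. k (G x))" by auto
    let ?b' = "\<lambda>x. \<Sum>j<d'. of_real (partial i (\<lambda>x. G x j) x) * partial j k (G x)"
    have "?b' \<in> fun_algebra ?B"
    proof (intro fun_algebra_sum fun_algebra.mult)
      show "(\<lambda>_. 0) \<in> fun_algebra ?B"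
        using smooth_on_open_const[OF W] by (auto intro: fun_algebra.gen)
      fix j assume "j \<in> {..<d'}"
      then show "(\<lambda>x. of_real (partial i (\<lambda>x. G x j) x)) \<in> fun_algebra ?B"
        using smooth_on_open_of_real[OF smooth_on_open_partial[OF G i], of j] by (auto intro!: fun_algebra.gen)
      show "(\<lambda>x. partial j k (G x)) \<in> fun_algebra ?B"
        using \<open>j \<in> _\<close> smooth_on_open_partial[OF k(1)] by (auto intro!: fun_algebra.gen)
    qed
    moreover have "\<forall>x\<in>W. has_partial i b (?b' x) x"
      using has_partial_compose[OF k(1) W G GV _ i] k(2) by (simp add: scaleR_conv_of_real)
    ultimately show ?thesis by (intro bexI[of _ ?b'])
  next
    assume "b \<in> {f. smooth_on_open d W f}"
    then show ?thesis
      using smooth_on_open_partial[of d W b i] smooth_on_open_has_partial[of d W b] i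
      by (intro bexI[of _ "partial i b"]) (auto intro: fun_algebra.gen)
  qed
qed

section \<open>Smooth functions on sets with corners\<close>

text \<open>Relative to \<open>coords d\<close>: the set is contained in the closure of its interior.\<close>

definition regular :: "nat \<Rightarrow> (nat \<Rightarrow> real) set \<Rightarrow> bool" where
  "regular d A \<longleftrightarrow> A \<subseteq> coords d \<and>
     (\<forall>p\<in>A. \<forall>U. openin (Euclidean_space d) U \<and> p \<in> U \<longrightarrow>
        (\<exists>V. openin (Euclidean_space d) V \<and> V \<noteq> {} \<and> V \<subseteq> A \<inter> U))"

lemma regular_Int_open:
  assumes "regular d A" "openin (Euclidean_space d) U"
  shows "regular d (A \<inter> U)"
  unfolding regular_def
proof (intro conjI ballI allI impI)
  fix p U' assume "p \<in> A \<inter> U" "openin (Euclidean_space d) U' \<and> p \<in> U'"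
  moreover then have "openin (Euclidean_space d) (U \<inter> U')" using assms by blast
  ultimately obtain V where "openin (Euclidean_space d) V" "V \<noteq> {}" "V \<subseteq> A \<inter> (U \<inter> U')"
    using assms(1) unfolding regular_def by (meson IntD1 IntD2 IntI)
  then show "\<exists>V. openin (Euclidean_space d) V \<and> V \<noteq> {} \<and> V \<subseteq> A \<inter> U \<inter> U'" by blast
qed (use assms in \<open>auto simp: regular_def\<close>)

text \<open>If the derivatives differed at \<open>p\<close>, continuity would separate them on a
  neighbourhood of \<open>p\<close>. Regularity provides a nonempty open set in this neighbourhood
  inside \<open>A\<close>, on which \<open>f\<close> and \<open>g\<close> coincide and so have the
  same derivatives.\<close>

lemma partial_eq_of_regular:
  fixes f g :: "(nat \<Rightarrow> real) \<Rightarrow> 'v::real_normed_vector"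
  assumes A: "regular d A" "p \<in> A" and i: "i < d"
    and f: "smooth_on_open d W f" "p \<in> W" and g: "smooth_on_open d V g" "p \<in> V"
    and eq: "\<And>x. x \<in> A \<inter> W \<inter> V \<Longrightarrow> f x = g x"
  shows "partial i f p = partial i g p"
proof (rule ccontr)
  assume "partial i f p \<noteq> partial i g p"
  then have e: "dist (partial i f p) (partial i g p) / 2 > 0" (is "?e > 0") by simp
  have oW: "openin (Euclidean_space d) W" and oV: "openin (Euclidean_space d) V"
    using f g by (auto intro: smooth_on_open_openin)
  obtain r1 where r1: "r1 > 0" "\<And>y. y \<in> W \<Longrightarrow> y \<in> cube d p r1 \<Longrightarrow> dist (partial i f y) (partial i f p) < ?e"
    by (rule continuous_on_cubeD[OF openin_coords_subset[OF oW]
        smooth_on_open_continuous[OF smooth_on_open_partial[OF f(1) i]] f(2) e]) blast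
  obtain r2 where r2: "r2 > 0" "\<And>y. y \<in> V \<Longrightarrow> y \<in> cube d p r2 \<Longrightarrow> dist (partial i g y) (partial i g p) < ?e"
    by (rule continuous_on_cubeD[OF openin_coords_subset[OF oV]
        smooth_on_open_continuous[OF smooth_on_open_partial[OF g(1) i]] g(2) e]) blast
  let ?U = "W \<inter> V \<inter> (cube d p r1 \<inter> cube d p r2)"
  have "p \<in> coords d" using f oW openin_coords_subset by blast
  then have "openin (Euclidean_space d) ?U" "p \<in> ?U"
    using oW oV f g r1(1) r2(1) by (auto intro!: openin_cube cube_center)
  then obtain O' where O': "openin (Euclidean_space d) O'" "O' \<noteq> {}" "O' \<subseteq> A \<inter> ?U"
    using A unfolding regular_def by blast
  then obtain y where y: "y \<in> O'" by blast
  have "has_partial i g (partial i f y) y"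
    using has_partial_cong[OF smooth_on_open_has_partial[OF f(1) _ i] O'(1) y i] O' eq y by blast
  then have "partial i f y = partial i g y" using has_partial_imp by metis
  moreover have "dist (partial i f y) (partial i f p) < ?e" "dist (partial i g y) (partial i g p) < ?e"
    using r1(2) r2(2) y O' by blast+
  ultimately show False
    using dist_triangle_half_r[of "partial i f y" "partial i f p" "dist (partial i f p) (partial i g p)" "partial i g p"]
    by (simp add: dist_commute)
qed

text \<open>Evaluates the definite description in \<open>partial_on\<close> by any one local
  extension; uniqueness is \<open>partial_eq_of_regular\<close>.\<close>

lemma partial_on_eq:
  assumes "regular d A" "p \<in> A" "i < d" "smooth_on_open d W g" "p \<in> W"
    and "\<And>x. x \<in> A \<inter> W \<Longrightarrow> f x = g x"
  shows "partial_on d A i f p = partial i g p"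
  unfolding partial_on_def
proof (rule the_equality)
  show "\<exists>W g'. p \<in> W \<and> smooth_on_open d W g' \<and> (\<forall>x\<in>A \<inter> W. f x = g' x) \<and> partial i g p = partial i g' p"
    using assms by blast
  fix v assume "\<exists>W g. p \<in> W \<and> smooth_on_open d W g \<and> (\<forall>x\<in>A \<inter> W. f x = g x) \<and> v = partial i g p"
  then obtain W' g' where "p \<in> W'" "smooth_on_open d W' g'" "\<forall>x\<in>A \<inter> W'. f x = g' x" "v = partial i g' p"
    by blast
  moreover have "partial i g' p = partial i g p"
  proof (rule partial_eq_of_regular[OF assms(1-3) _ _ assms(4,5)])
    show "g' x = g x" if "x \<in> A \<inter> W' \<inter> W" for x
      using assms(6)[of x] \<open>\<forall>x\<in>A \<inter> W'. f x = g' x\<close> that by simp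
  qed fact+
  ultimately show "v = partial i g p" by simp
qed

lemma partial_on_cong:
  assumes "\<And>x. x \<in> A \<Longrightarrow> f x = g x"
  shows "partial_on d A i f p = partial_on d A i g p"
proof -
  have "(\<forall>x\<in>A \<inter> W. f x = h x) = (\<forall>x\<in>A \<inter> W. g x = h x)" for W h using assms by auto
  then show ?thesis unfolding partial_on_def by simp
qed

lemma smooth_on_subsetE:
  assumes "smooth_on_subset d A f" "p \<in> A"
  obtains W g where "p \<in> W" "smooth_on_open d W g" "\<And>x. x \<in> A \<inter> W \<Longrightarrow> f x = g x"
  using assms unfolding smooth_on_subset_def by blast

lemma smooth_on_subset_coords: "smooth_on_subset d A f \<Longrightarrow> A \<subseteq> coords d"
  by (simp add: smooth_on_subset_def topspace_coords)

lemma smooth_on_subsetI: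
  assumes "A \<subseteq> coords d"
    "\<And>p. p \<in> A \<Longrightarrow> \<exists>W g. p \<in> W \<and> smooth_on_open d W g \<and> (\<forall>x\<in>A \<inter> W. f x = g x)"
  shows "smooth_on_subset d A f"
  using assms by (simp add: smooth_on_subset_def topspace_coords)

lemma smooth_on_subset_cong:
  assumes "smooth_on_subset d A f" "\<And>x. x \<in> A \<Longrightarrow> f x = g x"
  shows "smooth_on_subset d A g"
  using assms unfolding smooth_on_subset_def by fastforce

lemma smooth_on_subset_mono:
  assumes "smooth_on_subset d A f" "B \<subseteq> A"
  shows "smooth_on_subset d B f"
proof (rule smooth_on_subsetI)
  show "B \<subseteq> coords d" using assms smooth_on_subset_coords[of d A f] by blast
  fix p assume "p \<in> B"
  then obtain W g where "p \<in> W" "smooth_on_open d W g" "\<And>x. x \<in> A \<inter> W \<Longrightarrow> f x = g x"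
    using smooth_on_subsetE[OF assms(1), of p] assms(2) by blast
  then show "\<exists>W g. p \<in> W \<and> smooth_on_open d W g \<and> (\<forall>x\<in>B \<inter> W. f x = g x)"
    using assms(2) by blast
qed

lemma smooth_on_subset_local:
  assumes "A \<subseteq> coords d"
    "\<And>p. p \<in> A \<Longrightarrow> \<exists>U. openin (Euclidean_space d) U \<and> p \<in> U \<and> smooth_on_subset d (A \<inter> U) f"
  shows "smooth_on_subset d A f"
proof (rule smooth_on_subsetI[OF assms(1)])
  fix p assume p: "p \<in> A"
  then obtain U where U: "openin (Euclidean_space d) U" "p \<in> U" "smooth_on_subset d (A \<inter> U) f"
    using assms by blast
  then obtain W g where W: "p \<in> W" "smooth_on_open d W g" "\<And>x. x \<in> A \<inter> U \<inter> W \<Longrightarrow> f x = g x"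
    using smooth_on_subsetE[OF U(3), of p] p by blast
  have "openin (Euclidean_space d) (W \<inter> U)" using U smooth_on_open_openin[OF W(2)] by blast
  then have "smooth_on_open d (W \<inter> U) g" by (rule smooth_on_open_mono[OF W(2)]) auto
  then show "\<exists>W g. p \<in> W \<and> smooth_on_open d W g \<and> (\<forall>x\<in>A \<inter> W. f x = g x)"
    using W U by blast
qed

lemma smooth_on_subset_continuous:
  fixes f :: "_ \<Rightarrow> 'v::real_normed_vector"
  assumes "smooth_on_subset d A f" shows "continuous_on A f"
proof (rule continuous_on_cubeI[OF smooth_on_subset_coords[OF assms]])
  fix x e assume x: "x \<in> A" and e: "e > (0::real)"
  obtain W g where W: "x \<in> W" "smooth_on_open d W g" "\<And>x. x \<in> A \<inter> W \<Longrightarrow> f x = g x"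
    using smooth_on_subsetE[OF assms x] by blast
  have oW: "openin (Euclidean_space d) W" using smooth_on_open_openin[OF W(2)] .
  obtain r1 where r1: "r1 > 0" "cube d x r1 \<subseteq> W" using openin_imp_cube[OF oW W(1)] .
  obtain r2 where r2: "r2 > 0" "\<And>y. y \<in> W \<Longrightarrow> y \<in> cube d x r2 \<Longrightarrow> dist (g y) (g x) < e"
    by (rule continuous_on_cubeD[OF openin_coords_subset[OF oW] smooth_on_open_continuous[OF W(2)] W(1) e]) blast
  have "\<forall>y\<in>A \<inter> cube d x (min r1 r2). dist (f y) (f x) < e"
  proof
    fix y assume y: "y \<in> A \<inter> cube d x (min r1 r2)"
    then have "y \<in> W" "y \<in> cube d x r2"
      using r1(2) cube_mono[of "min r1 r2" r1 d x] cube_mono[of "min r1 r2" r2 d x] by auto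
    then show "dist (f y) (f x) < e" using r2(2) W x y by auto
  qed
  then show "\<exists>\<delta>>0. \<forall>y\<in>A \<inter> cube d x \<delta>. dist (f y) (f x) < e"
    using r1(1) r2(1) by (intro exI[of _ "min r1 r2"]) auto
qed

text \<open>If \<open>g\<close> extends \<open>f\<close> near \<open>p\<close>, then
  \<open>partial i g\<close> extends the derivative of \<open>f\<close> there, since
  \<open>g\<close> computes it at all nearby points of \<open>A\<close>.\<close>

lemma smooth_on_subset_partial_on:
  assumes "smooth_on_subset d A f" "regular d A" "i < d"
  shows "smooth_on_subset d A (partial_on d A i f)"
proof (rule smooth_on_subsetI[OF smooth_on_subset_coords[OF assms(1)]])
  fix p assume p: "p \<in> A"
  obtain W g where W: "p \<in> W" "smooth_on_open d W g" "\<And>x. x \<in> A \<inter> W \<Longrightarrow> f x = g x"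
    using smooth_on_subsetE[OF assms(1) p] by blast
  have "\<forall>x\<in>A \<inter> W. partial_on d A i f x = partial i g x"
    using partial_on_eq[OF assms(2) _ assms(3) W(2)] W(3) by blast
  then show "\<exists>W g. p \<in> W \<and> smooth_on_open d W g \<and> (\<forall>x\<in>A \<inter> W. partial_on d A i f x = g x)"
    using W smooth_on_open_partial[OF W(2) assms(3)] by blast
qed

text \<open>A single local extension computes both sides. This moves derivatives between the
  different chart regions on which a map is considered.\<close>

lemma partial_on_subset:
  assumes "smooth_on_subset d A f" "regular d A" "regular d B" "B \<subseteq> A" "p \<in> B" "i < d"
  shows "partial_on d B i f p = partial_on d A i f p"
proof -
  obtain W g where W: "p \<in> W" "smooth_on_open d W g" "\<And>x. x \<in> A \<inter> W \<Longrightarrow> f x = g x"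
    using smooth_on_subsetE[OF assms(1), of p] assms by blast
  have "partial_on d B i f p = partial i g p" "partial_on d A i f p = partial i g p"
    using partial_on_eq[OF assms(3,5,6) W(2,1), of f] partial_on_eq[OF assms(2) _ assms(6) W(2,1), of f]
      W(3) assms by blast+
  then show ?thesis by simp
qed

section \<open>Algebraic operations and composition on sets with corners\<close>

lemma smooth_on_subset_const: "A \<subseteq> coords d \<Longrightarrow> smooth_on_subset d A (\<lambda>_. c)"
  using smooth_on_open_const[OF openin_topspace[of "Euclidean_space d"], of c]
  by (intro smooth_on_subsetI) (auto simp: topspace_coords)

lemma smooth_on_subset_coord: "A \<subseteq> coords d \<Longrightarrow> smooth_on_subset d A (\<lambda>x. x j)"
  using smooth_on_open_coord[OF openin_topspace[of "Euclidean_space d"], of j]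
  by (intro smooth_on_subsetI) (auto simp: topspace_coords)

lemma smooth_on_subset_of_real:
  assumes "smooth_on_subset d A f"
  shows "smooth_on_subset d A (\<lambda>x. of_real (f x) :: 'v::real_normed_field)"
proof (rule smooth_on_subsetI[OF smooth_on_subset_coords[OF assms(1)]])
  fix p assume "p \<in> A"
  then obtain W g where "p \<in> W" "smooth_on_open d W g" "\<And>x. x \<in> A \<inter> W \<Longrightarrow> f x = g x"
    using smooth_on_subsetE[OF assms(1)] by blast
  then show "\<exists>W g. p \<in> W \<and> smooth_on_open d W g \<and> (\<forall>x\<in>A \<inter> W. (of_real (f x) :: 'v) = g x)"
    using smooth_on_open_of_real[of d W g] by (intro exI[of _ W] exI[of _ "\<lambda>x. of_real (g x)"]) auto
qed

lemma smooth_on_subset_common: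
  assumes "smooth_on_subset d A f" "smooth_on_subset d A g" "p \<in> A"
  obtains W f' g' where "p \<in> W" "smooth_on_open d W f'" "smooth_on_open d W g'"
    "\<And>x. x \<in> A \<inter> W \<Longrightarrow> f x = f' x" "\<And>x. x \<in> A \<inter> W \<Longrightarrow> g x = g' x"
proof -
  obtain W1 f' where 1: "p \<in> W1" "smooth_on_open d W1 f'" "\<And>x. x \<in> A \<inter> W1 \<Longrightarrow> f x = f' x"
    using smooth_on_subsetE[OF assms(1,3)] by blast
  obtain W2 g' where 2: "p \<in> W2" "smooth_on_open d W2 g'" "\<And>x. x \<in> A \<inter> W2 \<Longrightarrow> g x = g' x"
    using smooth_on_subsetE[OF assms(2,3)] by blast
  have "openin (Euclidean_space d) (W1 \<inter> W2)"
    using smooth_on_open_openin[OF 1(2)] smooth_on_open_openin[OF 2(2)] by blast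
  with 1 2 show ?thesis
    by (intro that[of "W1 \<inter> W2" f' g']) (auto intro: smooth_on_open_mono)
qed

lemma
  fixes f g :: "_ \<Rightarrow> 'v::real_normed_field"
  assumes "smooth_on_subset d A f" "smooth_on_subset d A g"
  shows smooth_on_subset_add: "smooth_on_subset d A (\<lambda>x. f x + g x)"
    and smooth_on_subset_mult: "smooth_on_subset d A (\<lambda>x. f x * g x)"
    and partial_on_add: "regular d A \<Longrightarrow> p \<in> A \<Longrightarrow> i < d \<Longrightarrow>
      partial_on d A i (\<lambda>x. f x + g x) p = partial_on d A i f p + partial_on d A i g p"
proof -
  have *: "\<exists>W f' g'. p \<in> W \<and> smooth_on_open d W f' \<and> smooth_on_open d W g' \<and>
       (\<forall>x\<in>A \<inter> W. f x = f' x \<and> g x = g' x)" if "p \<in> A" for p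
    by (rule smooth_on_subset_common[OF assms that]) blast
  show "smooth_on_subset d A (\<lambda>x. f x + g x)"
  proof (rule smooth_on_subsetI[OF smooth_on_subset_coords[OF assms(1)]])
    fix p assume "p \<in> A"
    then obtain W f' g' where "p \<in> W" "smooth_on_open d W f'" "smooth_on_open d W g'"
       "\<forall>x\<in>A \<inter> W. f x = f' x \<and> g x = g' x" using * by blast
    then show "\<exists>W h. p \<in> W \<and> smooth_on_open d W h \<and> (\<forall>x\<in>A \<inter> W. f x + g x = h x)"
      using smooth_on_open_add[of d W f' g'] by (intro exI[of _ W] exI[of _ "\<lambda>x. f' x + g' x"]) auto
  qed
  show "smooth_on_subset d A (\<lambda>x. f x * g x)"
  proof (rule smooth_on_subsetI[OF smooth_on_subset_coords[OF assms(1)]])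
    fix p assume "p \<in> A"
    then obtain W f' g' where "p \<in> W" "smooth_on_open d W f'" "smooth_on_open d W g'"
       "\<forall>x\<in>A \<inter> W. f x = f' x \<and> g x = g' x" using * by blast
    then show "\<exists>W h. p \<in> W \<and> smooth_on_open d W h \<and> (\<forall>x\<in>A \<inter> W. f x * g x = h x)"
      using smooth_on_open_mult[of d W f' g'] by (intro exI[of _ W] exI[of _ "\<lambda>x. f' x * g' x"]) auto
  qed
  assume r: "regular d A" and p: "p \<in> A" and i: "i < d"
  obtain W f' g' where W: "p \<in> W" "smooth_on_open d W f'" "smooth_on_open d W g'"
       "\<forall>x\<in>A \<inter> W. f x = f' x \<and> g x = g' x" using *[OF p] by blast
  have "has_partial i (\<lambda>x. f' x + g' x) (partial i f' p + partial i g' p) p"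
    using smooth_on_open_has_partial[OF W(2,1) i] smooth_on_open_has_partial[OF W(3,1) i]
    by (auto simp: has_partial_def intro: has_vector_derivative_add)
  then have "partial i (\<lambda>x. f' x + g' x) p = partial i f' p + partial i g' p" by (rule has_partial_imp)
  then show "partial_on d A i (\<lambda>x. f x + g x) p = partial_on d A i f p + partial_on d A i g p"
    using partial_on_eq[OF r p i smooth_on_open_add[OF W(2,3)] W(1), of "\<lambda>x. f x + g x"]
      partial_on_eq[OF r p i W(2,1), of f] partial_on_eq[OF r p i W(3,1), of g] W(4) by auto
qed

lemma smooth_on_subset_sum:
  fixes f :: "_ \<Rightarrow> _ \<Rightarrow> 'v::real_normed_field"
  assumes "A \<subseteq> coords d" "\<And>i. i \<in> I \<Longrightarrow> smooth_on_subset d A (f i)"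
  shows "smooth_on_subset d A (\<lambda>x. \<Sum>i\<in>I. f i x)"
  using assms(2)
  by (induction I rule: infinite_finite_induct) (auto intro: smooth_on_subset_const[OF assms(1)] smooth_on_subset_add)

lemma partial_on_const:
  assumes "regular d A" "p \<in> A" "i < d"
  shows "partial_on d A i (\<lambda>_. c) p = 0"
  using partial_on_eq[OF assms smooth_on_open_const[OF openin_topspace], of "\<lambda>_. c"] assms(1,2)
    has_partial_imp[of i "\<lambda>_. c" 0 p]
  by (auto simp: topspace_coords regular_def has_partial_def)

lemma partial_on_coord:
  assumes "regular d A" "p \<in> A" "i < d"
  shows "partial_on d A i (\<lambda>x. x j) p = (if i = j then 1 else 0)"
proof -
  have "has_partial i (\<lambda>x. x j) (if i = j then 1 else 0) p"
    by (auto simp: has_partial_def fun_upd_def)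
  then have "partial i (\<lambda>x. x j) p = (if i = j then 1 else 0)" by (rule has_partial_imp)
  moreover have "p \<in> topspace (Euclidean_space d)" using assms by (auto simp: regular_def topspace_coords)
  ultimately show ?thesis
    using partial_on_eq[OF assms smooth_on_open_coord[OF openin_topspace], of "\<lambda>x. x j"] by simp
qed

lemma smooth_on_subset_extend_map:
  assumes G: "\<And>j. j < d' \<Longrightarrow> smooth_on_subset d A (\<lambda>x. G x j)" and Ac: "A \<subseteq> coords d" and GA: "\<And>x. x \<in> A \<Longrightarrow> G x \<in> coords d'"
    and p: "p \<in> A"
  obtains W H where "p \<in> W" "openin (Euclidean_space d) W" "\<And>j. j < d' \<Longrightarrow> smooth_on_open d W (\<lambda>x. H x j)"
    "\<And>x. H x \<in> coords d'" "\<And>x. x \<in> A \<inter> W \<Longrightarrow> G x = H x" "continuous_on W H"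
proof -
  have "\<exists>W g. p \<in> W \<and> smooth_on_open d W g \<and> (\<forall>x\<in>A \<inter> W. G x j = g x)" if "j < d'" for j
    by (rule smooth_on_subsetE[OF G[OF that] p]) blast
  then obtain W g where W: "\<And>j. j < d' \<Longrightarrow> p \<in> W j \<and> smooth_on_open d (W j) (g j) \<and> (\<forall>x\<in>A \<inter> W j. G x j = g j x)"
    by metis
  \<comment> \<open>The factor \<open>coords d\<close> keeps the set open for \<open>d' = 0\<close>,
    where the intersection over \<open>j\<close> is the whole type. The extension below is set to
    \<open>0\<close> from \<open>d'\<close> on, so that its values lie in
    \<open>coords d'\<close>.\<close>
  let ?W = "coords d \<inter> (\<Inter>j<d'. W j)"
  let ?H = "\<lambda>x j. if j < d' then g j x else 0"
  have oW: "openin (Euclidean_space d) ?W"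
  proof (cases "d' = 0")
    case True then show ?thesis using openin_topspace[of "Euclidean_space d"] by (simp add: topspace_coords)
  next
    case False
    then have "openin (Euclidean_space d) (\<Inter>j<d'. W j)"
      using W by (intro openin_INT2) (auto intro: smooth_on_open_openin)
    then show ?thesis using openin_topspace[of "Euclidean_space d"] by (auto simp: topspace_coords)
  qed
  have s: "smooth_on_open d ?W (\<lambda>x. ?H x j)" if "j < d'" for j
    using smooth_on_open_mono[OF _ oW, of "W j" "g j"] W[OF that] that by auto
  show ?thesis
  proof (rule that[of ?W ?H])
    show "p \<in> ?W" using W p Ac by auto
    show "\<And>x. ?H x \<in> coords d'" by (auto simp: coords_def)
    show "G x = ?H x" if "x \<in> A \<inter> ?W" for x
      using W GA[of x] that coords_ge[of "G x" d'] by (intro ext) (auto simp: not_less)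
    show "continuous_on ?W ?H"
    proof (rule continuous_on_coordinatewise_then_product)
      show "continuous_on ?W (\<lambda>x. ?H x j)" for j
        using smooth_on_open_continuous[OF s[of j]] by (cases "j < d'") auto
    qed
  qed (use s oW in auto)
qed

lemma
  fixes h :: "_ \<Rightarrow> 'v::real_normed_field"
  assumes h: "smooth_on_subset d' B h" and G: "\<And>j. j < d' \<Longrightarrow> smooth_on_subset d A (\<lambda>x. G x j)"
    and Ac: "A \<subseteq> coords d" and GA: "\<And>x. x \<in> A \<Longrightarrow> G x \<in> B"
  shows smooth_on_subset_compose: "smooth_on_subset d A (\<lambda>x. h (G x))"
    and partial_on_compose: "regular d A \<Longrightarrow> regular d' B \<Longrightarrow> p \<in> A \<Longrightarrow> i < d \<Longrightarrow>
      partial_on d A i (\<lambda>x. h (G x)) p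
        = (\<Sum>j<d'. partial_on d A i (\<lambda>x. G x j) p *\<^sub>R partial_on d' B j h (G p))"
proof -
  have GA': "G x \<in> coords d'" if "x \<in> A" for x
    using GA[OF that] smooth_on_subset_coords[OF h] by blast
  \<comment> \<open>Local extensions \<open>H\<close> of \<open>G\<close> and \<open>k\<close> of
    \<open>h\<close> can be composed only where \<open>H\<close> lands in the domain of
    \<open>k\<close>; the domain of \<open>H\<close> is shrunk to the preimage of that open
    set.\<close>
  have *: "\<exists>W H V k. p \<in> W \<and> openin (Euclidean_space d) W \<and> (\<forall>j<d'. smooth_on_open d W (\<lambda>x. H x j)) \<and>
      (\<forall>x\<in>A \<inter> W. G x = H x) \<and> smooth_on_open d' V k \<and> (\<forall>y\<in>B \<inter> V. h y = k y) \<and> (\<forall>x\<in>W. H x \<in> V)"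
    if p: "p \<in> A" for p
  proof -
    obtain W H where W: "p \<in> W" "openin (Euclidean_space d) W" "\<And>j. j < d' \<Longrightarrow> smooth_on_open d W (\<lambda>x. H x j)"
      "\<And>x. H x \<in> coords d'" "\<And>x. x \<in> A \<inter> W \<Longrightarrow> G x = H x" "continuous_on W H"
      using smooth_on_subset_extend_map[OF G Ac GA' p] by blast
    obtain V k where V: "G p \<in> V" "smooth_on_open d' V k" "\<And>y. y \<in> B \<inter> V \<Longrightarrow> h y = k y"
      using smooth_on_subsetE[OF h GA[OF p]] by blast
    have "openin (Euclidean_space d') V" using smooth_on_open_openin[OF V(2)] .
    then obtain T where T: "open T" "V = coords d' \<inter> T" by (auto simp: Euclidean_space_coords openin_open)
    have "openin (top_of_set W) (W \<inter> H -` T)"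
      using continuous_openin_preimage_gen[OF W(6) T(1)] .
    moreover have "openin (top_of_set (coords d)) W" using W(2) by (simp add: Euclidean_space_coords)
    ultimately have o: "openin (Euclidean_space d) (W \<inter> H -` T)"
      using openin_trans by (metis Euclidean_space_coords)
    have "p \<in> W \<inter> H -` T" using W p V T by auto
    then show ?thesis
      using o W V T smooth_on_open_mono[OF W(3) o]
      by (intro exI[of _ "W \<inter> H -` T"] exI[of _ H] exI[of _ V] exI[of _ k]) auto
  qed
  show "smooth_on_subset d A (\<lambda>x. h (G x))"
  proof (rule smooth_on_subsetI[OF Ac])
    fix p assume p: "p \<in> A"
    obtain W H V k where W: "p \<in> W" "openin (Euclidean_space d) W" "\<forall>j<d'. smooth_on_open d W (\<lambda>x. H x j)"
      "\<forall>x\<in>A \<inter> W. G x = H x" "smooth_on_open d' V k" "\<forall>y\<in>B \<inter> V. h y = k y" "\<forall>x\<in>W. H x \<in> V"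
      using *[OF p] by (elim exE conjE) (rule that)
    have "smooth_on_open d W (\<lambda>x. k (H x))" using W by (intro smooth_on_open_compose[OF W(5,2)]) auto
    moreover have "\<forall>x\<in>A \<inter> W. h (G x) = k (H x)" 
    proof
      fix x assume x: "x \<in> A \<inter> W"
      then have "G x = H x" "H x \<in> V" using W(4,7) by blast+
      moreover have "G x \<in> B" using GA x by blast
      ultimately show "h (G x) = k (H x)" using W(6) by auto
    qed
    ultimately show "\<exists>W g. p \<in> W \<and> smooth_on_open d W g \<and> (\<forall>x\<in>A \<inter> W. h (G x) = g x)" using W(1) by blast
  qed
  assume r: "regular d A" "regular d' B" and p: "p \<in> A" and i: "i < d"
  obtain W H V k where W: "p \<in> W" "openin (Euclidean_space d) W" "\<forall>j<d'. smooth_on_open d W (\<lambda>x. H x j)"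
    "\<forall>x\<in>A \<inter> W. G x = H x" "smooth_on_open d' V k" "\<forall>y\<in>B \<inter> V. h y = k y" "\<forall>x\<in>W. H x \<in> V"
    using *[OF p] by (elim exE conjE) (rule that)
  have s: "smooth_on_open d W (\<lambda>x. k (H x))" using W by (intro smooth_on_open_compose[OF W(5,2)]) auto
  have Gp: "G p = H p" using W p by blast
  have "partial_on d A i (\<lambda>x. h (G x)) p = partial i (\<lambda>x. k (H x)) p"
  proof (rule partial_on_eq[OF r(1) p i s W(1)])
    fix x assume x: "x \<in> A \<inter> W"
    then have "G x = H x" "H x \<in> V" using W(4,7) by blast+
      moreover have "G x \<in> B" using GA x by blast
    ultimately show "h (G x) = k (H x)" using W(6) by auto
  qed
  also have "\<dots> = (\<Sum>j<d'. partial i (\<lambda>x. H x j) p *\<^sub>R partial j k (H p))"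
    using has_partial_compose[OF W(5,2) _ _ W(1) i, of H] W by (intro has_partial_imp) auto
  also have "\<dots> = (\<Sum>j<d'. partial_on d A i (\<lambda>x. G x j) p *\<^sub>R partial_on d' B j h (G p))"
  proof (intro sum.cong refl arg_cong2[where f=scaleR])
    fix j assume j: "j \<in> {..<d'}"
    show "partial i (\<lambda>x. H x j) p = partial_on d A i (\<lambda>x. G x j) p"
      using partial_on_eq[OF r(1) p i _ W(1), of "\<lambda>x. H x j" "\<lambda>x. G x j"] W j by simp
    show "partial j k (H p) = partial_on d' B j h (G p)"
      using partial_on_eq[OF r(2) GA[OF p] _ W(5), of j h] W j Gp by simp
  qed
  finally show "partial_on d A i (\<lambda>x. h (G x)) p
        = (\<Sum>j<d'. partial_on d A i (\<lambda>x. G x j) p *\<^sub>R partial_on d' B j h (G p))" .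
qed

section \<open>Manifolds with corners\<close>

text \<open>The common properties of \<open>\<Delta>\<^sup>n\<close> and \<open>\<Delta>\<^sup>n \<times> M\<close>.\<close>

definition corner_space :: "'a smooth_space \<Rightarrow> bool" where
  "corner_space M \<longleftrightarrow>
     (\<Union>c \<in> atlas M. cdom c) = points M \<and>
     (\<forall>c \<in> atlas M. openin (top_of M) (cdom c) \<and> regular (cdim c) (cmap c ` cdom c) \<and>
        inj_on (cmap c) (cdom c) \<and>
        continuous_map (subtopology (Euclidean_space (cdim c)) (cmap c ` cdom c)) (top_of M) (chart_inv c)) \<and>
     (\<forall>c \<in> atlas M. \<forall>c' \<in> atlas M. smooth_in_charts c c' (\<lambda>x. x))"

lemma corner_spaceD:
  assumes "corner_space M" "c \<in> atlas M"
  shows "openin (top_of M) (cdom c)" "regular (cdim c) (cmap c ` cdom c)" "inj_on (cmap c) (cdom c)"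
    "continuous_map (subtopology (Euclidean_space (cdim c)) (cmap c ` cdom c)) (top_of M) (chart_inv c)"
  using assms unfolding corner_space_def by auto

lemma chart_inv_cmap:
  assumes "corner_space M" "c \<in> atlas M" "x \<in> cdom c"
  shows "chart_inv c (cmap c x) = x"
  using corner_spaceD(3)[OF assms(1,2)] assms(3) by (simp add: chart_inv_def)

lemma chart_at_in:
  assumes "corner_space M" "p \<in> points M" shows "chart_at M p \<in> charts_at M p"
proof -
  have "p \<in> (\<Union>c \<in> atlas M. cdom c)" using assms by (simp add: corner_space_def)
  then have "\<exists>c. c \<in> charts_at M p" by (auto simp: charts_at_def)
  then show ?thesis unfolding chart_at_def by (rule someI_ex)
qed

lemma charts_atD: "c \<in> charts_at M p \<Longrightarrow> c \<in> atlas M" "c \<in> charts_at M p \<Longrightarrow> p \<in> cdom c"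
  by (auto simp: charts_at_def)

lemma charts_at_points: "corner_space M \<Longrightarrow> c \<in> charts_at M p \<Longrightarrow> p \<in> points M"
  unfolding corner_space_def charts_at_def by auto

text \<open>Continuity of the inverse chart makes the image of \<open>U\<close> relatively open in
  the chart image. Hence it is the trace of an open set, and regularity passes to it.\<close>

lemma chart_region_open:
  assumes "corner_space M" "c \<in> atlas M" "openin (top_of M) U"
  obtains T where "openin (Euclidean_space (cdim c)) T" "cmap c ` (cdom c \<inter> U) = cmap c ` cdom c \<inter> T"
proof -
  let ?A = "cmap c ` cdom c"
  have A: "?A \<subseteq> topspace (Euclidean_space (cdim c))"
    using corner_spaceD(2)[OF assms(1,2)] by (simp add: regular_def topspace_coords)
  have "openin (subtopology (Euclidean_space (cdim c)) ?A)
      {y \<in> topspace (subtopology (Euclidean_space (cdim c)) ?A). chart_inv c y \<in> U}"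
    using openin_continuous_map_preimage[OF corner_spaceD(4)[OF assms(1,2)] assms(3)] .
  moreover have "{y \<in> topspace (subtopology (Euclidean_space (cdim c)) ?A). chart_inv c y \<in> U} = cmap c ` (cdom c \<inter> U)"
    using A chart_inv_cmap[OF assms(1,2)] by auto
  ultimately have "openin (subtopology (Euclidean_space (cdim c)) ?A) (cmap c ` (cdom c \<inter> U))" by simp
  then obtain T where "openin (Euclidean_space (cdim c)) T" "cmap c ` (cdom c \<inter> U) = T \<inter> ?A"
    by (auto simp: openin_subtopology)
  then show ?thesis using that[of T] by (simp add: Int_commute)
qed

lemma chart_region_regular:
  assumes "corner_space M" "c \<in> atlas M" "openin (top_of M) U"
  shows "regular (cdim c) (cmap c ` (cdom c \<inter> U))"
proof -
  obtain T where "openin (Euclidean_space (cdim c)) T" "cmap c ` (cdom c \<inter> U) = cmap c ` cdom c \<inter> T"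
    by (rule chart_region_open[OF assms])
  then show ?thesis using regular_Int_open[OF corner_spaceD(2)[OF assms(1,2)]] by simp
qed

text \<open>The preimage under \<open>f\<close> is taken in the whole type and may contain elements
  outside \<open>points M\<close>. Its part inside the space is open and has the same trace on the
  chart domain.\<close>

lemma smooth_map_open_vimage:
  assumes "corner_space M" "corner_space N" "continuous_map (top_of M) (top_of N) f" "c \<in> atlas M" "c' \<in> atlas N"
  obtains U where "openin (top_of M) U" "cdom c \<inter> f -` cdom c' = cdom c \<inter> U" "U \<subseteq> f -` cdom c'"
proof
  let ?U = "{x \<in> points M. f x \<in> cdom c'}"
  show "openin (top_of M) ?U"
    using openin_continuous_map_preimage[OF assms(3) corner_spaceD(1)[OF assms(2,5)]] .
  show "cdom c \<inter> f -` cdom c' = cdom c \<inter> ?U"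
    using openin_subset[OF corner_spaceD(1)[OF assms(1,4)]] by auto
qed auto

lemma smooth_map_region_regular:
  assumes "corner_space M" "corner_space N" "smooth_map M N f" "c \<in> atlas M" "c' \<in> atlas N"
  shows "regular (cdim c) (cmap c ` (cdom c \<inter> f -` cdom c'))"
proof -
  have "continuous_map (top_of M) (top_of N) f" using assms(3) by (simp add: smooth_map_def)
  then obtain U where "openin (top_of M) U" "cdom c \<inter> f -` cdom c' = cdom c \<inter> U"
    by (rule smooth_map_open_vimage[OF assms(1,2) _ assms(4,5)]) (rule that)
  then show ?thesis using chart_region_regular[OF assms(1,4)] by simp
qed

lemma smooth_mapD:
  assumes "smooth_map M N f" "c \<in> atlas M" "c' \<in> atlas N" "j < cdim c'"
  shows "smooth_on_subset (cdim c) (cmap c ` (cdom c \<inter> f -` cdom c')) (\<lambda>y. cmap c' (f (chart_inv c y)) j)"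
  using assms unfolding smooth_map_def smooth_in_charts_def by blast

lemma smooth_map_id: "corner_space M \<Longrightarrow> smooth_map M M (\<lambda>x. x)"
  by (auto simp: corner_space_def smooth_map_def)

lemma cmap_coords: "corner_space M \<Longrightarrow> c \<in> atlas M \<Longrightarrow> x \<in> cdom c \<Longrightarrow> cmap c x \<in> coords (cdim c)"
  using corner_spaceD(2) unfolding regular_def by blast

text \<open>An intermediate chart \<open>c'\<close> of \<open>N\<close> covers only part of the
  region on which \<open>h\<close> is expressed in \<open>c\<close> and \<open>c''\<close>. That
  part is cut out by an open set, so it is again regular and suffices for local statements.\<close>

lemma smooth_map_compose_region:
  assumes M: "corner_space M" and N: "corner_space N" and P: "corner_space P"
    and f: "smooth_map M N f" and g: "smooth_map N P g"
    and h: "\<And>x. x \<in> points M \<Longrightarrow> h x = g (f x)"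
    and c: "c \<in> atlas M" "c' \<in> atlas N" "c'' \<in> atlas P"
  obtains T where "openin (Euclidean_space (cdim c)) T"
    "cmap c ` (cdom c \<inter> f -` cdom c') \<inter> cmap c ` (cdom c \<inter> h -` cdom c'')
       = cmap c ` (cdom c \<inter> h -` cdom c'') \<inter> T"
    "regular (cdim c) (cmap c ` (cdom c \<inter> f -` cdom c') \<inter> cmap c ` (cdom c \<inter> h -` cdom c''))"
proof -
  have cf: "continuous_map (top_of M) (top_of N) f" and cg: "continuous_map (top_of N) (top_of P) g"
    using f g by (auto simp: smooth_map_def)
  have ch: "continuous_map (top_of M) (top_of P) h"
    using continuous_map_eq[OF continuous_map_compose[OF cf cg]] h by auto
  obtain U where U: "openin (top_of M) U" "cdom c \<inter> f -` cdom c' = cdom c \<inter> U"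
    by (rule smooth_map_open_vimage[OF M N cf c(1,2)]) (rule that)
  obtain V where V: "openin (top_of M) V" "cdom c \<inter> h -` cdom c'' = cdom c \<inter> V"
    by (rule smooth_map_open_vimage[OF M P ch c(1,3)]) (rule that)
  obtain T where T: "openin (Euclidean_space (cdim c)) T" "cmap c ` (cdom c \<inter> U) = cmap c ` cdom c \<inter> T"
    by (rule chart_region_open[OF M c(1) U(1)]) (rule that)
  have "cmap c ` (cdom c \<inter> U) \<inter> cmap c ` (cdom c \<inter> V) = cmap c ` (cdom c \<inter> V) \<inter> T"
    unfolding T(2) by blast
  then show ?thesis
    using that[OF T(1)] regular_Int_open[OF chart_region_regular[OF M c(1) V(1)] T(1)] U(2) V(2) by simp
qed

text \<open>Where \<open>f\<close> lands in \<open>c'\<close>, the coordinate expression of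
  \<open>h\<close> factors through that of \<open>f\<close> followed by that of \<open>g\<close>, so
  composition and chain rule in Euclidean space apply. The factors in the resulting formula are
  derivatives on the full regions of \<open>f\<close> and \<open>g\<close>, as in
  \<open>coord_diff\<close>.\<close>

lemma smooth_in_compose_region:
  assumes M: "corner_space M" and N: "corner_space N" and P: "corner_space P"
    and f: "smooth_map M N f" and g: "smooth_map N P g"
    and h: "\<And>x. x \<in> points M \<Longrightarrow> h x = g (f x)"
    and c: "c \<in> atlas M" "c' \<in> atlas N" "c'' \<in> atlas P" and j: "j < cdim c''"
  shows "smooth_on_subset (cdim c) (cmap c ` (cdom c \<inter> f -` cdom c') \<inter> cmap c ` (cdom c \<inter> h -` cdom c''))
      (\<lambda>y. cmap c'' (h (chart_inv c y)) j)" (is ?S)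
    and "p \<in> cdom c \<Longrightarrow> f p \<in> cdom c' \<Longrightarrow> h p \<in> cdom c'' \<Longrightarrow> i < cdim c \<Longrightarrow>
      partial_on (cdim c) (cmap c ` (cdom c \<inter> f -` cdom c') \<inter> cmap c ` (cdom c \<inter> h -` cdom c'')) i
          (\<lambda>y. cmap c'' (h (chart_inv c y)) j) (cmap c p) =
        (\<Sum>l<cdim c'. partial_on (cdim c) (cmap c ` (cdom c \<inter> f -` cdom c')) i (\<lambda>y. cmap c' (f (chart_inv c y)) l) (cmap c p)
           * partial_on (cdim c') (cmap c' ` (cdom c' \<inter> g -` cdom c'')) l (\<lambda>y. cmap c'' (g (chart_inv c' y)) j) (cmap c' (f p)))"
proof -
  let ?A = "cmap c ` (cdom c \<inter> f -` cdom c') \<inter> cmap c ` (cdom c \<inter> h -` cdom c'')"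
  let ?B = "cmap c' ` (cdom c' \<inter> g -` cdom c'')"
  let ?G = "\<lambda>y. cmap c' (f (chart_inv c y))"
  let ?k = "\<lambda>y. cmap c'' (g (chart_inv c' y)) j"
  have pts: "x \<in> points M" if "x \<in> cdom c" for x
    using that openin_subset[OF corner_spaceD(1)[OF M c(1)]] by auto
  have inA: "\<exists>x. y = cmap c x \<and> x \<in> cdom c \<and> f x \<in> cdom c' \<and> h x \<in> cdom c'' \<and> chart_inv c y = x" if y: "y \<in> ?A" for y
  proof -
    obtain x where x: "y = cmap c x" "x \<in> cdom c" "f x \<in> cdom c'" using y by blast
    obtain x' where x': "y = cmap c x'" "x' \<in> cdom c" "h x' \<in> cdom c''" using y by blast
    have "chart_inv c y = x" unfolding x(1) by (rule chart_inv_cmap[OF M c(1) x(2)])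
    moreover have "chart_inv c y = x'" unfolding x'(1) by (rule chart_inv_cmap[OF M c(1) x'(2)])
    ultimately show ?thesis using x x' by (intro exI[of _ x]) simp
  qed
  have GB: "?G y \<in> ?B" "cmap c'' (h (chart_inv c y)) j = ?k (?G y)" if "y \<in> ?A" for y
    using inA[OF that] h[OF pts] chart_inv_cmap[OF N c(2)] by auto
  have Gs: "smooth_on_subset (cdim c) ?A (\<lambda>y. ?G y l)" if "l < cdim c'" for l
    by (rule smooth_on_subset_mono[OF smooth_mapD[OF f c(1,2) that]]) auto
  have ks: "smooth_on_subset (cdim c') ?B ?k" by (rule smooth_mapD[OF g c(2,3) j])
  have Ac: "?A \<subseteq> coords (cdim c)" using cmap_coords[OF M c(1)] by auto
  have comp: "smooth_on_subset (cdim c) ?A (\<lambda>y. ?k (?G y))"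
    by (rule smooth_on_subset_compose[OF ks Gs Ac GB(1)])
  then show ?S by (rule smooth_on_subset_cong) (simp add: GB(2))
  assume p: "p \<in> cdom c" "f p \<in> cdom c'" "h p \<in> cdom c''" and i: "i < cdim c"
  have pA: "cmap c p \<in> ?A" using p by auto
  have rA: "regular (cdim c) ?A" by (rule smooth_map_compose_region[OF M N P f g h c])
  have rB: "regular (cdim c') ?B" by (rule smooth_map_region_regular[OF N P g c(2,3)])
  have "partial_on (cdim c) ?A i (\<lambda>y. cmap c'' (h (chart_inv c y)) j) (cmap c p)
      = partial_on (cdim c) ?A i (\<lambda>y. ?k (?G y)) (cmap c p)"
    by (rule partial_on_cong) (simp add: GB(2))
  also have "\<dots> = (\<Sum>l<cdim c'. partial_on (cdim c) ?A i (\<lambda>y. ?G y l) (cmap c p) *\<^sub>R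
      partial_on (cdim c') ?B l ?k (?G (cmap c p)))"
    by (rule partial_on_compose[OF ks Gs Ac GB(1) rA rB pA i])
  also have "\<dots> = (\<Sum>l<cdim c'. partial_on (cdim c) (cmap c ` (cdom c \<inter> f -` cdom c')) i (\<lambda>y. ?G y l) (cmap c p)
           * partial_on (cdim c') ?B l ?k (cmap c' (f p)))"
  proof (rule sum.cong[OF refl])
    fix l assume l: "l \<in> {..<cdim c'}"
    have "partial_on (cdim c) ?A i (\<lambda>y. ?G y l) (cmap c p)
       = partial_on (cdim c) (cmap c ` (cdom c \<inter> f -` cdom c')) i (\<lambda>y. ?G y l) (cmap c p)"
      using l by (intro partial_on_subset[OF smooth_mapD[OF f c(1,2)] smooth_map_region_regular[OF M N f c(1,2)] rA _ pA i]) auto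
    then show "partial_on (cdim c) ?A i (\<lambda>y. ?G y l) (cmap c p) *\<^sub>R partial_on (cdim c') ?B l ?k (?G (cmap c p))
      = partial_on (cdim c) (cmap c ` (cdom c \<inter> f -` cdom c')) i (\<lambda>y. ?G y l) (cmap c p)
           * partial_on (cdim c') ?B l ?k (cmap c' (f p))"
      using chart_inv_cmap[OF M c(1) p(1)] by simp
  qed
  finally show "partial_on (cdim c) ?A i (\<lambda>y. cmap c'' (h (chart_inv c y)) j) (cmap c p) = \<dots>" .
qed

text \<open>Each point has a neighbourhood on which some chart of \<open>N\<close> serves as
  intermediate chart, and smoothness is local. The map \<open>h\<close> is compared with the
  composite on \<open>points M\<close> only, because \<open>simplex_map\<close> and
  \<open>singular_face\<close> are restricted to the simplex and take the value
  \<open>undefined\<close> elsewhere.\<close>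

lemma smooth_map_compose:
  assumes M: "corner_space M" and N: "corner_space N" and P: "corner_space P"
    and f: "smooth_map M N f" and g: "smooth_map N P g"
    and h: "\<And>x. x \<in> points M \<Longrightarrow> h x = g (f x)"
  shows "smooth_map M P h"
  unfolding smooth_map_def smooth_in_charts_def
proof (intro conjI ballI allI impI)
  have cf: "continuous_map (top_of M) (top_of N) f" and cg: "continuous_map (top_of N) (top_of P) g"
    using f g by (auto simp: smooth_map_def)
  show "continuous_map (top_of M) (top_of P) h"
    using continuous_map_eq[OF continuous_map_compose[OF cf cg]] h by auto
  fix c c'' j assume c: "c \<in> atlas M" "c'' \<in> atlas P" and j: "j < cdim c''"
  show "smooth_on_subset (cdim c) (cmap c ` (cdom c \<inter> h -` cdom c'')) (\<lambda>y. cmap c'' (h (chart_inv c y)) j)"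
  proof (rule smooth_on_subset_local)
    show "cmap c ` (cdom c \<inter> h -` cdom c'') \<subseteq> coords (cdim c)" using cmap_coords[OF M c(1)] by auto
    fix p assume "p \<in> cmap c ` (cdom c \<inter> h -` cdom c'')"
    then obtain x where x: "x \<in> cdom c" "h x \<in> cdom c''" "p = cmap c x" by auto
    then have "x \<in> points M" using openin_subset[OF corner_spaceD(1)[OF M c(1)]] by auto
    then have "f x \<in> points N" using continuous_map_image_subset_topspace[OF cf] by auto
    then have "chart_at N (f x) \<in> charts_at N (f x)" by (rule chart_at_in[OF N])
    then obtain c' where c': "c' \<in> atlas N" "f x \<in> cdom c'" by (auto simp: charts_at_def)
    obtain T where T: "openin (Euclidean_space (cdim c)) T"
    "cmap c ` (cdom c \<inter> f -` cdom c') \<inter> cmap c ` (cdom c \<inter> h -` cdom c'')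
       = cmap c ` (cdom c \<inter> h -` cdom c'') \<inter> T"
      by (rule smooth_map_compose_region[OF M N P f g h c(1) c'(1) c(2)]) (assumption | rule that)+
    have "p \<in> T" using x c' T(2) by blast
    then show "\<exists>U. openin (Euclidean_space (cdim c)) U \<and> p \<in> U \<and>
        smooth_on_subset (cdim c) (cmap c ` (cdom c \<inter> h -` cdom c'') \<inter> U) (\<lambda>y. cmap c'' (h (chart_inv c y)) j)"
      using smooth_in_compose_region(1)[OF M N P f g h c(1) c'(1) c(2) j] T by auto
  qed
qed

text \<open>The Jacobian matrices multiply. The chain rule holds on the region covered by the
  intermediate chart, and \<open>partial_on_subset\<close> identifies derivatives there with those
  on the larger region in the definition of \<open>coord_diff\<close>.\<close>

lemma coord_diff_compose:
  assumes M: "corner_space M" and N: "corner_space N" and P: "corner_space P"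
    and f: "smooth_map M N f" and g: "smooth_map N P g"
    and h: "\<And>x. x \<in> points M \<Longrightarrow> h x = g (f x)"
    and c: "c \<in> charts_at M p" "c' \<in> charts_at N (f p)" "c'' \<in> charts_at P (h p)"
  shows "coord_diff c c'' h p u = coord_diff c' c'' g (f p) (coord_diff c c' f p u)"
proof
  fix j
  note ca = charts_atD(1)[OF c(1)] charts_atD(1)[OF c(2)] charts_atD(1)[OF c(3)]
  note cp = charts_atD(2)[OF c(1)] charts_atD(2)[OF c(2)] charts_atD(2)[OF c(3)]
  have hs: "smooth_map M P h" by (rule smooth_map_compose[OF M N P f g h])
  show "coord_diff c c'' h p u j = coord_diff c' c'' g (f p) (coord_diff c c' f p u) j"
  proof (cases "j < cdim c''")
    case j: True
    let ?F = "\<lambda>i l. partial_on (cdim c) (cmap c ` (cdom c \<inter> f -` cdom c')) i (\<lambda>y. cmap c' (f (chart_inv c y)) l) (cmap c p)"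
    let ?K = "\<lambda>l. partial_on (cdim c') (cmap c' ` (cdom c' \<inter> g -` cdom c'')) l (\<lambda>y. cmap c'' (g (chart_inv c' y)) j) (cmap c' (f p))"
    have "partial_on (cdim c) (cmap c ` (cdom c \<inter> h -` cdom c'')) i (\<lambda>y. cmap c'' (h (chart_inv c y)) j) (cmap c p)
        = (\<Sum>l<cdim c'. ?F i l * ?K l)" if i: "i < cdim c" for i
    proof -
      let ?A = "cmap c ` (cdom c \<inter> f -` cdom c') \<inter> cmap c ` (cdom c \<inter> h -` cdom c'')"
      have rA: "regular (cdim c) ?A" by (rule smooth_map_compose_region[OF M N P f g h ca])
      have "partial_on (cdim c) ?A i (\<lambda>y. cmap c'' (h (chart_inv c y)) j) (cmap c p)
         = partial_on (cdim c) (cmap c ` (cdom c \<inter> h -` cdom c'')) i (\<lambda>y. cmap c'' (h (chart_inv c y)) j) (cmap c p)"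
        using cp by (intro partial_on_subset[OF smooth_mapD[OF hs ca(1,3) j] smooth_map_region_regular[OF M P hs ca(1,3)] rA _ _ i]) auto
      then show ?thesis
        using smooth_in_compose_region(2)[OF M N P f g h ca j cp i] by simp
    qed
    then have "coord_diff c c'' h p u j = (\<Sum>i<cdim c. (\<Sum>l<cdim c'. ?F i l * ?K l) * u i)"
      using j by (simp add: coord_diff_def)
    also have "\<dots> = (\<Sum>l<cdim c'. \<Sum>i<cdim c. ?K l * (?F i l * u i))"
      unfolding sum_distrib_right by (subst sum.swap) (simp add: mult_ac)
    also have "\<dots> = coord_diff c' c'' g (f p) (coord_diff c c' f p u) j"
      using j by (simp add: coord_diff_def sum_distrib_left)
    finally show ?thesis .
  qed (simp add: coord_diff_def)
qed

section \<open>Tangent vectors, tangent maps and functoriality of the pullback\<close>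

lemma coord_diff_coords: "coord_diff c c' f p u \<in> coords (cdim c')"
  by (simp add: coord_diff_def coords_def)

lemma coord_diff_id:
  assumes M: "corner_space M" and c: "c \<in> charts_at M p" and u: "u \<in> coords (cdim c)"
  shows "coord_diff c c (\<lambda>x. x) p u = u"
proof
  fix j
  note ca = charts_atD[OF c]
  let ?A = "cmap c ` (cdom c \<inter> (\<lambda>x. x) -` cdom c)"
  have r: "regular (cdim c) ?A" by (rule smooth_map_region_regular[OF M M smooth_map_id[OF M] ca(1) ca(1)])
  have "partial_on (cdim c) ?A i (\<lambda>y. cmap c (chart_inv c y) j) (cmap c p) = (if i = j then 1 else 0)"
    if "i < cdim c" for i
  proof -
    have "partial_on (cdim c) ?A i (\<lambda>y. cmap c (chart_inv c y) j) (cmap c p) = partial_on (cdim c) ?A i (\<lambda>y. y j) (cmap c p)"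
      using chart_inv_cmap[OF M ca(1)] by (intro partial_on_cong) auto
    then show ?thesis using partial_on_coord[OF r _ that] ca by auto
  qed
  then show "coord_diff c c (\<lambda>x. x) p u j = u j"
    using u coords_ge[OF u, of j] by (auto simp: coord_diff_def if_distrib[of "\<lambda>t. t * _"] cong: if_cong)
qed

lemma coord_diff_linear:
  "coord_diff c c' f p (\<lambda>j. a * u j + b * w j) = (\<lambda>j. a * coord_diff c c' f p u j + b * coord_diff c c' f p w j)"
  by (auto simp: coord_diff_def sum_distrib_left sum.distrib[symmetric] algebra_simps intro!: sum.cong)

lemma chart_vector_linear:
  "chart_vector M c p (\<lambda>j. a * u j + b * w j) = (\<lambda>c' j. a * chart_vector M c p u c' j + b * chart_vector M c p w c' j)"
  by (auto simp: chart_vector_def coord_diff_linear)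

lemma chart_vector_tangent:
  assumes M: "corner_space M" and c: "c \<in> charts_at M p"
  shows "chart_vector M c p u \<in> tangent_space M p"
  unfolding tangent_space_def
proof (intro CollectI conjI ballI allI impI)
  have e: "chart_vector M c p u d = coord_diff c d (\<lambda>x. x) p u" if "d \<in> charts_at M p" for d
    using that by (simp add: chart_vector_def)
  fix c' c'' assume c': "c' \<in> charts_at M p" and c'': "c'' \<in> charts_at M p"
  show "chart_vector M c p u c'' = coord_diff c' c'' (\<lambda>x. x) p (chart_vector M c p u c')"
    unfolding e[OF c'] e[OF c'']
    by (rule coord_diff_compose[OF M M M smooth_map_id[OF M] smooth_map_id[OF M] refl c c' c''])
qed (simp add: chart_vector_def)

lemma chart_vector_coord:
  assumes "corner_space M" "c \<in> charts_at M p" "u \<in> coords (cdim c)"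
  shows "chart_vector M c p u c = u"
  using coord_diff_id[OF assms] assms(2) by (simp add: chart_vector_def)

lemma tangent_space_coords:
  assumes "v \<in> tangent_space M p" "c \<in> charts_at M p" shows "v c \<in> coords (cdim c)"
proof -
  have "v c = coord_diff c c (\<lambda>x. x) p (v c)" using assms unfolding tangent_space_def by blast
  then show ?thesis using coord_diff_coords by metis
qed

text \<open>Removes the choice hidden in \<open>chart_at\<close>: the coordinates of
  \<open>v\<close> in the chosen chart are a transition Jacobian applied to \<open>v c\<close>, and
  this Jacobian is absorbed by the chain rule.\<close>

lemma tangent_map_coord:
  assumes M: "corner_space M" and N: "corner_space N" and f: "smooth_map M N f"
    and v: "v \<in> tangent_space M p" and c: "c \<in> charts_at M p" "c' \<in> charts_at N (f p)"
  shows "tangent_map M N f p v c' = coord_diff c c' f p (v c)"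
proof -
  let ?b = "chart_at M p"
  have b: "?b \<in> charts_at M p" using chart_at_in[OF M charts_at_points[OF M c(1)]] .
  have "v ?b = coord_diff c ?b (\<lambda>x. x) p (v c)" using v b c unfolding tangent_space_def by blast
  moreover have "coord_diff c c' f p (v c) = coord_diff ?b c' f p (coord_diff c ?b (\<lambda>x. x) p (v c))"
    by (rule coord_diff_compose[OF M M N smooth_map_id[OF M] f refl c(1) b c(2)])
  ultimately have "coord_diff ?b c' f p (v ?b) = coord_diff c c' f p (v c)"
    by metis
  then show ?thesis using c by (simp add: tangent_map_def)
qed

lemma smooth_map_points:
  assumes "smooth_map M N f" "p \<in> points M" shows "f p \<in> points N"
  using assms continuous_map_image_subset_topspace[of "top_of M" "top_of N" f] by (auto simp: smooth_map_def)

lemma tangent_map_chart_vector: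
  assumes M: "corner_space M" and N: "corner_space N" and f: "smooth_map M N f"
    and v: "v \<in> tangent_space M p" and c: "c \<in> charts_at M p" "c' \<in> charts_at N (f p)"
  shows "tangent_map M N f p v = chart_vector N c' (f p) (coord_diff c c' f p (v c))"
proof
  fix c''
  have "coord_diff c c'' f p (v c) = coord_diff c' c'' (\<lambda>x. x) (f p) (coord_diff c c' f p (v c))"
    if "c'' \<in> charts_at N (f p)"
    using coord_diff_compose[OF M N N f smooth_map_id[OF N] refl c that] .
  moreover have "tangent_map M N f p v c'' = coord_diff c c'' f p (v c)" if "c'' \<in> charts_at N (f p)"
    using tangent_map_coord[OF M N f v c(1) that] .
  ultimately show "tangent_map M N f p v c'' = chart_vector N c' (f p) (coord_diff c c' f p (v c)) c''"
    by (cases "c'' \<in> charts_at N (f p)") (simp_all only: chart_vector_def if_True, simp_all add: tangent_map_def)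
qed

lemma tangent_map_tangent:
  assumes M: "corner_space M" and N: "corner_space N" and f: "smooth_map M N f"
    and v: "v \<in> tangent_space M p" and p: "p \<in> points M"
  shows "tangent_map M N f p v \<in> tangent_space N (f p)"
  using tangent_map_chart_vector[OF M N f v chart_at_in[OF M p] chart_at_in[OF N smooth_map_points[OF f p]]]
    chart_vector_tangent[OF N chart_at_in[OF N smooth_map_points[OF f p]]] by simp

lemma tangent_map_compose:
  assumes M: "corner_space M" and N: "corner_space N" and P: "corner_space P"
    and f: "smooth_map M N f" and g: "smooth_map N P g"
    and h: "\<And>x. x \<in> points M \<Longrightarrow> h x = g (f x)"
    and v: "v \<in> tangent_space M p" and p: "p \<in> points M"
  shows "tangent_map M P h p v = tangent_map N P g (f p) (tangent_map M N f p v)"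
proof
  fix c''
  note c = chart_at_in[OF M p] and c' = chart_at_in[OF N smooth_map_points[OF f p]]
  note hs = smooth_map_compose[OF M N P f g h]
  show "tangent_map M P h p v c'' = tangent_map N P g (f p) (tangent_map M N f p v) c''"
  proof (cases "c'' \<in> charts_at P (h p)")
    case True
    then show ?thesis
      using tangent_map_coord[OF M P hs v c True] coord_diff_compose[OF M N P f g h c c' True]
        tangent_map_coord[OF M N f v c c'] h[OF p]
        tangent_map_coord[OF N P g tangent_map_tangent[OF M N f v p] c', of c''] by simp
  qed (simp add: tangent_map_def h[OF p])
qed

text \<open>The chain rule for tangent maps, applied entrywise. The equation holds between functions
  because both sides are \<open>0\<close> outside points and lists of tangent vectors.\<close>

lemma pullback_form_compose:
  assumes M: "corner_space M" and N: "corner_space N" and P: "corner_space P"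
    and f: "smooth_map M N f" and g: "smooth_map N P g"
    and h: "\<And>x. x \<in> points M \<Longrightarrow> h x = g (f x)"
  shows "pullback_form M P k h \<omega> = pullback_form M N k f (pullback_form N P k g \<omega>)"
proof (intro ext)
  fix p vs
  have "map (tangent_map M P h p) vs = map (tangent_map N P g (f p)) (map (tangent_map M N f p) vs)"
    "map (tangent_map M N f p) vs \<in> tangent_lists N k (f p)"
    if "p \<in> points M" "vs \<in> tangent_lists M k p"
    using that tangent_map_compose[OF M N P f g h] tangent_map_tangent[OF M N f]
    by (auto simp: tangent_lists_def subset_iff)
  then show "pullback_form M P k h \<omega> p vs = pullback_form M N k f (pullback_form N P k g \<omega>) p vs"
    using smooth_map_points[OF f, of p] h[of p]
    by (cases "p \<in> points M \<and> vs \<in> tangent_lists M k p") (auto simp: pullback_form_def simp del: map_map)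
qed

section \<open>Simplices and their products with manifolds\<close>

text \<open>In coordinates this is the product of the \<open>n\<close>-simplex with a space of
  dimension \<open>d - n\<close>. The second parameter lets the charts of the simplex and of its
  products with manifolds share one description.\<close>

definition coord_simplex :: "nat \<Rightarrow> nat \<Rightarrow> (nat \<Rightarrow> real) set" where
  "coord_simplex n d = {z \<in> coords d. (\<forall>i<n. 0 \<le> z i) \<and> (\<Sum>i<n. z i) \<le> 1}"

text \<open>The inverse of the simplex chart, which forgets the coordinate with index
  \<open>0\<close>. It reads only the first \<open>n\<close> coordinates and thus also applies to
  points of a product chart.\<close>

definition barycentric :: "nat \<Rightarrow> (nat \<Rightarrow> real) \<Rightarrow> nat \<Rightarrow> real" where
  "barycentric n y = (\<lambda>i. if i = 0 then 1 - (\<Sum>j<n. y j) else if i \<le> n then y (i - 1) else 0)"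

lemma coord_simplex_coords: "coord_simplex n d \<subseteq> coords d"
  by (auto simp: coord_simplex_def)

lemma barycentric_in:
  assumes "z \<in> coord_simplex n d" shows "barycentric n z \<in> standard_simplex n"
proof -
  have nn: "\<forall>i<n. 0 \<le> z i" and s: "(\<Sum>i<n. z i) \<le> 1" using assms by (auto simp: coord_simplex_def)
  have "z i \<le> 1" if "i < n" for i
    using member_le_sum[of i "{..<n}" z] nn s that by auto
  moreover have "0 \<le> (\<Sum>i<n. z i)" using nn by (auto intro: sum_nonneg)
  moreover have "(\<Sum>i\<le>n. barycentric n z i) = 1"
    by (simp add: sum.atMost_shift barycentric_def)
  ultimately show ?thesis
    using nn s by (auto simp: standard_simplex_def barycentric_def)
qed

lemma barycentric_inverse:
  assumes "t \<in> standard_simplex n" "\<And>i. i < n \<Longrightarrow> z i = t (Suc i)"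
  shows "barycentric n z = t"
proof
  fix i
  have "(\<Sum>j<n. z j) = (\<Sum>j<n. t (Suc j))" using assms by (intro sum.cong) auto
  moreover have "(\<Sum>i\<le>n. t i) = t 0 + (\<Sum>j<n. t (Suc j))" by (simp add: sum.atMost_shift)
  moreover have "(\<Sum>i\<le>n. t i) = 1" "\<forall>i>n. t i = 0" using assms by (auto simp: standard_simplex_def)
  ultimately show "barycentric n z i = t i"
    using assms(2)[of "i - 1"] by (auto simp: barycentric_def)
qed

lemma standard_simplex_coords:
  assumes "t \<in> standard_simplex n" shows "(\<lambda>i. if i < n then t (Suc i) else 0) \<in> coord_simplex n n"
proof -
  have "(\<Sum>i\<le>n. t i) = t 0 + (\<Sum>j<n. t (Suc j))" by (simp add: sum.atMost_shift)
  moreover have "(\<Sum>i\<le>n. t i) = 1" "\<forall>i. 0 \<le> t i" using assms by (auto simp: standard_simplex_def)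
  ultimately have "(\<Sum>j<n. t (Suc j)) \<le> 1" "\<forall>i. 0 \<le> t i" by (smt (verit))+
  then show ?thesis by (auto simp: coord_simplex_def coords_def)
qed

lemma continuous_on_barycentric: "continuous_on S (barycentric n)"
proof (rule continuous_on_coordinatewise_then_product)
  have c: "continuous_on S (\<lambda>y::nat \<Rightarrow> real. y j)" for j
    by (rule continuous_on_subset[OF continuous_on_product_coordinates]) auto
  show "continuous_on S (\<lambda>x. barycentric n x i)" for i
    unfolding barycentric_def by (cases "i = 0"; cases "i \<le> n") (auto intro!: continuous_intros c)
qed

text \<open>A point is pushed slightly towards the barycentre, whose first \<open>n\<close>
  coordinates are \<open>1 / (n + 1)\<close>. The result satisfies all defining inequalities
  strictly and is as close to the point as desired.\<close>

lemma regular_coord_simplex: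
  assumes "n \<le> d" shows "regular d (coord_simplex n d)"
  unfolding regular_def
proof (intro conjI ballI allI impI coord_simplex_coords)
  fix p U assume p: "p \<in> coord_simplex n d" and "openin (Euclidean_space d) U \<and> p \<in> U"
  then obtain e where e: "e > 0" "cube d p e \<subseteq> U" and oU: "openin (Euclidean_space d) U"
    using openin_imp_cube by blast
  let ?I = "{z \<in> coords d. (\<forall>i<n. 0 < z i) \<and> (\<Sum>i<n. z i) < 1}"
  have "open {z::nat \<Rightarrow> real. (\<forall>i\<in>{..<n}. 0 < z i) \<and> (\<Sum>i<n. z i) < 1}"
  proof -
    have c: "continuous_on UNIV (\<lambda>y::nat \<Rightarrow> real. y j)" for j
      by (rule continuous_on_product_coordinates)
    have "open (\<Inter>i\<in>{..<n}. {z::nat \<Rightarrow> real. 0 < z i})"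
      by (intro open_INT) (auto intro!: open_Collect_less c continuous_intros)
    moreover have "open {z::nat \<Rightarrow> real. (\<Sum>i<n. z i) < 1}"
      by (intro open_Collect_less continuous_intros c)
    ultimately have "open ((\<Inter>i\<in>{..<n}. {z::nat \<Rightarrow> real. 0 < z i}) \<inter> {z. (\<Sum>i<n. z i) < 1})" by blast
    then show ?thesis by (rule back_subst[where P="open"]) auto
  qed
  then have "openin (Euclidean_space d) (coords d \<inter> {z. (\<forall>i\<in>{..<n}. 0 < z i) \<and> (\<Sum>i<n. z i) < 1})"
    unfolding Euclidean_space_coords openin_open by blast
  then have oI: "openin (Euclidean_space d) ?I" by (rule back_subst[where P="openin _"]) auto
  \<comment> \<open>The step length \<open>s\<close> moves no coordinate by more than
    \<open>s\<close>, since all differences to the barycentre are at most \<open>1\<close>;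
    \<open>e / 2\<close> keeps the new point in the cube and \<open>1/2\<close> keeps the
    combination convex.\<close>
  define s where "s = min (1/2) (e / 2)"
  have s: "0 < s" "s < 1" "s < e" using e by (auto simp: s_def min_def)
  define q where "q = (\<lambda>i. if i < n then (1 - s) * p i + s / (real n + 1) else p i)"
  have p': "\<forall>i<n. 0 \<le> p i" "(\<Sum>i<n. p i) \<le> 1" "p \<in> coords d" using p by (auto simp: coord_simplex_def)
  have "p i \<le> 1" if "i < n" for i using member_le_sum[of i "{..<n}" p] p' that by auto
  have "\<bar>q i - p i\<bar> < e" for i
  proof (cases "i < n")
    case True
    have "q i - p i = s * (1 / (real n + 1) - p i)" using True by (simp add: q_def algebra_simps)
    moreover have "\<bar>1 / (real n + 1) - p i\<bar> \<le> 1"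
    proof -
      have "0 \<le> 1 / (real n + 1)" "1 / (real n + 1) \<le> 1" "0 \<le> p i" "p i \<le> 1"
        using p'(1) \<open>i < n \<Longrightarrow> p i \<le> 1\<close> True by auto
      then show ?thesis by linarith
    qed
    ultimately have "\<bar>q i - p i\<bar> \<le> s" using s by (simp add: abs_mult mult_left_le)
    then show ?thesis using s by simp
  qed (use e in \<open>simp add: q_def\<close>)
  then have "q \<in> cube d p e" using p'(3) assms by (auto simp: cube_def q_def coords_def)
  moreover have "q \<in> ?I"
  proof -
    have "(\<Sum>i<n. q i) = (1 - s) * (\<Sum>i<n. p i) + s * (real n / (real n + 1))"
      by (simp add: q_def sum.distrib sum_distrib_left)
    also have "\<dots> < (1 - s) * 1 + s * 1"
      using p'(2) s by (intro add_le_less_mono mult_left_mono mult_strict_left_mono) auto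
    finally have "(\<Sum>i<n. q i) < 1" by simp
    moreover have "0 < q i" if "i < n" for i
      using p'(1) s that by (auto simp: q_def intro!: add_nonneg_pos)
    ultimately show ?thesis using p'(3) assms by (auto simp: q_def coords_def)
  qed
  ultimately have "q \<in> ?I \<inter> U" using e by blast
  moreover have "?I \<inter> U \<subseteq> coord_simplex n d \<inter> U" by (auto simp: coord_simplex_def less_imp_le)
  ultimately show "\<exists>V. openin (Euclidean_space d) V \<and> V \<noteq> {} \<and> V \<subseteq> coord_simplex n d \<inter> U"
    using openin_Int[OF oI oU] by blast
qed

section \<open>The standard simplex as a manifold with corners\<close>

lemma simplex_chart_simps [simp]:
  "cdom (simplex_chart n) = standard_simplex n" "cdim (simplex_chart n) = n"
  "cmap (simplex_chart n) t i = (if i < n then t (Suc i) else 0)"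
  by (auto simp: simplex_chart_def)

lemma atlas_simplex_space [simp]: "atlas (simplex_space n) = {simplex_chart n}"
  by (simp add: simplex_space_def)

lemma top_of_simplex_space: "top_of (simplex_space n) = top_of_set (standard_simplex n)"
  by (simp add: simplex_space_def euclidean_product_topology)

lemma points_simplex_space [simp]: "points (simplex_space n) = standard_simplex n"
  by (simp add: top_of_simplex_space)

lemma simplex_chart_barycentric:
  assumes "y \<in> coord_simplex n n" shows "cmap (simplex_chart n) (barycentric n y) = y"
proof
  fix i show "cmap (simplex_chart n) (barycentric n y) i = y i"
    using assms coords_ge[of y n i] by (auto simp: barycentric_def coord_simplex_def not_less)
qed

lemma simplex_chart_image: "cmap (simplex_chart n) ` standard_simplex n = coord_simplex n n"
proof
  show "cmap (simplex_chart n) ` standard_simplex n \<subseteq> coord_simplex n n"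
    using standard_simplex_coords by (auto simp: simplex_chart_def)
  show "coord_simplex n n \<subseteq> cmap (simplex_chart n) ` standard_simplex n"
    using simplex_chart_barycentric barycentric_in by (metis image_eqI subsetI)
qed

lemma inj_on_simplex_chart: "inj_on (cmap (simplex_chart n)) (standard_simplex n)"
proof (rule inj_onI)
  fix s t assume st: "s \<in> standard_simplex n" "t \<in> standard_simplex n" "cmap (simplex_chart n) s = cmap (simplex_chart n) t"
  have "barycentric n (cmap (simplex_chart n) s) = s"
    by (rule barycentric_inverse[OF st(1)]) simp
  moreover have "barycentric n (cmap (simplex_chart n) t) = t"
    by (rule barycentric_inverse[OF st(2)]) simp
  ultimately show "s = t" using st(3) by metis
qed

lemma chart_inv_simplex:
  assumes "y \<in> coord_simplex n n" shows "chart_inv (simplex_chart n) y = barycentric n y"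
  using inv_into_f_f[OF inj_on_simplex_chart barycentric_in[OF assms]] simplex_chart_barycentric[OF assms]
  by (simp add: chart_inv_def)

lemma corner_space_simplex: "corner_space (simplex_space n)"
  unfolding corner_space_def
proof (intro conjI ballI)
  fix c c' assume c: "c \<in> atlas (simplex_space n)"
  then have c_eq: "c = simplex_chart n" by simp
  show "openin (top_of (simplex_space n)) (cdom c)"
    using c_eq openin_topspace[of "top_of (simplex_space n)"] by simp
  show "regular (cdim c) (cmap c ` cdom c)"
    using regular_coord_simplex[of n n] simplex_chart_image by (simp add: c_eq)
  show "inj_on (cmap c) (cdom c)" using inj_on_simplex_chart by (simp add: c_eq)
  have "continuous_map (subtopology (Euclidean_space n) (coord_simplex n n)) (top_of (simplex_space n)) (barycentric n)"
    using continuous_on_barycentric barycentric_in coord_simplex_coords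
    by (auto simp: top_of_simplex_space Euclidean_space_coords subtopology_subtopology)
  then have "continuous_map (subtopology (Euclidean_space n) (coord_simplex n n)) (top_of (simplex_space n)) (chart_inv c)"
    by (rule continuous_map_eq) (auto simp: c_eq chart_inv_simplex)
  then show "continuous_map (subtopology (Euclidean_space (cdim c)) (cmap c ` cdom c)) (top_of (simplex_space n)) (chart_inv c)"
    using simplex_chart_image by (simp add: c_eq)
  assume "c' \<in> atlas (simplex_space n)"
  then have c'_eq: "c' = simplex_chart n" by simp
  have "smooth_on_subset n (coord_simplex n n) (\<lambda>y. chart_inv (simplex_chart n) y (Suc j))" if "j < n" for j
    using smooth_on_subset_coord[OF coord_simplex_coords[of n n], of j]
    by (rule smooth_on_subset_cong) (use that in \<open>simp add: chart_inv_simplex barycentric_def\<close>)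
  then show "smooth_in_charts c c' (\<lambda>x. x)"
    using simplex_chart_image[of n] by (simp add: smooth_in_charts_def c_eq c'_eq)
qed simp

section \<open>Products of a simplex with a manifold\<close>

lemma simplex_times_chart_simps [simp]:
  "cdom (simplex_times_chart n c) = standard_simplex n \<times> cdom c"
  "cdim (simplex_times_chart n c) = n + cdim c"
  "cmap (simplex_times_chart n c) (t, x) i = (if i < n then t (Suc i) else cmap c x (i - n))"
  by (auto simp: simplex_times_chart_def)

lemma atlas_simplex_times [simp]: "atlas (simplex_times n M) = simplex_times_chart n ` atlas M"
  by (simp add: simplex_times_def)

lemma points_simplex_times [simp]: "points (simplex_times n M) = standard_simplex n \<times> points M"
  by (simp add: simplex_times_def)

definition shift_coords :: "nat \<Rightarrow> (nat \<Rightarrow> real) \<Rightarrow> nat \<Rightarrow> real" where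
  "shift_coords n z = (\<lambda>i. z (i + n))"

lemma shift_coords_in: "z \<in> coords (n + m) \<Longrightarrow> shift_coords n z \<in> coords m"
  by (auto simp: coords_def shift_coords_def)

lemma continuous_on_shift_coords: "continuous_on S (shift_coords n)"
  by (auto simp: shift_coords_def intro!: continuous_on_coordinatewise_then_product
      intro: continuous_on_subset[OF continuous_on_product_coordinates])

lemma smooth_manifoldD:
  assumes "smooth_manifold M" "c \<in> atlas M"
  shows "openin (top_of M) (cdom c)" "openin (Euclidean_space (cdim c)) (cmap c ` cdom c)"
    "homeomorphic_map (subtopology (top_of M) (cdom c))
          (subtopology (Euclidean_space (cdim c)) (cmap c ` cdom c)) (cmap c)"
  using assms unfolding smooth_manifold_def by auto

lemma smooth_manifold_chart:
  assumes M: "smooth_manifold M" and c: "c \<in> atlas M"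
  shows "inj_on (cmap c) (cdom c)"
    "continuous_map (subtopology (Euclidean_space (cdim c)) (cmap c ` cdom c)) (top_of M) (chart_inv c)"
proof -
  note h = smooth_manifoldD[OF M c]
  let ?X = "subtopology (top_of M) (cdom c)" and ?Y = "subtopology (Euclidean_space (cdim c)) (cmap c ` cdom c)"
  have tX: "topspace ?X = cdom c" and tY: "topspace ?Y = cmap c ` cdom c"
    using openin_subset[OF h(1)] openin_subset[OF h(2)] by (auto simp: Int_absorb1)
  show inj: "inj_on (cmap c) (cdom c)"
    using homeomorphic_imp_injective_map[OF h(3)] tX by simp
  obtain g where g: "homeomorphic_maps ?X ?Y (cmap c) g"
    using h(3) by (auto simp: homeomorphic_map_maps)
  then have gc: "continuous_map ?Y ?X g" and gi: "\<And>x. x \<in> cdom c \<Longrightarrow> g (cmap c x) = x"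
    using tX by (auto simp: homeomorphic_maps_def)
  have "continuous_map ?Y (top_of M) g" using gc by (simp add: continuous_map_in_subtopology)
  then show "continuous_map ?Y (top_of M) (chart_inv c)"
  proof (rule continuous_map_eq)
    fix y assume "y \<in> topspace ?Y"
    then obtain x where "x \<in> cdom c" "y = cmap c x" using tY by auto
    then show "g y = chart_inv c y" using gi inj by (simp add: chart_inv_def)
  qed
qed

lemma simplex_times_chart_image:
  assumes M: "smooth_manifold M" and c: "c \<in> atlas M"
  shows "cmap (simplex_times_chart n c) ` (standard_simplex n \<times> cdom c)
     = {z \<in> coord_simplex n (n + cdim c). shift_coords n z \<in> cmap c ` cdom c}" (is "?L = ?R")
proof
  have mc: "cmap c x \<in> coords (cdim c)" if "x \<in> cdom c" for x
    using openin_coords_subset[OF smooth_manifoldD(2)[OF M c]] that by auto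
  show "?L \<subseteq> ?R"
  proof
    fix z assume "z \<in> ?L"
    then obtain t x where tx: "t \<in> standard_simplex n" "x \<in> cdom c" "z = cmap (simplex_times_chart n c) (t, x)" by auto
    have "shift_coords n z = cmap c x" by (auto simp: shift_coords_def tx)
    moreover have "z \<in> coords (n + cdim c)" using mc[OF tx(2)] by (auto simp: coords_def tx)
    moreover have "(\<forall>i<n. 0 \<le> z i) \<and> (\<Sum>i<n. z i) \<le> 1"
      using standard_simplex_coords[OF tx(1)] by (simp add: coord_simplex_def tx)
    ultimately show "z \<in> ?R" using tx by (auto simp: coord_simplex_def)
  qed
  show "?R \<subseteq> ?L"
  proof
    fix z assume "z \<in> ?R"
    then obtain x where z: "z \<in> coord_simplex n (n + cdim c)" and x: "x \<in> cdom c" "shift_coords n z = cmap c x" by auto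
    have "z = cmap (simplex_times_chart n c) (barycentric n z, x)"
    proof
      fix i show "z i = cmap (simplex_times_chart n c) (barycentric n z, x) i"
        using x(2)[symmetric] by (auto simp: barycentric_def shift_coords_def)
    qed
    then show "z \<in> ?L" using barycentric_in[OF z] x by blast
  qed
qed

lemma inj_on_simplex_times_chart:
  assumes M: "smooth_manifold M" and c: "c \<in> atlas M"
  shows "inj_on (cmap (simplex_times_chart n c)) (standard_simplex n \<times> cdom c)"
proof (rule inj_onI, clarify)
  fix s x t y assume st: "s \<in> standard_simplex n" "t \<in> standard_simplex n" and xy: "x \<in> cdom c" "y \<in> cdom c"
    and e: "cmap (simplex_times_chart n c) (s, x) = cmap (simplex_times_chart n c) (t, y)"
  have "s (Suc i) = t (Suc i)" if "i < n" for i
    using fun_cong[OF e, of i] that by simp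
  then have "barycentric n (\<lambda>i. s (Suc i)) = s" "barycentric n (\<lambda>i. s (Suc i)) = t"
    by (auto intro!: barycentric_inverse st)
  moreover have "cmap c x i = cmap c y i" for i using fun_cong[OF e, of "i + n"] by simp
  then have "x = y" using smooth_manifold_chart(1)[OF M c] xy by (auto dest: inj_onD)
  ultimately show "s = t \<and> x = y" by simp
qed

lemma chart_inv_simplex_times:
  assumes M: "smooth_manifold M" and c: "c \<in> atlas M"
    and z: "z \<in> cmap (simplex_times_chart n c) ` (standard_simplex n \<times> cdom c)"
  shows "chart_inv (simplex_times_chart n c) z = (barycentric n z, chart_inv c (shift_coords n z))"
proof -
  obtain t x where tx: "t \<in> standard_simplex n" "x \<in> cdom c" "z = cmap (simplex_times_chart n c) (t, x)"
    using z by auto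
  have "shift_coords n z = cmap c x" by (auto simp: shift_coords_def tx)
  then have "chart_inv c (shift_coords n z) = x"
    using smooth_manifold_chart(1)[OF M c] tx(2) by (simp add: chart_inv_def)
  moreover have "barycentric n z = t" by (rule barycentric_inverse[OF tx(1)]) (simp add: tx)
  moreover have "chart_inv (simplex_times_chart n c) z = (t, x)"
    unfolding chart_inv_def tx(3) using inj_on_simplex_times_chart[OF M c] tx(1,2)
    by (subst inv_into_f_f) auto
  ultimately show ?thesis by simp
qed

text \<open>Smoothness is required on \<open>coord_simplex n d\<close> for every \<open>d\<close>,
  with passive extra coordinates, so that the same predicate covers \<alpha> as a map of simplices
  and as the first factor of a product map.\<close>

definition simplex_map_smooth :: "nat \<Rightarrow> nat \<Rightarrow> ((nat \<Rightarrow> real) \<Rightarrow> nat \<Rightarrow> real) \<Rightarrow> bool" where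
  "simplex_map_smooth n n' \<alpha> \<longleftrightarrow>
     \<alpha> ` standard_simplex n \<subseteq> standard_simplex n' \<and> continuous_on (standard_simplex n) \<alpha> \<and>
     (\<forall>d. \<forall>j<n'. smooth_on_subset d (coord_simplex n d) (\<lambda>z. \<alpha> (barycentric n z) (Suc j)))"

lemma simplex_map_smooth_id: "simplex_map_smooth n n (\<lambda>t. t)"
  unfolding simplex_map_smooth_def
proof (intro conjI allI impI)
  fix d j assume "j < n"
  then show "smooth_on_subset d (coord_simplex n d) (\<lambda>z. barycentric n z (Suc j))"
    using smooth_on_subset_coord[OF coord_simplex_coords[of n d], of j] by (simp add: barycentric_def)
qed (auto intro: continuous_on_id)

lemma simplex_map_smooth_face:
  assumes "i \<le> Suc n" shows "simplex_map_smooth n (Suc n) (simplical_face i)"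
  unfolding simplex_map_smooth_def
proof (intro conjI allI impI)
  show "simplical_face i ` standard_simplex n \<subseteq> standard_simplex (Suc n)"
    using simplical_face_in_standard_simplex[of "Suc n" i] assms by auto
  have c: "continuous_on S (\<lambda>y::nat \<Rightarrow> real. y j)" for j S
    by (rule continuous_on_subset[OF continuous_on_product_coordinates]) auto
  have "continuous_on (standard_simplex n) (\<lambda>x. simplical_face i x j :: real)" for j
    using c by (cases "j < i"; cases "j = i") (auto simp: simplical_face_def)
  then show "continuous_on (standard_simplex n) (simplical_face i)"
    by (rule continuous_on_coordinatewise_then_product)
  fix d j assume "j < Suc n"
  have "smooth_on_subset d (coord_simplex n d) (\<lambda>z. barycentric n z l)" for l
  proof -
    have m: "smooth_on_subset d (coord_simplex n d) (\<lambda>z. 1 + (- 1) * (\<Sum>j<n. z j))"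
      by (intro smooth_on_subset_add smooth_on_subset_mult smooth_on_subset_sum smooth_on_subset_const
          smooth_on_subset_coord coord_simplex_coords)
    consider "l = 0" | "l \<noteq> 0" "l \<le> n" | "l > n" by linarith
    then show ?thesis
      using m smooth_on_subset_coord[OF coord_simplex_coords[of n d], of "l - 1"]
        smooth_on_subset_const[OF coord_simplex_coords[of n d], of "0::real"]
      by cases (simp_all add: barycentric_def)
  qed
  then show "smooth_on_subset d (coord_simplex n d) (\<lambda>z. simplical_face i (barycentric n z) (Suc j))"
    using smooth_on_subset_const[OF coord_simplex_coords[of n d], of "0::real"]
    by (cases "Suc j < i"; cases "Suc j = i") (simp_all add: simplical_face_def)
qed

lemma smooth_map_simplex:
  assumes "simplex_map_smooth n n' \<alpha>" shows "smooth_map (simplex_space n) (simplex_space n') \<alpha>"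
  unfolding smooth_map_def smooth_in_charts_def
proof (intro conjI ballI allI impI)
  show "continuous_map (top_of (simplex_space n)) (top_of (simplex_space n')) \<alpha>"
    using assms by (auto simp: top_of_simplex_space simplex_map_smooth_def)
  fix c c' j assume c: "c \<in> atlas (simplex_space n)" "c' \<in> atlas (simplex_space n')" "j < cdim c'"
  have "cmap (simplex_chart n) ` (standard_simplex n \<inter> \<alpha> -` standard_simplex n') = coord_simplex n n"
    using assms unfolding simplex_chart_image[symmetric] simplex_map_smooth_def by blast
  moreover have "smooth_on_subset n (coord_simplex n n) (\<lambda>z. \<alpha> (chart_inv (simplex_chart n) z) (Suc j))"
    by (rule smooth_on_subset_cong[of n _ "\<lambda>z. \<alpha> (barycentric n z) (Suc j)"])
       (use assms c in \<open>auto simp: simplex_map_smooth_def chart_inv_simplex\<close>)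
  ultimately show "smooth_on_subset (cdim c) (cmap c ` (cdom c \<inter> \<alpha> -` cdom c')) (\<lambda>y. cmap c' (\<alpha> (chart_inv c y)) j)"
    using c by simp
qed

text \<open>The first \<open>n'\<close> target coordinates depend only on the simplex coordinates
  and are smooth by the condition on \<alpha>; the others are the coordinate expression of
  \<open>f\<close> after \<open>shift_coords\<close>, which is linear.\<close>

lemma smooth_in_charts_map_prod:
  assumes M: "smooth_manifold M" and N: "smooth_manifold N" and c: "c \<in> atlas M" "c' \<in> atlas N"
    and \<alpha>: "simplex_map_smooth n n' \<alpha>" and f: "smooth_in_charts c c' f"
  shows "smooth_in_charts (simplex_times_chart n c) (simplex_times_chart n' c') (map_prod \<alpha> f)"
  unfolding smooth_in_charts_def
proof (intro allI impI)
  let ?A = "cmap (simplex_times_chart n c) ` (cdom (simplex_times_chart n c) \<inter> map_prod \<alpha> f -` cdom (simplex_times_chart n' c'))"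
  let ?B = "cmap c ` (cdom c \<inter> f -` cdom c')"
  let ?d = "n + cdim c"
  have A1: "?A \<subseteq> cmap (simplex_times_chart n c) ` (standard_simplex n \<times> cdom c)" by auto
  then have As: "?A \<subseteq> coord_simplex n ?d" using simplex_times_chart_image[OF M c(1), of n] by auto
  then have Ac: "?A \<subseteq> coords ?d" using coord_simplex_coords by blast
  have shB: "shift_coords n z \<in> ?B" if "z \<in> ?A" for z
  proof -
    obtain t x where "x \<in> cdom c" "f x \<in> cdom c'" "z = cmap (simplex_times_chart n c) (t, x)"
      using \<open>z \<in> ?A\<close> by auto
    moreover then have "shift_coords n z = cmap c x" by (auto simp: shift_coords_def)
    ultimately show ?thesis by auto
  qed
  fix j assume "j < cdim (simplex_times_chart n' c')"
  then have j: "j < n' + cdim c'" by simp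
  have inv: "chart_inv (simplex_times_chart n c) z = (barycentric n z, chart_inv c (shift_coords n z))" if "z \<in> ?A" for z
    using chart_inv_simplex_times[OF M c(1)] A1 that by blast
  have "smooth_on_subset ?d ?A (\<lambda>y. cmap (simplex_times_chart n' c') (map_prod \<alpha> f (chart_inv (simplex_times_chart n c) y)) j)"
  proof (cases "j < n'")
    case True
    have "smooth_on_subset ?d (coord_simplex n ?d) (\<lambda>z. \<alpha> (barycentric n z) (Suc j))"
      using \<alpha> True by (simp add: simplex_map_smooth_def)
    from smooth_on_subset_mono[OF this As] show ?thesis
      by (rule smooth_on_subset_cong) (simp add: inv True)
  next
    case False
    then have "smooth_on_subset (cdim c) ?B (\<lambda>y. cmap c' (f (chart_inv c y)) (j - n'))"
      using f j by (simp add: smooth_in_charts_def)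
    then have "smooth_on_subset ?d ?A (\<lambda>z. cmap c' (f (chart_inv c (shift_coords n z))) (j - n'))"
    proof (rule smooth_on_subset_compose[OF _ _ Ac shB])
      show "smooth_on_subset ?d ?A (\<lambda>x. shift_coords n x l)" for l
        unfolding shift_coords_def by (rule smooth_on_subset_coord[OF Ac])
    qed
    then show ?thesis by (rule smooth_on_subset_cong) (simp add: inv False)
  qed
  then show "smooth_on_subset (cdim (simplex_times_chart n c)) ?A
     (\<lambda>y. cmap (simplex_times_chart n' c') (map_prod \<alpha> f (chart_inv (simplex_times_chart n c) y)) j)"
    by simp
qed

lemma smooth_map_map_prod:
  assumes M: "smooth_manifold M" and N: "smooth_manifold N"
    and \<alpha>: "simplex_map_smooth n n' \<alpha>" and f: "smooth_map M N f"
  shows "smooth_map (simplex_times n M) (simplex_times n' N) (map_prod \<alpha> f)"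
  unfolding smooth_map_def
proof (intro conjI ballI)
  have "continuous_map (top_of (simplex_space n)) (top_of (simplex_space n')) \<alpha>"
    using smooth_map_simplex[OF \<alpha>] by (simp add: smooth_map_def)
  then show "continuous_map (top_of (simplex_times n M)) (top_of (simplex_times n' N)) (map_prod \<alpha> f)"
    using f unfolding smooth_map_def simplex_times_def map_prod_def
    by (auto simp: continuous_map_prod_top)
  fix c c' assume "c \<in> atlas (simplex_times n M)" "c' \<in> atlas (simplex_times n' N)"
  then obtain b b' where b: "b \<in> atlas M" "b' \<in> atlas N" "c = simplex_times_chart n b" "c' = simplex_times_chart n' b'" by auto
  then show "smooth_in_charts c c' (map_prod \<alpha> f)"
    using smooth_in_charts_map_prod[OF M N b(1,2) \<alpha>] f by (simp add: smooth_map_def)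
qed

text \<open>A chart image is \<open>coord_simplex\<close> intersected with the preimage of an open
  set under \<open>shift_coords\<close>, so regularity comes from the simplex. Chart changes are
  product maps of the identity with a chart change of \<open>M\<close>.\<close>

lemma corner_space_simplex_times:
  assumes M: "smooth_manifold M" shows "corner_space (simplex_times n M)"
  unfolding corner_space_def
proof (intro conjI ballI)
  show "(\<Union>c\<in>atlas (simplex_times n M). cdom c) = points (simplex_times n M)"
    using M by (auto simp: smooth_manifold_def)
  fix c assume "c \<in> atlas (simplex_times n M)"
  then obtain b where b: "b \<in> atlas M" "c = simplex_times_chart n b" by auto
  let ?I = "cmap c ` cdom c"
  have I: "?I = {z \<in> coord_simplex n (n + cdim b). shift_coords n z \<in> cmap b ` cdom b}"
    using simplex_times_chart_image[OF M b(1)] b by simp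
  have "openin (top_of (simplex_space n)) (standard_simplex n)"
    using openin_topspace[of "top_of (simplex_space n)"] by simp
  then show "openin (top_of (simplex_times n M)) (cdom c)"
    using smooth_manifoldD(1)[OF M b(1)] b by (simp add: simplex_times_def openin_prod_Times_iff)
  have sc: "continuous_map (Euclidean_space (n + cdim b)) (Euclidean_space (cdim b)) (shift_coords n)"
    using continuous_on_shift_coords shift_coords_in by (auto simp: Euclidean_space_coords)
  from openin_continuous_map_preimage[OF this smooth_manifoldD(2)[OF M b(1)]]
  have "regular (n + cdim b) (coord_simplex n (n + cdim b) \<inter>
      {z \<in> topspace (Euclidean_space (n + cdim b)). shift_coords n z \<in> cmap b ` cdom b})"
    by (intro regular_Int_open regular_coord_simplex) auto
  moreover have "coord_simplex n (n + cdim b) \<inter>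
      {z \<in> topspace (Euclidean_space (n + cdim b)). shift_coords n z \<in> cmap b ` cdom b} = ?I"
    using coord_simplex_coords[of n "n + cdim b"] by (auto simp: I topspace_coords)
  ultimately show "regular (cdim c) ?I" using b by simp
  show "inj_on (cmap c) (cdom c)" using inj_on_simplex_times_chart[OF M b(1)] b by simp
  show "continuous_map (subtopology (Euclidean_space (cdim c)) ?I) (top_of (simplex_times n M)) (chart_inv c)"
  proof -
    let ?E = "subtopology (Euclidean_space (cdim c)) ?I"
    have "continuous_map ?E (top_of (simplex_space n)) (barycentric n)"
      using continuous_on_barycentric barycentric_in I b
      by (auto simp: top_of_simplex_space Euclidean_space_coords subtopology_subtopology)
    moreover have "continuous_map ?E (subtopology (Euclidean_space (cdim b)) (cmap b ` cdom b)) (shift_coords n)"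
      using continuous_map_from_subtopology[OF sc] I b
      by (auto simp: continuous_map_in_subtopology)
    then have "continuous_map ?E (top_of M) (chart_inv b \<circ> shift_coords n)"
      using smooth_manifold_chart(2)[OF M b(1)] by (rule continuous_map_compose)
    ultimately have "continuous_map ?E (top_of (simplex_times n M)) (\<lambda>z. (barycentric n z, chart_inv b (shift_coords n z)))"
      by (simp add: simplex_times_def continuous_map_paired o_def)
    then show ?thesis
      by (rule continuous_map_eq) (use chart_inv_simplex_times[OF M b(1)] b in auto)
  qed
  fix c' assume "c' \<in> atlas (simplex_times n M)"
  then obtain b' where b': "b' \<in> atlas M" "c' = simplex_times_chart n b'" by auto
  have "smooth_in_charts b b' (\<lambda>x. x)" using M b b' by (simp add: smooth_manifold_def)
  from smooth_in_charts_map_prod[OF M M b(1) b'(1) simplex_map_smooth_id this]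
  show "smooth_in_charts c c' (\<lambda>x. x)" by (simp add: b b' map_prod_ident)
qed

section \<open>Alternating forms in coordinates\<close>

definition unit_vec :: "nat \<Rightarrow> nat \<Rightarrow> real" where
  "unit_vec a = (\<lambda>i. if i = a then 1 else 0)"

text \<open>Multilinearity and alternation on coordinate vectors, phrased by splitting the argument
  list at the entries concerned instead of by positions. Linear combinations are taken in one step,
  so that sums, multiples and zero are special cases.\<close>

locale alternating =
  fixes k d :: nat and \<phi> :: "(nat \<Rightarrow> real) list \<Rightarrow> complex"
  assumes linear: "Suc (length xs + length ys) = k \<Longrightarrow> set xs \<subseteq> coords d \<Longrightarrow> set ys \<subseteq> coords d \<Longrightarrow>
      u \<in> coords d \<Longrightarrow> w \<in> coords d \<Longrightarrow>
      \<phi> (xs @ (\<lambda>j. a * u j + b * w j) # ys) = of_real a * \<phi> (xs @ u # ys) + of_real b * \<phi> (xs @ w # ys)"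
    and repeated: "Suc (Suc (length xs + length ys + length zs)) = k \<Longrightarrow> set xs \<subseteq> coords d \<Longrightarrow>
      set ys \<subseteq> coords d \<Longrightarrow> set zs \<subseteq> coords d \<Longrightarrow> u \<in> coords d \<Longrightarrow> \<phi> (xs @ u # ys @ u # zs) = 0"
begin

lemma zero_entry:
  assumes "Suc (length xs + length ys) = k" "set xs \<subseteq> coords d" "set ys \<subseteq> coords d"
  shows "\<phi> (xs @ (\<lambda>_. 0) # ys) = 0"
  using linear[OF assms, of "\<lambda>_. 0" "\<lambda>_. 0" 0 0] by (simp add: coords_def)

lemma sum_entry:
  assumes "Suc (length xs + length ys) = k" "set xs \<subseteq> coords d" "set ys \<subseteq> coords d"
    and "finite I" "\<And>i. i \<in> I \<Longrightarrow> u i \<in> coords d"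
  shows "\<phi> (xs @ (\<lambda>j. \<Sum>i\<in>I. a i * u i j) # ys) = (\<Sum>i\<in>I. of_real (a i) * \<phi> (xs @ u i # ys))"
  using assms(4,5)
proof (induction I rule: finite_induct)
  case empty then show ?case using zero_entry[OF assms(1-3)] by simp
next
  case (insert i I)
  have "(\<lambda>j. \<Sum>i\<in>I. a i * u i j) \<in> coords d" using insert by (auto simp: coords_def)
  then show ?case
    using linear[OF assms(1-3), of "u i" "\<lambda>j. \<Sum>i\<in>I. a i * u i j" "a i" 1] insert by simp
qed

lemma basis_entry:
  assumes "Suc (length xs + length ys) = k" "set xs \<subseteq> coords d" "set ys \<subseteq> coords d" "u \<in> coords d"
  shows "\<phi> (xs @ u # ys) = (\<Sum>i<d. of_real (u i) * \<phi> (xs @ unit_vec i # ys))"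
proof -
  have "u = (\<lambda>j. \<Sum>i<d. u i * unit_vec i j)"
  proof
    fix j show "u j = (\<Sum>i<d. u i * unit_vec i j)"
      using coords_ge[OF assms(4), of j] by (cases "j < d") (auto simp: unit_vec_def if_distrib cong: if_cong)
  qed
  then have "\<phi> (xs @ u # ys) = \<phi> (xs @ (\<lambda>j. \<Sum>i<d. u i * unit_vec i j) # ys)" by simp
  also have "\<dots> = (\<Sum>i<d. of_real (u i) * \<phi> (xs @ unit_vec i # ys))"
    by (rule sum_entry[OF assms(1-3)]) (auto simp: unit_vec_def coords_def)
  finally show ?thesis .
qed

text \<open>Polarisation: expand the vanishing value with \<open>u + w\<close> in both adjacent
  places.\<close>

lemma swap_adjacent:
  assumes "Suc (Suc (length xs + length ys)) = k" "set xs \<subseteq> coords d" "set ys \<subseteq> coords d"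
    "u \<in> coords d" "w \<in> coords d"
  shows "\<phi> (xs @ u # w # ys) = - \<phi> (xs @ w # u # ys)"
proof -
  let ?s = "\<lambda>j. 1 * u j + 1 * w j"
  have s: "?s \<in> coords d" using assms by (auto simp: coords_def)
  have z: "\<phi> (xs @ v # v # ys) = 0" if "v \<in> coords d" for v
    using repeated[of xs "[]" ys v] assms that by simp
  have "0 = \<phi> (xs @ ?s # ?s # ys)" using z[OF s] by simp
  also have "\<dots> = \<phi> (xs @ u # ?s # ys) + \<phi> (xs @ w # ?s # ys)"
    using linear[of xs "?s # ys" u w 1 1] assms s by simp
  also have "\<phi> (xs @ u # ?s # ys) = \<phi> (xs @ u # w # ys)"
    using linear[of "xs @ [u]" ys u w 1 1] assms z by simp
  also have "\<phi> (xs @ w # ?s # ys) = \<phi> (xs @ w # u # ys)"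
    using linear[of "xs @ [w]" ys u w 1 1] assms z by simp
  finally show ?thesis by (simp add: eq_neg_iff_add_eq_0)
qed

lemma move_entry:
  assumes "Suc (length xs + length ys + length zs) = k" "set xs \<subseteq> coords d" "set ys \<subseteq> coords d"
    "set zs \<subseteq> coords d" "h \<in> coords d"
  shows "\<phi> (xs @ h # ys @ zs) = (-1) ^ length ys * \<phi> (xs @ ys @ h # zs)"
  using assms
proof (induction ys arbitrary: xs)
  case (Cons y ys)
  have "\<phi> (xs @ h # y # ys @ zs) = - \<phi> ((xs @ [y]) @ h # ys @ zs)"
    using swap_adjacent[of xs "ys @ zs" h y] Cons.prems by simp
  also have "\<dots> = - ((-1) ^ length ys * \<phi> ((xs @ [y]) @ ys @ h # zs))"
    using Cons.IH[of "xs @ [y]"] Cons.prems by simp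
  finally show ?case by simp
qed simp

end

text \<open>Each variable entry is expanded in the standard basis, which turns it into constant
  entries with smooth coefficients. The list \<open>us\<close> collects the entries that are already
  constant.\<close>

lemma smooth_on_subset_eval:
  assumes A: "A \<subseteq> coords m" and \<phi>: "\<And>y. y \<in> A \<Longrightarrow> alternating k d (\<phi> y)"
    and c: "\<And>us. length us = k \<Longrightarrow> set us \<subseteq> coords d \<Longrightarrow> smooth_on_subset m A (\<lambda>y. \<phi> y us)"
    and "length us + length Vs = k" "set us \<subseteq> coords d"
    and "\<And>V y. V \<in> set Vs \<Longrightarrow> y \<in> A \<Longrightarrow> V y \<in> coords d"
    and "\<And>V l. V \<in> set Vs \<Longrightarrow> l < d \<Longrightarrow> smooth_on_subset m A (\<lambda>y. V y l)"
  shows "smooth_on_subset m A (\<lambda>y. \<phi> y (us @ map (\<lambda>V. V y) Vs))"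
  using assms(4-7)
proof (induction Vs arbitrary: us)
  case Nil then show ?case using c by simp
next
  case (Cons V Vs)
  have u: "unit_vec i \<in> coords d" if "i < d" for i using that by (auto simp: unit_vec_def coords_def)
  have "smooth_on_subset m A (\<lambda>y. \<Sum>i<d. of_real (V y i) * \<phi> y ((us @ [unit_vec i]) @ map (\<lambda>V. V y) Vs))"
    using Cons.prems u
    by (intro smooth_on_subset_sum A smooth_on_subset_mult smooth_on_subset_of_real Cons.IH) auto
  then show ?case
  proof (rule smooth_on_subset_cong)
    fix y assume y: "y \<in> A"
    show "(\<Sum>i<d. of_real (V y i) * \<phi> y ((us @ [unit_vec i]) @ map (\<lambda>V. V y) Vs)) = \<phi> y (us @ map (\<lambda>V. V y) (V # Vs))"
    proof -
      have "set (map (\<lambda>V. V y) Vs) \<subseteq> coords d" "V y \<in> coords d" using Cons.prems(3) y by auto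
      then show ?thesis
        using alternating.basis_entry[OF \<phi>[OF y], of us "map (\<lambda>V. V y) Vs" "V y"] Cons.prems(1,2) by simp
    qed
  qed
qed

text \<open>\<open>Vs\<close> lists the vector fields along the curve together with their derivatives.\<close>

lemma has_vector_derivative_eval:
  fixes t0 :: real
  assumes \<phi>: "\<forall>\<^sub>F t in nhds t0. alternating k d (\<phi> t)"
    and c: "\<And>us. length us = k \<Longrightarrow> set us \<subseteq> coords d \<Longrightarrow> ((\<lambda>t. \<phi> t us) has_vector_derivative \<psi> us) (at t0)"
    and "length us + length Vs = k" "set us \<subseteq> coords d"
    and "\<And>V t. V \<in> set Vs \<Longrightarrow> fst V t \<in> coords d" "\<And>V. V \<in> set Vs \<Longrightarrow> snd V \<in> coords d"
    and "\<And>V l. V \<in> set Vs \<Longrightarrow> l < d \<Longrightarrow> ((\<lambda>t. fst V t l) has_real_derivative snd V l) (at t0)"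
  shows "((\<lambda>t. \<phi> t (us @ map (\<lambda>V. fst V t) Vs)) has_vector_derivative
     \<psi> (us @ map (\<lambda>V. fst V t0) Vs)
       + (\<Sum>a<length Vs. \<phi> t0 (us @ (map (\<lambda>V. fst V t0) Vs)[a := snd (Vs ! a)]))) (at t0)"
  using assms(3-7)
proof (induction Vs arbitrary: us)
  case Nil then show ?case using c by simp
next
  case (Cons V Vs)
  have u: "unit_vec i \<in> coords d" if "i < d" for i using that by (auto simp: unit_vec_def coords_def)
  let ?Vs = "\<lambda>t. map (\<lambda>V. fst V t) Vs"
  let ?D = "\<lambda>i. \<psi> (us @ unit_vec i # ?Vs t0)
       + (\<Sum>a<length Vs. \<phi> t0 (us @ unit_vec i # (?Vs t0)[a := snd (Vs ! a)]))"
  have \<phi>0: "alternating k d (\<phi> t0)" using \<phi> by (rule eventually_nhds_x_imp_x)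
  have D: "((\<lambda>t. \<phi> t (us @ unit_vec i # ?Vs t)) has_vector_derivative ?D i) (at t0)" if "i < d" for i
    using Cons.IH[of "us @ [unit_vec i]"] Cons.prems u[OF that] by simp
  \<comment> \<open>The first field is expanded in the basis, and the product rule separates its own
    derivative from that of the remaining expression, which is covered by the induction
    hypothesis.\<close>
  have "((\<lambda>t. \<Sum>i<d. of_real (fst V t i) * \<phi> t (us @ unit_vec i # ?Vs t)) has_vector_derivative
      (\<Sum>i<d. of_real (fst V t0 i) * ?D i + of_real (snd V i) * \<phi> t0 (us @ unit_vec i # ?Vs t0))) (at t0)"
  proof (intro has_vector_derivative_sum)
    fix i assume i: "i \<in> {..<d}"
    have "((\<lambda>t. of_real (fst V t i) :: complex) has_vector_derivative of_real (snd V i)) (at t0)"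
      using Cons.prems(5)[of V i] i by (auto intro: has_vector_derivative_of_real)
    from has_vector_derivative_mult[OF this D[of i]] i
    show "((\<lambda>t. of_real (fst V t i) * \<phi> t (us @ unit_vec i # ?Vs t)) has_vector_derivative
      of_real (fst V t0 i) * ?D i + of_real (snd V i) * \<phi> t0 (us @ unit_vec i # ?Vs t0)) (at t0)" by simp
  qed
  moreover have "\<forall>\<^sub>F t in nhds t0. (\<Sum>i<d. of_real (fst V t i) * \<phi> t (us @ unit_vec i # ?Vs t))
      = \<phi> t (us @ map (\<lambda>V. fst V t) (V # Vs))"
    using \<phi>
  proof eventually_elim
    case (elim t)
    have "set (?Vs t) \<subseteq> coords d" "fst V t \<in> coords d" using Cons.prems(3) by auto
    then show ?case
      using alternating.basis_entry[OF elim, of us "?Vs t" "fst V t"] Cons.prems(1,2) by simp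
  qed
  ultimately have "((\<lambda>t. \<phi> t (us @ map (\<lambda>V. fst V t) (V # Vs))) has_vector_derivative
      (\<Sum>i<d. of_real (fst V t0 i) * ?D i + of_real (snd V i) * \<phi> t0 (us @ unit_vec i # ?Vs t0))) (at t0)"
    by (subst has_vector_derivative_cong_ev[where g="\<lambda>t. \<Sum>i<d. of_real (fst V t i) * \<phi> t (us @ unit_vec i # ?Vs t)"])
       (auto elim!: eventually_mono dest: eventually_nhds_x_imp_x)
  \<comment> \<open>Linearity of \<psi> in this entry is inherited from the forms: both sides are
    the derivative of the same function of \<open>t\<close>, so uniqueness of derivatives gives the
    equation.\<close>
  moreover have "\<psi> (us @ fst V t0 # ?Vs t0) = (\<Sum>i<d. of_real (fst V t0 i) * \<psi> (us @ unit_vec i # ?Vs t0))"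
  proof (rule vector_derivative_unique_at)
    show "((\<lambda>t. \<phi> t (us @ fst V t0 # ?Vs t0)) has_vector_derivative \<psi> (us @ fst V t0 # ?Vs t0)) (at t0)"
      using Cons.prems by (intro c) auto
    have "((\<lambda>t. \<Sum>i<d. of_real (fst V t0 i) * \<phi> t (us @ unit_vec i # ?Vs t0)) has_vector_derivative
        (\<Sum>i<d. of_real (fst V t0 i) * \<psi> (us @ unit_vec i # ?Vs t0))) (at t0)"
      using Cons.prems u
      by (intro has_vector_derivative_sum has_vector_derivative_mult_right c) auto
    moreover have "\<forall>\<^sub>F t in nhds t0. (\<Sum>i<d. of_real (fst V t0 i) * \<phi> t (us @ unit_vec i # ?Vs t0))
      = \<phi> t (us @ fst V t0 # ?Vs t0)"
      using \<phi>
    proof eventually_elim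
      case (elim t)
      have "set (?Vs t0) \<subseteq> coords d" "fst V t0 \<in> coords d" using Cons.prems(3) by auto
      then show ?case
        using alternating.basis_entry[OF elim, of us "?Vs t0" "fst V t0"] Cons.prems(1,2) by simp
    qed
    ultimately show "((\<lambda>t. \<phi> t (us @ fst V t0 # ?Vs t0)) has_vector_derivative
        (\<Sum>i<d. of_real (fst V t0 i) * \<psi> (us @ unit_vec i # ?Vs t0))) (at t0)"
      by (subst has_vector_derivative_cong_ev[where g="\<lambda>t. \<Sum>i<d. of_real (fst V t0 i) * \<phi> t (us @ unit_vec i # ?Vs t0)"])
         (auto elim!: eventually_mono dest: eventually_nhds_x_imp_x)
  qed
  moreover have "(\<Sum>a<length (V # Vs). \<phi> t0 (us @ (map (\<lambda>V. fst V t0) (V # Vs))[a := snd ((V # Vs) ! a)]))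
     = \<phi> t0 (us @ snd V # ?Vs t0) + (\<Sum>a<length Vs. \<phi> t0 (us @ fst V t0 # (?Vs t0)[a := snd (Vs ! a)]))"
    by (simp add: sum.lessThan_Suc_shift del: sum.lessThan_Suc)
  moreover have "\<phi> t0 (us @ snd V # ?Vs t0) = (\<Sum>i<d. of_real (snd V i) * \<phi> t0 (us @ unit_vec i # ?Vs t0))"
  proof -
    have "set (?Vs t0) \<subseteq> coords d" "snd V \<in> coords d" using Cons.prems(3,4) by auto
    then show ?thesis
      using alternating.basis_entry[OF \<phi>0, of us "?Vs t0" "snd V"] Cons.prems(1,2) by simp
  qed
  moreover have "\<phi> t0 (us @ fst V t0 # (?Vs t0)[a := snd (Vs ! a)])
      = (\<Sum>i<d. of_real (fst V t0 i) * \<phi> t0 (us @ unit_vec i # (?Vs t0)[a := snd (Vs ! a)]))"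
    if "a < length Vs" for a
  proof -
    have "set (?Vs t0) \<subseteq> coords d" "snd (Vs ! a) \<in> coords d" "fst V t0 \<in> coords d"
      using Cons.prems(3,4) that by auto
    moreover from this have "set ((?Vs t0)[a := snd (Vs ! a)]) \<subseteq> coords d"
      using set_update_subset_insert[of "?Vs t0" a "snd (Vs ! a)"] by (meson insert_subset subset_trans)
    ultimately show ?thesis
      using alternating.basis_entry[OF \<phi>0, of us "(?Vs t0)[a := snd (Vs ! a)]" "fst V t0"] Cons.prems(1,2) by simp
  qed
  moreover have "(\<Sum>a<length Vs. \<Sum>i<d. of_real (fst V t0 i) * \<phi> t0 (us @ unit_vec i # (?Vs t0)[a := snd (Vs ! a)]))
     = (\<Sum>i<d. of_real (fst V t0 i) * (\<Sum>a<length Vs. \<phi> t0 (us @ unit_vec i # (?Vs t0)[a := snd (Vs ! a)])))"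
    by (subst sum.swap) (simp add: sum_distrib_left)
  ultimately show ?case
    by (simp add: sum.distrib algebra_simps)
qed

section \<open>Omitted entries and the cancellation of second derivatives\<close>

lemma omit_nth_simps: "length xs = j \<Longrightarrow> omit_nth j (xs @ y # ys) = xs @ ys"
  by (simp add: omit_nth_def)

lemma map_omit_nth: "map f (omit_nth j xs) = omit_nth j (map f xs)"
  by (simp add: omit_nth_def take_map drop_map)

lemma length_omit_nth: "j < length xs \<Longrightarrow> length (omit_nth j xs) = length xs - 1"
  by (simp add: omit_nth_def)

lemma set_omit_nth: "set (omit_nth j xs) \<subseteq> set xs"
  using set_take_subset set_drop_subset by (fastforce simp: omit_nth_def)

lemma nth_omit_nth:
  assumes "j < length xs" "a < length xs - 1"
  shows "omit_nth j xs ! a = xs ! (if a < j then a else Suc a)"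
  using assms by (auto simp: omit_nth_def nth_append)

lemma omit_nth_update:
  assumes "j < length xs" "a < length xs - 1"
  shows "(omit_nth j xs)[a := h] = omit_nth j (xs[(if a < j then a else Suc a) := h])"
  by (rule nth_equalityI) (use assms in \<open>auto simp: length_omit_nth nth_omit_nth nth_list_update\<close>)

text \<open>For \<open>j < b\<close>, omitting entry \<open>j\<close> and replacing entry
  \<open>b\<close> by \<open>h j b\<close> differs from the same with \<open>j\<close> and
  \<open>b\<close> exchanged only in the place of one vector, which moves past
  \<open>b - j - 1\<close> others. Together with \<open>(-1) ^ j\<close> and \<open>(-1) ^ b\<close>
  the two terms cancel. With \<open>h\<close> the second derivatives of a map, this is why they drop
  out of the exterior derivative of a pullback.\<close>

lemma (in alternating) hessian_cancel:
  assumes X: "length X = Suc k" "set X \<subseteq> coords d"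
    and h: "\<And>j b. h j b \<in> coords d" "\<And>j b. j \<le> k \<Longrightarrow> b \<le> k \<Longrightarrow> h j b = h b j"
  shows "(\<Sum>j\<le>k. (-1) ^ j * (\<Sum>a<k. \<phi> ((omit_nth j X)[a := h j (if a < j then a else Suc a)]))) = 0"
proof -
  define f where "f j b = (if j = b then 0 else (-1) ^ j * \<phi> (omit_nth j (X[b := h j b])))" for j b
  have lt: "f j b = - f b j" if jb: "j < b" "b \<le> k" for j b
  proof -
    \<comment> \<open>The three stretches before, between and after the positions \<open>j\<close>
      and \<open>b\<close>.\<close>
    define P Q R where "P = take j (take b X)" "Q = drop (Suc j) (take b X)" "R = drop (Suc b) X"
    have len: "length P = j" "length Q = b - j - 1" "length R = k - b"
      using X jb by (auto simp: P_Q_R_def)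
    have "X = take b X @ X ! b # R" using X jb unfolding P_Q_R_def by (intro id_take_nth_drop) simp
    moreover have "take b X = P @ take b X ! j # Q" using X jb unfolding P_Q_R_def by (intro id_take_nth_drop) simp
    ultimately have XQ: "X = P @ X ! j # Q @ X ! b # R" using jb by simp
    have "set P \<subseteq> set X" "set Q \<subseteq> set X" "set R \<subseteq> set X"
      unfolding P_Q_R_def by (meson set_take_subset set_drop_subset subset_trans)+
    then have s: "set P \<subseteq> coords d" "set Q \<subseteq> coords d" "set R \<subseteq> coords d"
      using X(2) by auto
    have "length (P @ X ! j # Q) = b" using len jb by simp
    then have "((P @ X ! j # Q) @ X ! b # R)[b := h j b] = (P @ X ! j # Q) @ h j b # R"
      using list_update_length[of "P @ X ! j # Q" "X ! b" R "h j b"] by simp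
    moreover have "X[b := h j b] = (P @ X ! j # Q @ X ! b # R)[b := h j b]" by (rule arg_cong[OF XQ])
    ultimately have "X[b := h j b] = P @ X ! j # Q @ h j b # R" by simp
    then have 1: "omit_nth j (X[b := h j b]) = P @ Q @ h j b # R"
      using len by (simp add: omit_nth_simps)
    have "X[j := h b j] = (P @ X ! j # Q @ X ! b # R)[j := h b j]" by (rule arg_cong[OF XQ])
    also have "\<dots> = (P @ h b j # Q) @ X ! b # R"
      using list_update_length[of P "X ! j" "Q @ X ! b # R" "h b j"] len(1) by simp
    finally have "X[j := h b j] = (P @ h b j # Q) @ X ! b # R" .
    then have 2: "omit_nth b (X[j := h b j]) = P @ h b j # Q @ R"
      using omit_nth_simps[of "P @ h b j # Q" b "X ! b" R] len jb by simp
    have "\<phi> (P @ h b j # Q @ R) = (-1) ^ length Q * \<phi> (P @ Q @ h b j # R)"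
      using len jb s h(1) by (intro move_entry) auto
    moreover have hs: "h j b = h b j" using h(2)[of j b] jb by simp
    moreover have "b = j + Suc (length Q)" using len jb by simp
    then have "(-1::complex) ^ b = - ((-1) ^ j * (-1) ^ length Q)"
      by (simp only: power_add power_Suc) simp
    moreover have "(-1::complex) ^ length Q * (-1) ^ length Q = 1" by (simp flip: power_mult_distrib)
    ultimately show ?thesis
      using jb 1[unfolded hs] by (simp add: f_def 2 mult.assoc)
  qed
  have anti: "f j b = - f b j" if "j \<le> k" "b \<le> k" for j b
    using lt[of j b] lt[of b j] that by (cases j b rule: linorder_cases) (auto simp: f_def)
  \<comment> \<open>Position \<open>a\<close> in the shortened list is position \<open>a\<close> or
    \<open>Suc a\<close> in the full one, so the inner sum runs over all \<open>b\<close> different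
    from \<open>j\<close>; the term \<open>b = j\<close> of \<open>f\<close> is
    \<open>0\<close>.\<close>
  have re: "(-1) ^ j * (\<Sum>a<k. \<phi> ((omit_nth j X)[a := h j (if a < j then a else Suc a)])) = (\<Sum>b\<le>k. f j b)" if j: "j \<le> k" for j
  proof -
    let ?g = "\<lambda>a. if a < j then a else Suc a"
    have bij: "bij_betw ?g {..<k} ({..k} - {j})"
    proof (rule bij_betw_byWitness[where f'="\<lambda>b. if b < j then b else b - 1"])
    qed (use j in auto)
    have "(\<Sum>b\<le>k. f j b) = (\<Sum>b\<in>{..k} - {j}. f j b)"
      by (rule sum.mono_neutral_right) (auto simp: f_def)
    also have "\<dots> = (\<Sum>a<k. f j (?g a))" by (rule sum.reindex_bij_betw[OF bij, symmetric])
    also have "\<dots> = (\<Sum>a<k. (-1) ^ j * \<phi> ((omit_nth j X)[a := h j (?g a)]))"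
      using j X by (intro sum.cong refl) (auto simp: f_def omit_nth_update)
    finally show ?thesis by (simp add: sum_distrib_left)
  qed
  have "(\<Sum>j\<le>k. \<Sum>b\<le>k. f j b) = (\<Sum>j\<le>k. \<Sum>b\<le>k. f b j)" by (rule sum.swap)
  also have "\<dots> = (\<Sum>j\<le>k. \<Sum>b\<le>k. - f j b)"
    by (intro sum.cong refl anti) auto
  also have "\<dots> = - (\<Sum>j\<le>k. \<Sum>b\<le>k. f j b)" by (simp add: sum_negf)
  finally have "(\<Sum>j\<le>k. \<Sum>b\<le>k. f j b) = 0" by simp
  then show ?thesis using re by simp
qed

section \<open>Pullbacks of forms in coordinates\<close>

lemma smooth_formD:
  assumes "smooth_form M k \<omega>"
  shows "p \<in> points M \<Longrightarrow> multilinear_form M k p (\<omega> p)" "p \<in> points M \<Longrightarrow> alternating_form M k p (\<omega> p)"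
    "c \<in> atlas M \<Longrightarrow> length us = k \<Longrightarrow> set us \<subseteq> coords (cdim c) \<Longrightarrow>
       smooth_on_subset (cdim c) (cmap c ` cdom c) (local_rep M c \<omega> us)"
  using assms unfolding smooth_form_def by (auto simp: topspace_coords)

lemma chart_inv_in:
  assumes "corner_space M" "c \<in> atlas M" "y \<in> cmap c ` cdom c"
  shows "chart_inv c y \<in> cdom c" "c \<in> charts_at M (chart_inv c y)" "chart_inv c y \<in> points M"
    "cmap c (chart_inv c y) = y"
proof -
  obtain x where x: "x \<in> cdom c" "y = cmap c x" using assms by auto
  then have e: "chart_inv c y = x" using chart_inv_cmap[OF assms(1,2)] by simp
  show "chart_inv c y \<in> cdom c" "cmap c (chart_inv c y) = y" using e x by auto
  show c: "c \<in> charts_at M (chart_inv c y)" using e x assms by (simp add: charts_at_def)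
  show "chart_inv c y \<in> points M" by (rule charts_at_points[OF assms(1) c])
qed

lemma alternating_local_rep:
  assumes M: "corner_space M" and \<omega>: "smooth_form M k \<omega>" and c: "c \<in> atlas M" and y: "y \<in> cmap c ` cdom c"
  shows "alternating k (cdim c) (\<lambda>us. local_rep M c \<omega> us y)"
proof -
  let ?p = "chart_inv c y"
  let ?v = "chart_vector M c ?p"
  note p = chart_inv_in[OF M c y]
  have t: "?v u \<in> tangent_space M ?p" for u by (rule chart_vector_tangent[OF M p(2)])
  have ts: "set (map ?v us) \<subseteq> tangent_space M ?p" for us using t by auto
  show ?thesis
  proof
    fix xs ys :: "(nat \<Rightarrow> real) list" and u w :: "nat \<Rightarrow> real" and a b :: real
    assume len: "Suc (length xs + length ys) = k"
    let ?vs = "map ?v xs @ ?v u # map ?v ys"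
    have vs: "?vs \<in> tangent_lists M k ?p" using len t by (auto simp: tangent_lists_def)
    have i: "length xs < k" using len by simp
    have "\<omega> ?p (?vs[length xs := (\<lambda>c' j. a * ?v u c' j + b * ?v w c' j)])
       = of_real a * \<omega> ?p (?vs[length xs := ?v u]) + of_real b * \<omega> ?p (?vs[length xs := ?v w])"
      by (rule smooth_formD(1)[OF \<omega> p(3), unfolded multilinear_form_def, rule_format, OF vs i t t])
    moreover have "?vs[length xs := z] = map ?v xs @ z # map ?v ys" for z
      using list_update_length[of "map ?v xs" "?v u" "map ?v ys" z] by simp
    ultimately show "local_rep M c \<omega> (xs @ (\<lambda>j. a * u j + b * w j) # ys) y
       = of_real a * local_rep M c \<omega> (xs @ u # ys) y + of_real b * local_rep M c \<omega> (xs @ w # ys) y"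
      by (simp add: local_rep_def chart_vector_linear)
  next
    fix xs ys zs :: "(nat \<Rightarrow> real) list" and u :: "nat \<Rightarrow> real"
    assume len: "Suc (Suc (length xs + length ys + length zs)) = k"
    let ?vs = "map ?v xs @ ?v u # map ?v ys @ ?v u # map ?v zs"
    have vs: "?vs \<in> tangent_lists M k ?p" using len t by (auto simp: tangent_lists_def)
    have ij: "length xs < k" "Suc (length xs + length ys) < k" using len by simp_all
    have "?vs ! length xs = ?v u" by (simp add: nth_append)
    moreover have "?vs ! Suc (length xs + length ys) = ?v u"
      by (simp add: nth_append)
    ultimately have "\<omega> ?p ?vs = 0"
      using smooth_formD(2)[OF \<omega> p(3), unfolded alternating_form_def, rule_format, OF vs ij] by simp
    then show "local_rep M c \<omega> (xs @ u # ys @ u # zs) y = 0"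
      by (simp add: local_rep_def)
  qed
qed

text \<open>The tangent map sends the vector with coordinates \<open>u\<close> to the one whose
  coordinates are the Jacobian applied to \<open>u\<close>, and it may be read in any chart
  \<open>c'\<close> at the image point.\<close>

lemma local_rep_pullback:
  assumes M: "corner_space M" and N: "corner_space N" and f: "smooth_map M N f"
    and c: "c \<in> atlas M" "y \<in> cmap c ` cdom c" and c': "c' \<in> charts_at N (f (chart_inv c y))"
    and us: "length us = k" "set us \<subseteq> coords (cdim c)"
  shows "local_rep M c (pullback_form M N k f \<omega>) us y
    = local_rep N c' \<omega> (map (coord_diff c c' f (chart_inv c y)) us) (cmap c' (f (chart_inv c y)))"
proof -
  let ?p = "chart_inv c y"
  note p = chart_inv_in[OF M c]
  have ts: "map (chart_vector M c ?p) us \<in> tangent_lists M k ?p"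
    using us(1) chart_vector_tangent[OF M p(2)] by (auto simp: tangent_lists_def)
  have "map (tangent_map M N f ?p) (map (chart_vector M c ?p) us)
      = map (chart_vector N c' (f ?p)) (map (coord_diff c c' f ?p) us)"
    using tangent_map_chart_vector[OF M N f chart_vector_tangent[OF M p(2)] p(2) c'] us(2)
      chart_vector_coord[OF M p(2)] by auto
  moreover have "chart_inv c' (cmap c' (f ?p)) = f ?p"
    using chart_inv_cmap[OF N] charts_atD[OF c'] by blast
  ultimately show ?thesis
    using ts p(3) by (simp add: local_rep_def pullback_form_def del: map_map)
qed

lemma unit_vec_coords: "i < d \<Longrightarrow> unit_vec i \<in> coords d"
  by (auto simp: unit_vec_def coords_def)

lemma coord_diff_unit:
  assumes "a < cdim c"
  shows "coord_diff c c' f p (unit_vec a) = (\<lambda>l. if l < cdim c' then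
     partial_on (cdim c) (cmap c ` (cdom c \<inter> f -` cdom c')) a (\<lambda>y. cmap c' (f (chart_inv c y)) l) (cmap c p) else 0)"
  using assms by (auto simp: coord_diff_def unit_vec_def if_distrib[of "\<lambda>t. _ * t"] cong: if_cong)

text \<open>Near a point \<open>f\<close> lands in one chart \<open>c'\<close>. There the
  coefficient is a coefficient function of \<omega> along \<open>f\<close>, evaluated at the images
  of \<open>us\<close> under the Jacobian, which vary smoothly, so
  \<open>smooth_on_subset_eval\<close> applies.\<close>

lemma smooth_on_subset_local_rep_pullback:
  assumes M: "corner_space M" and N: "corner_space N" and f: "smooth_map M N f"
    and \<omega>: "smooth_form N k \<omega>" and c: "c \<in> atlas M"
    and us: "length us = k" "set us \<subseteq> coords (cdim c)"
  shows "smooth_on_subset (cdim c) (cmap c ` cdom c) (local_rep M c (pullback_form M N k f \<omega>) us)"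
proof (rule smooth_on_subset_local)
  let ?A = "cmap c ` cdom c"
  show Ac: "?A \<subseteq> coords (cdim c)" using cmap_coords[OF M c] by auto
  fix y0 assume y0: "y0 \<in> ?A"
  note p0 = chart_inv_in[OF M c y0]
  obtain c' where c': "c' \<in> charts_at N (f (chart_inv c y0))"
    using chart_at_in[OF N smooth_map_points[OF f p0(3)]] by blast
  note c'a = charts_atD(1)[OF c']
  have cf: "continuous_map (top_of M) (top_of N) f" using f by (simp add: smooth_map_def)
  obtain U where U: "openin (top_of M) U" "cdom c \<inter> f -` cdom c' = cdom c \<inter> U"
    by (rule smooth_map_open_vimage[OF M N cf c c'a]) (rule that)
  obtain T where T: "openin (Euclidean_space (cdim c)) T" "cmap c ` (cdom c \<inter> U) = ?A \<inter> T"
    by (rule chart_region_open[OF M c U(1)]) (rule that)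
  have AT: "?A \<inter> T = cmap c ` (cdom c \<inter> f -` cdom c')" using T(2) U(2) by simp
  let ?F = "\<lambda>y. cmap c' (f (chart_inv c y))"
  let ?J = "\<lambda>u y. coord_diff c c' f (chart_inv c y) u"
  have in_dom: "chart_inv c y \<in> cdom c" "f (chart_inv c y) \<in> cdom c'" "c' \<in> charts_at N (f (chart_inv c y))" "y \<in> ?A"
    if y: "y \<in> ?A \<inter> T" for y
  proof -
    obtain x where x: "x \<in> cdom c" "f x \<in> cdom c'" "y = cmap c x" using y AT by auto
    then have "chart_inv c y = x" using chart_inv_cmap[OF M c] by simp
    then show "chart_inv c y \<in> cdom c" "f (chart_inv c y) \<in> cdom c'" "c' \<in> charts_at N (f (chart_inv c y))"
      using x c'a by (auto simp: charts_at_def)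
    show "y \<in> ?A" using y by simp
  qed
  have rAT: "regular (cdim c) (?A \<inter> T)" by (rule regular_Int_open[OF corner_spaceD(2)[OF M c] T(1)])
  have Fs: "smooth_on_subset (cdim c) (?A \<inter> T) (\<lambda>y. ?F y l)" if "l < cdim c'" for l
    unfolding AT by (rule smooth_mapD[OF f c c'a that])
  have Js: "smooth_on_subset (cdim c) (?A \<inter> T) (\<lambda>y. ?J u y l)" if "l < cdim c'" for u l
  proof -
    have "smooth_on_subset (cdim c) (?A \<inter> T) (\<lambda>y. \<Sum>i<cdim c. partial_on (cdim c) (?A \<inter> T) i (\<lambda>y. ?F y l) y * u i)"
      using Fs[OF that] rAT Ac
      by (intro smooth_on_subset_sum smooth_on_subset_mult smooth_on_subset_partial_on smooth_on_subset_const) auto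
    then show ?thesis
      by (rule smooth_on_subset_cong)
         (use that in \<open>auto simp: coord_diff_def AT[symmetric] chart_inv_in(4)[OF M c] in_dom(4)\<close>)
  qed
  have "smooth_on_subset (cdim c) (?A \<inter> T)
      (\<lambda>y. local_rep N c' \<omega> ([] @ map (\<lambda>V. V y) (map ?J us)) (?F y))"
  proof (rule smooth_on_subset_eval[where k=k and d="cdim c'"])
    show "?A \<inter> T \<subseteq> coords (cdim c)" using Ac by blast
    show "alternating k (cdim c') (\<lambda>us. local_rep N c' \<omega> us (?F y))" if "y \<in> ?A \<inter> T" for y
      using in_dom[OF that] by (intro alternating_local_rep[OF N \<omega> c'a]) auto
    show "smooth_on_subset (cdim c) (?A \<inter> T) (\<lambda>y. local_rep N c' \<omega> us (?F y))"
      if "length us = k" "set us \<subseteq> coords (cdim c')" for us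
    proof (rule smooth_on_subset_compose[OF smooth_formD(3)[OF \<omega> c'a that] Fs])
      show "?A \<inter> T \<subseteq> coords (cdim c)" using Ac by blast
      show "?F y \<in> cmap c' ` cdom c'" if "y \<in> ?A \<inter> T" for y using in_dom[OF that] by auto
    qed
  qed (use us Js coord_diff_coords in auto)
  then have "smooth_on_subset (cdim c) (?A \<inter> T) (local_rep M c (pullback_form M N k f \<omega>) us)"
  proof (rule smooth_on_subset_cong)
    fix y assume y: "y \<in> ?A \<inter> T"
    show "local_rep N c' \<omega> ([] @ map (\<lambda>V. V y) (map ?J us)) (?F y) = local_rep M c (pullback_form M N k f \<omega>) us y"
      using local_rep_pullback[OF M N f c in_dom(4)[OF y] in_dom(3)[OF y] us, of \<omega>] by (simp add: o_def)
  qed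
  moreover have "y0 \<in> T" using AT p0 charts_atD(2)[OF c'] y0 by (metis IntD2 IntI imageI vimageI)
  ultimately show "\<exists>U. openin (Euclidean_space (cdim c)) U \<and> y0 \<in> U \<and>
      smooth_on_subset (cdim c) (?A \<inter> U) (local_rep M c (pullback_form M N k f \<omega>) us)"
    using T(1) by blast
qed

lemma alternating_local_rep_pullback:
  assumes M: "corner_space M" and N: "corner_space N" and f: "smooth_map M N f"
    and \<omega>: "smooth_form N k \<omega>" and c: "c \<in> atlas M" and y: "y \<in> cmap c ` cdom c"
  shows "alternating k (cdim c) (\<lambda>us. local_rep M c (pullback_form M N k f \<omega>) us y)"
proof -
  note p = chart_inv_in[OF M c y]
  obtain c' where c': "c' \<in> charts_at N (f (chart_inv c y))"
    using chart_at_in[OF N smooth_map_points[OF f p(3)]] by blast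
  let ?J = "coord_diff c c' f (chart_inv c y)"
  let ?z = "cmap c' (f (chart_inv c y))"
  have z: "?z \<in> cmap c' ` cdom c'" using charts_atD(2)[OF c'] by auto
  interpret N: alternating k "cdim c'" "\<lambda>us. local_rep N c' \<omega> us ?z"
    by (rule alternating_local_rep[OF N \<omega> charts_atD(1)[OF c'] z])
  have J: "set (map ?J us) \<subseteq> coords (cdim c')" for us using coord_diff_coords by auto
  have e: "local_rep M c (pullback_form M N k f \<omega>) us y = local_rep N c' \<omega> (map ?J us) ?z"
    if "length us = k" "set us \<subseteq> coords (cdim c)" for us
    by (rule local_rep_pullback[OF M N f c y c' that])
  show ?thesis
  proof
    fix xs ys :: "(nat \<Rightarrow> real) list" and u w :: "nat \<Rightarrow> real" and a b :: real
    assume *: "Suc (length xs + length ys) = k" "set xs \<subseteq> coords (cdim c)" "set ys \<subseteq> coords (cdim c)"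
      "u \<in> coords (cdim c)" "w \<in> coords (cdim c)"
    moreover have "(\<lambda>j. a * u j + b * w j) \<in> coords (cdim c)" using * by (auto simp: coords_def)
    ultimately show "local_rep M c (pullback_form M N k f \<omega>) (xs @ (\<lambda>j. a * u j + b * w j) # ys) y
       = of_real a * local_rep M c (pullback_form M N k f \<omega>) (xs @ u # ys) y
         + of_real b * local_rep M c (pullback_form M N k f \<omega>) (xs @ w # ys) y"
      using N.linear[of "map ?J xs" "map ?J ys" "?J u" "?J w" a b] J[of xs] J[of ys]
        coord_diff_coords[of c c' f "chart_inv c y" u] coord_diff_coords[of c c' f "chart_inv c y" w]
      by (simp add: e coord_diff_linear)
  next
    fix xs ys zs :: "(nat \<Rightarrow> real) list" and u :: "nat \<Rightarrow> real"
    assume "Suc (Suc (length xs + length ys + length zs)) = k" "set xs \<subseteq> coords (cdim c)"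
      "set ys \<subseteq> coords (cdim c)" "set zs \<subseteq> coords (cdim c)" "u \<in> coords (cdim c)"
    then show "local_rep M c (pullback_form M N k f \<omega>) (xs @ u # ys @ u # zs) y = 0"
      using N.repeated[of "map ?J xs" "map ?J ys" "map ?J zs" "?J u"] J[of xs] J[of ys] J[of zs]
        coord_diff_coords[of c c' f "chart_inv c y" u]
      by (simp add: e)
  qed
qed

text \<open>At an interior point a local extension coincides with \<open>f\<close> on a
  neighbourhood, so the derivative in the sense of extensions is the ordinary one.\<close>

lemma partial_on_interior:
  assumes "smooth_on_subset d A f" "regular d A" "openin (Euclidean_space d) V" "V \<subseteq> A" "y \<in> V" "i < d"
    and "has_partial i f D y"
  shows "partial_on d A i f y = D"
proof -
  have yA: "y \<in> A" using assms by blast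
  obtain W g where W: "y \<in> W" "smooth_on_open d W g" "\<And>x. x \<in> A \<inter> W \<Longrightarrow> f x = g x"
    by (rule smooth_on_subsetE[OF assms(1) yA]) (rule that)
  have "openin (Euclidean_space d) (V \<inter> W)" using assms(3) smooth_on_open_openin[OF W(2)] by blast
  then have "has_partial i g D y"
    using has_partial_cong[OF assms(7), of d "V \<inter> W" g] W assms by auto
  then show ?thesis
    using partial_on_eq[OF assms(2) yA assms(6) W(2,1) W(3)] has_partial_imp by metis
qed

text \<open>By regularity a boundary point is a limit of interior points, where \<open>f\<close>
  vanishes; continuity does the rest. It serves to discard boundary points before differentiating
  twice.\<close>

lemma zero_on_regular:
  fixes f :: "(nat \<Rightarrow> real) \<Rightarrow> 'v::real_normed_vector"
  assumes "continuous_on A f" "regular d A"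
    and z: "\<And>V y. openin (Euclidean_space d) V \<Longrightarrow> V \<subseteq> A \<Longrightarrow> y \<in> V \<Longrightarrow> f y = 0" and y: "y \<in> A"
  shows "f y = 0"
proof (rule ccontr)
  assume "f y \<noteq> 0"
  then have e: "norm (f y) > 0" by simp
  have Ac: "A \<subseteq> coords d" using assms(2) by (simp add: regular_def)
  obtain \<delta> where \<delta>: "\<delta> > 0" "\<And>x. x \<in> A \<Longrightarrow> x \<in> cube d y \<delta> \<Longrightarrow> dist (f x) (f y) < norm (f y)"
    by (rule continuous_on_cubeD[OF Ac assms(1) y e]) blast
  have "y \<in> cube d y \<delta>" using y Ac \<delta>(1) by (intro cube_center) auto
  then obtain V where V: "openin (Euclidean_space d) V" "V \<noteq> {}" "V \<subseteq> A \<inter> cube d y \<delta>"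
    using assms(2) y openin_cube unfolding regular_def by meson
  then obtain x where x: "x \<in> V" by blast
  then have "x \<in> A" "x \<in> cube d y \<delta>" using V(3) by auto
  then have "f x = 0" "dist (f x) (f y) < norm (f y)" using z[OF V(1) _ x] V(3) \<delta>(2) by blast+
  then show False by (simp add: dist_norm)
qed

lemma has_partial_interior:
  assumes "smooth_on_subset d A f" "regular d A" "openin (Euclidean_space d) V" "V \<subseteq> A" "y \<in> V" "i < d"
  shows "has_partial i f (partial_on d A i f y) y"
proof -
  have yA: "y \<in> A" using assms by blast
  obtain W g where W: "y \<in> W" "smooth_on_open d W g" "\<And>x. x \<in> A \<inter> W \<Longrightarrow> f x = g x"
    by (rule smooth_on_subsetE[OF assms(1) yA]) (rule that)
  have "openin (Euclidean_space d) (V \<inter> W)" using assms(3) smooth_on_open_openin[OF W(2)] by blast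
  then have "has_partial i f (partial i g y) y"
  proof (rule has_partial_cong[OF smooth_on_open_has_partial[OF W(2,1) assms(6)]])
    show "g x = f x" if "x \<in> V \<inter> W" for x using W(3)[of x] that assms(4) by auto
  qed (use W(1) assms(5,6) in auto)
  then show ?thesis
    using partial_on_eq[OF assms(2) yA assms(6) W(2,1) W(3)] by simp
qed

text \<open>Expresses \<open>ext_deriv\<close> on vectors with prescribed coordinates in the chart
  chosen by \<open>chart_at\<close>, so that closedness becomes a statement about coefficient
  functions.\<close>

lemma ext_deriv_chart_vectors:
  assumes N: "corner_space N" and q: "q \<in> points N" and len: "length vs = Suc k"
    and vs: "set vs \<subseteq> coords (cdim (chart_at N q))"
  shows "ext_deriv N k \<omega> q (map (chart_vector N (chart_at N q) q) vs)
    = (\<Sum>j\<le>k. (-1) ^ j * (\<Sum>i<cdim (chart_at N q). of_real ((vs ! j) i) *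
        partial_on (cdim (chart_at N q)) (cmap (chart_at N q) ` cdom (chart_at N q)) i
          (local_rep N (chart_at N q) \<omega> (omit_nth j vs)) (cmap (chart_at N q) q)))"
proof -
  let ?c = "chart_at N q"
  note c = chart_at_in[OF N q]
  have cv: "chart_vector N ?c q v ?c = v" if "v \<in> set vs" for v
    using chart_vector_coord[OF N c] vs that by blast
  have m: "map (\<lambda>v. v ?c) (omit_nth j (map (chart_vector N ?c q) vs)) = omit_nth j vs" for j
  proof -
    have "map (\<lambda>v. v ?c) (map (chart_vector N ?c q) vs) = vs"
      using cv by (simp add: map_idI)
    then show ?thesis by (simp add: map_omit_nth del: map_map)
  qed
  have "map (chart_vector N ?c q) vs \<in> tangent_lists N (Suc k) q"
    using len chart_vector_tangent[OF N c] by (auto simp: tangent_lists_def)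
  then show ?thesis
    using q len cv by (auto simp: ext_deriv_def Let_def m intro!: sum.cong)
qed

text \<open>At interior points the second derivatives of \<open>f\<close> cancel, since they are symmetric and \<open>\<omega>\<close> is
  alternating.  Boundary points follow by continuity.\<close>

lemma pullback_closed:
  assumes M: "corner_space M" and N: "corner_space N" and f: "smooth_map M N f"
    and \<omega>: "smooth_form N k \<omega>" and cl: "ext_deriv N k \<omega> = (\<lambda>p vs. 0)"
    and c: "c \<in> atlas M" and y: "y \<in> cmap c ` cdom c"
    and idx: "length idx = Suc k" "set idx \<subseteq> {..<cdim c}"
  shows "(\<Sum>j\<le>k. (-1) ^ j * partial_on (cdim c) (cmap c ` cdom c) (idx ! j)
     (local_rep M c (pullback_form M N k f \<omega>) (omit_nth j (map unit_vec idx))) y) = 0"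
proof -
  let ?A = "cmap c ` cdom c" and ?d = "cdim c"
  let ?\<eta> = "pullback_form M N k f \<omega>"
  note rA = corner_spaceD(2)[OF M c]
  have idxj: "idx ! j < ?d" if "j \<le> k" for j 
  proof -
    have "idx ! j \<in> set idx" using idx(1) that by (intro nth_mem) simp
    then show ?thesis using idx(2) by auto
  qed
  have om: "length (omit_nth j idx) = k" "set (omit_nth j idx) \<subseteq> {..<?d}" if "j \<le> k" for j
    using idx that set_omit_nth[of j idx] by (auto simp: length_omit_nth)
  have su: "set (map unit_vec idx') \<subseteq> coords ?d" if "set idx' \<subseteq> {..<?d}" for idx'
    using that unit_vec_coords by auto
  have s\<eta>: "smooth_on_subset ?d ?A (local_rep M c ?\<eta> (map unit_vec idx'))"
    if "length idx' = k" "set idx' \<subseteq> {..<?d}" for idx'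
    using that su by (intro smooth_on_subset_local_rep_pullback[OF M N f \<omega> c]) auto
  show ?thesis
  proof (rule zero_on_regular[OF _ rA _ y])
    show "continuous_on ?A (\<lambda>y. \<Sum>j\<le>k. (-1) ^ j * partial_on ?d ?A (idx ! j)
        (local_rep M c ?\<eta> (omit_nth j (map unit_vec idx))) y)"
    proof (intro continuous_on_sum continuous_on_mult continuous_on_const)
      fix j assume "j \<in> {..k}"
      then have j: "j \<le> k" by simp
      have "smooth_on_subset ?d ?A (partial_on ?d ?A (idx ! j) (local_rep M c ?\<eta> (map unit_vec (omit_nth j idx))))"
        by (rule smooth_on_subset_partial_on[OF s\<eta>[OF om[OF j]] rA idxj[OF j]])
      then show "continuous_on ?A (partial_on ?d ?A (idx ! j) (local_rep M c ?\<eta> (omit_nth j (map unit_vec idx))))"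
        by (auto simp: map_omit_nth intro: smooth_on_subset_continuous)
    qed
  next
    fix V y0 assume V: "openin (Euclidean_space ?d) V" "V \<subseteq> ?A" "y0 \<in> V"
    then have y0: "y0 \<in> ?A" by blast
    note p0 = chart_inv_in[OF M c y0]
    define q0 where "q0 = f (chart_inv c y0)"
    have q0: "q0 \<in> points N" unfolding q0_def by (rule smooth_map_points[OF f p0(3)])
    \<comment> \<open>The chart at the image point has to be the one chosen by
      \<open>chart_at\<close>, because \<open>ext_deriv\<close> at \<open>q0\<close> is expressed in
      it.\<close>
    define c' where "c' = chart_at N q0"
    have c': "c' \<in> charts_at N q0" unfolding c'_def by (rule chart_at_in[OF N q0])
    note c'a = charts_atD(1)[OF c']
    let ?d' = "cdim c'" and ?A' = "cmap c' ` cdom c'"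
    have cf: "continuous_map (top_of M) (top_of N) f" using f by (simp add: smooth_map_def)
    obtain U where U: "openin (top_of M) U" "cdom c \<inter> f -` cdom c' = cdom c \<inter> U"
      by (rule smooth_map_open_vimage[OF M N cf c c'a]) (rule that)
    obtain T where T: "openin (Euclidean_space ?d) T" "cmap c ` (cdom c \<inter> U) = ?A \<inter> T"
      by (rule chart_region_open[OF M c U(1)]) (rule that)
    have AT: "?A \<inter> T = cmap c ` (cdom c \<inter> f -` cdom c')" using T(2) U(2) by simp
    let ?F = "\<lambda>y. cmap c' (f (chart_inv c y))"
    have in_dom: "c' \<in> charts_at N (f (chart_inv c y))" "?F y \<in> ?A'" "y \<in> ?A" if y: "y \<in> ?A \<inter> T" for y
    proof -
      obtain x where x: "x \<in> cdom c" "f x \<in> cdom c'" "y = cmap c x" using y AT by auto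
      then have "chart_inv c y = x" using chart_inv_cmap[OF M c] by simp
      then show "c' \<in> charts_at N (f (chart_inv c y))" "?F y \<in> ?A'"
        using x c'a by (auto simp: charts_at_def)
      show "y \<in> ?A" using y by simp
    qed
    have y0T: "y0 \<in> ?A \<inter> T"
    proof -
      have "chart_inv c y0 \<in> cdom c \<inter> f -` cdom c'" using p0(1) charts_atD(2)[OF c'] by (simp add: q0_def)
      then show ?thesis unfolding AT using p0(4) by force
    qed
    have rAT: "regular ?d (?A \<inter> T)" by (rule regular_Int_open[OF rA T(1)])
    have Ac: "?A \<inter> T \<subseteq> coords ?d" using rAT by (simp add: regular_def)
    have Fs: "smooth_on_subset ?d (?A \<inter> T) (\<lambda>y. ?F y l)" if "l < ?d'" for l
      unfolding AT by (rule smooth_mapD[OF f c c'a that])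
    have Fc: "?F y \<in> coords ?d'" if "y \<in> ?A \<inter> T" for y
      using in_dom(2)[OF that] cmap_coords[OF N c'a] by auto
    obtain W H where W: "y0 \<in> W" "openin (Euclidean_space ?d) W" "\<And>j. j < ?d' \<Longrightarrow> smooth_on_open ?d W (\<lambda>x. H x j)"
      "\<And>x. H x \<in> coords ?d'" "\<And>x. x \<in> (?A \<inter> T) \<inter> W \<Longrightarrow> ?F x = H x"
      by (rule smooth_on_subset_extend_map[OF Fs Ac Fc y0T]) (assumption | rule that)+
    \<comment> \<open>On this open set the coordinates of \<open>f\<close> equal the smooth map
      \<open>H\<close>, so the columns of the Jacobian are ordinary partial derivatives of
      \<open>H\<close> and can be differentiated once more.\<close>
    define V2 where "V2 = V \<inter> T \<inter> W"
    have V2: "openin (Euclidean_space ?d) V2" "V2 \<subseteq> ?A \<inter> T" "y0 \<in> V2" "V2 \<subseteq> W"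
      using V T(1) W(1,2) y0T by (auto simp: V2_def)
    define Vec where "Vec a y = (\<lambda>l. if l < ?d' then partial a (\<lambda>x. H x l) y else 0)" for a y
    define Hess where "Hess i a = (\<lambda>l. if l < ?d' then partial i (partial a (\<lambda>x. H x l)) y0 else 0)" for i a
    have Vc: "Vec a y \<in> coords ?d'" and Hc: "Hess i a \<in> coords ?d'" for a y i
      by (auto simp: Vec_def Hess_def coords_def)
    have pF: "partial_on ?d (?A \<inter> T) a (\<lambda>y. ?F y l) y = partial a (\<lambda>x. H x l) y"
      if "a < ?d" "l < ?d'" "y \<in> V2" for a l y
      using that V2 W by (intro partial_on_eq[OF rAT _ that(1) W(3)]) auto
    have J: "coord_diff c c' f (chart_inv c y) (unit_vec a) = Vec a y" if "a < ?d" "y \<in> V2" for a y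
    proof -
      have "cmap c (chart_inv c y) = y" using that V2(2) by (intro chart_inv_in(4)[OF M c in_dom(3)]) auto
      then show ?thesis
        unfolding coord_diff_unit[OF that(1)] Vec_def AT[symmetric] by (intro ext) (simp add: pF that)
    qed
    have rep: "local_rep M c ?\<eta> (map unit_vec idx') y = local_rep N c' \<omega> (map (\<lambda>a. Vec a y) idx') (?F y)"
      if "y \<in> V2" "length idx' = k" "set idx' \<subseteq> {..<?d}" for y idx'
    proof -
      have y': "y \<in> ?A \<inter> T" using that V2 by blast
      have "map (coord_diff c c' f (chart_inv c y)) (map unit_vec idx') = map (\<lambda>a. Vec a y) idx'"
        using that J by auto
      then show ?thesis
        using local_rep_pullback[OF M N f c in_dom(3)[OF y'] in_dom(1)[OF y'], of "map unit_vec idx'" k \<omega>]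
          that(2) su[OF that(3)] by (simp del: map_map set_map)
    qed
    \<comment> \<open>The derivative at \<open>y0\<close> in direction \<open>i\<close> of the
      coefficient of \<omega> along \<open>f\<close>, with the entries \<open>us\<close> held
      constant.\<close>
    define \<psi> where "\<psi> i us = (\<Sum>l<?d'. Vec i y0 l *\<^sub>R partial_on ?d' ?A' l (local_rep N c' \<omega> us) (?F y0))" for i us
    interpret \<omega>0: alternating k ?d' "\<lambda>us. local_rep N c' \<omega> us (?F y0)"
      by (rule alternating_local_rep[OF N \<omega> c'a in_dom(2)[OF y0T]])
    have der: "partial_on ?d ?A i (local_rep M c ?\<eta> (map unit_vec idx')) y0
        = \<psi> i (map (\<lambda>a. Vec a y0) idx')
          + (\<Sum>a<k. local_rep N c' \<omega> ((map (\<lambda>a. Vec a y0) idx')[a := Hess i (idx' ! a)]) (?F y0))"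
      if i: "i < ?d" and idx': "length idx' = k" "set idx' \<subseteq> {..<?d}" for i idx'
    proof -
      let ?Vs = "map (\<lambda>a. (\<lambda>t. Vec a (y0(i := t)), Hess i a)) idx'"
      have ev: "\<forall>\<^sub>F t in nhds (y0 i). y0(i := t) \<in> V2" by (rule line_in_open[OF V2(1,3) i])
      have "((\<lambda>t. local_rep N c' \<omega> ([] @ map (\<lambda>V. fst V t) ?Vs) (?F (y0(i := t)))) has_vector_derivative
         \<psi> i ([] @ map (\<lambda>V. fst V (y0 i)) ?Vs) + (\<Sum>a<length ?Vs. local_rep N c' \<omega>
           ([] @ (map (\<lambda>V. fst V (y0 i)) ?Vs)[a := snd (?Vs ! a)]) (?F (y0(i := y0 i))))) (at (y0 i))"
      proof (rule has_vector_derivative_eval[where k=k and d="?d'"])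
        show "\<forall>\<^sub>F t in nhds (y0 i). alternating k ?d' (\<lambda>us. local_rep N c' \<omega> us (?F (y0(i := t))))"
          using ev by (rule eventually_mono) (use V2(2) in \<open>blast intro: alternating_local_rep[OF N \<omega> c'a] in_dom(2)\<close>)
        fix us assume us: "length us = k" "set us \<subseteq> coords ?d'"
        note s\<omega> = smooth_formD(3)[OF \<omega> c'a us]
        have sc: "smooth_on_subset ?d (?A \<inter> T) (\<lambda>y. local_rep N c' \<omega> us (?F y))"
          by (rule smooth_on_subset_compose[OF s\<omega> Fs Ac in_dom(2)])
        have "partial_on ?d (?A \<inter> T) i (\<lambda>y. local_rep N c' \<omega> us (?F y)) y0
            = (\<Sum>l<?d'. partial_on ?d (?A \<inter> T) i (\<lambda>y. ?F y l) y0 *\<^sub>R partial_on ?d' ?A' l (local_rep N c' \<omega> us) (?F y0))"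
          by (rule partial_on_compose[OF s\<omega> Fs Ac in_dom(2) rAT corner_spaceD(2)[OF N c'a] y0T i])
        also have "\<dots> = \<psi> i us"
          unfolding \<psi>_def by (intro sum.cong refl) (simp add: Vec_def pF i V2(3))
        finally show "((\<lambda>t. local_rep N c' \<omega> us (?F (y0(i := t)))) has_vector_derivative \<psi> i us) (at (y0 i))"
          using has_partial_interior[OF sc rAT V2(1,2,3) i] by (simp add: has_partial_def)
      next
        fix V l assume "V \<in> set ?Vs" and l: "l < ?d'"
        then obtain a where a: "a \<in> set idx'" "V = (\<lambda>t. Vec a (y0(i := t)), Hess i a)" by auto
        have "a < ?d" using a idx' by auto
        have "has_partial i (partial a (\<lambda>x. H x l)) (partial i (partial a (\<lambda>x. H x l)) y0) y0"
          by (rule smooth_on_open_has_partial[OF smooth_on_open_partial[OF W(3)[OF l] \<open>a < ?d\<close>] W(1) i])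
        then show "((\<lambda>t. fst V t l) has_real_derivative snd V l) (at (y0 i))"
          using l a by (simp add: has_partial_def Vec_def Hess_def has_real_derivative_iff_has_vector_derivative)
      qed (use idx' Vc Hc in auto)
      then have "((\<lambda>t. local_rep N c' \<omega> (map (\<lambda>a. Vec a (y0(i := t))) idx') (?F (y0(i := t)))) has_vector_derivative
         \<psi> i (map (\<lambda>a. Vec a y0) idx') + (\<Sum>a<k. local_rep N c' \<omega> ((map (\<lambda>a. Vec a y0) idx')[a := Hess i (idx' ! a)]) (?F y0))) (at (y0 i))"
        using idx' by (simp add: o_def)
      then have "has_partial i (\<lambda>y. local_rep N c' \<omega> (map (\<lambda>a. Vec a y) idx') (?F y))
        (\<psi> i (map (\<lambda>a. Vec a y0) idx') + (\<Sum>a<k. local_rep N c' \<omega> ((map (\<lambda>a. Vec a y0) idx')[a := Hess i (idx' ! a)]) (?F y0))) y0"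
        by (simp add: has_partial_def)
      then have "has_partial i (local_rep M c ?\<eta> (map unit_vec idx'))
        (\<psi> i (map (\<lambda>a. Vec a y0) idx') + (\<Sum>a<k. local_rep N c' \<omega> ((map (\<lambda>a. Vec a y0) idx')[a := Hess i (idx' ! a)]) (?F y0))) y0"
        by (rule has_partial_cong[OF _ V2(1,3) i]) (simp add: rep idx')
      then show ?thesis
        using V2 by (intro partial_on_interior[OF s\<eta>[OF idx'] rA V2(1) _ V2(3) i]) auto
    qed
    let ?X = "map (\<lambda>a. Vec a y0) idx"
    let ?h = "\<lambda>j b. Hess (if j \<le> k then idx ! j else 0) (if b \<le> k then idx ! b else 0)"
    have sym: "?h j b = ?h b j" if "j \<le> k" "b \<le> k" for j b
      using that idxj partial_commute[OF W(3) W(1)] by (auto simp: Hess_def)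
    have hess: "(\<Sum>j\<le>k. (-1) ^ j * (\<Sum>a<k. local_rep N c' \<omega>
        ((omit_nth j ?X)[a := ?h j (if a < j then a else Suc a)]) (?F y0))) = 0"
      using idx Vc Hc sym by (intro \<omega>0.hessian_cancel) auto
    \<comment> \<open>The terms that differentiate only the coefficients of \<omega> add up to the
      exterior derivative of \<omega> at \<open>q0\<close> on the Jacobian columns, which is
      \<open>0\<close> by hypothesis.\<close>
    have first: "(\<Sum>j\<le>k. (-1) ^ j * \<psi> (idx ! j) (omit_nth j ?X)) = 0"
    proof -
      have X: "length ?X = Suc k" "set ?X \<subseteq> coords (cdim (chart_at N q0))"
        using idx Vc by (auto simp: c'_def[symmetric])
      have "(\<Sum>j\<le>k. (-1) ^ j * \<psi> (idx ! j) (omit_nth j ?X))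
          = ext_deriv N k \<omega> q0 (map (chart_vector N c' q0) ?X)"
        unfolding ext_deriv_chart_vectors[OF N q0 X, of \<omega>, folded c'_def]
        using idx by (intro sum.cong refl) (simp add: \<psi>_def q0_def[symmetric] scaleR_conv_of_real)
      then show ?thesis by (simp add: cl)
    qed
    have "(\<Sum>j\<le>k. (-1) ^ j * partial_on ?d ?A (idx ! j) (local_rep M c ?\<eta> (omit_nth j (map unit_vec idx))) y0)
       = (\<Sum>j\<le>k. (-1) ^ j * \<psi> (idx ! j) (omit_nth j ?X) + (-1) ^ j * (\<Sum>a<k. local_rep N c' \<omega>
        ((omit_nth j ?X)[a := ?h j (if a < j then a else Suc a)]) (?F y0)))"
    proof (rule sum.cong[OF refl])
      fix j assume "j \<in> {..k}"
      then have j: "j \<le> k" by simp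
      have "omit_nth j idx ! a = idx ! (if a < j then a else Suc a)" if "a < k" for a
        using j idx that by (intro nth_omit_nth) auto
      then show "(-1) ^ j * partial_on ?d ?A (idx ! j) (local_rep M c ?\<eta> (omit_nth j (map unit_vec idx))) y0
         = (-1) ^ j * \<psi> (idx ! j) (omit_nth j ?X) + (-1) ^ j * (\<Sum>a<k. local_rep N c' \<omega>
        ((omit_nth j ?X)[a := ?h j (if a < j then a else Suc a)]) (?F y0))"
        using der[OF idxj[OF j] om[OF j]] j
        by (auto simp: map_omit_nth[symmetric] distrib_left intro!: sum.cong)
    qed
    also have "\<dots> = 0" using hess first by (simp add: sum.distrib)
    finally show "(\<Sum>j\<le>k. (-1) ^ j * partial_on ?d ?A (idx ! j) (local_rep M c ?\<eta> (omit_nth j (map unit_vec idx))) y0) = 0" .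
  qed
qed

section \<open>Stokes' theorem on the standard simplex\<close>

definition insert_coord :: "nat \<Rightarrow> real \<Rightarrow> (nat \<Rightarrow> real) \<Rightarrow> nat \<Rightarrow> real" where
  "insert_coord j s y = (\<lambda>i. if i < j then y i else if i = j then s else y (i - 1))"

text \<open>Points of the product measure space are extensional and take the value
  \<open>undefined\<close> from \<open>k\<close> on; \<open>pad\<close> replaces it by
  \<open>0\<close>, as membership in \<open>coords k\<close> requires.\<close>

definition pad :: "nat \<Rightarrow> (nat \<Rightarrow> real) \<Rightarrow> nat \<Rightarrow> real" where
  "pad k x = (\<lambda>i. if i < k then x i else 0)"

definition space_integral :: "nat \<Rightarrow> ((nat \<Rightarrow> real) \<Rightarrow> complex) \<Rightarrow> complex" where
  "space_integral k f = (\<integral>x. f (pad k x) \<partial>(Pi\<^sub>M {..<k} (\<lambda>_. lborel)))"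

definition on_simplex :: "nat \<Rightarrow> ((nat \<Rightarrow> real) \<Rightarrow> complex) \<Rightarrow> (nat \<Rightarrow> real) \<Rightarrow> complex" where
  "on_simplex k f y = (if y \<in> coord_simplex k k then f y else 0)"

lemma integral_simplex_eq:
  "integral_simplex k \<eta> = space_integral k (on_simplex k
     (local_rep (simplex_space k) (simplex_chart k) \<eta> (map unit_vec [0..<k])))"
  unfolding integral_simplex_def space_integral_def on_simplex_def simplex_chart_image pad_def
    unit_vec_def[abs_def] Let_def ..

interpretation lborel_product: product_sigma_finite "\<lambda>_::nat. lborel :: real measure"
  by standard

section \<open>Fubini's theorem with a chosen inner coordinate\<close>

lemma insert_coord_measurable:
  assumes "j \<le> k"
  shows "(\<lambda>(s, x). restrict (insert_coord j s x) {..<Suc k}) \<in>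
     lborel \<Otimes>\<^sub>M Pi\<^sub>M {..<k} (\<lambda>_. lborel) \<rightarrow>\<^sub>M Pi\<^sub>M {..<Suc k} (\<lambda>_. lborel :: real measure)"
    (is "?f \<in> ?P \<rightarrow>\<^sub>M ?Q")
  unfolding split_beta'
proof (rule measurable_restrict)
  fix i assume i: "i \<in> {..<Suc k}"
  consider "i < j" | "i = j" | "j < i" by linarith
  then show "(\<lambda>w. insert_coord j (fst w) (snd w) i) \<in> ?P \<rightarrow>\<^sub>M lborel"
  proof cases
    case 1
    then have "(\<lambda>w. snd w i) \<in> ?P \<rightarrow>\<^sub>M lborel"
      using assms by (intro measurable_compose[OF measurable_snd measurable_component_singleton]) auto
    then show ?thesis using 1 by (simp add: insert_coord_def)
  next
    case 2
    then show ?thesis by (simp add: insert_coord_def)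
  next
    case 3
    then have "(\<lambda>w. snd w (i - 1)) \<in> ?P \<rightarrow>\<^sub>M lborel"
      using i by (intro measurable_compose[OF measurable_snd measurable_component_singleton]) auto
    then show ?thesis using 3 by (simp add: insert_coord_def)
  qed
qed

text \<open>Insertion of a coordinate at position \<open>j\<close> preserves measure: the preimage
  of a box is a box with the same side lengths, and boxes determine the product measure. This allows
  any coordinate to be integrated first.\<close>

lemma distr_insert_coord:
  assumes "j \<le> k"
  shows "distr (lborel \<Otimes>\<^sub>M Pi\<^sub>M {..<k} (\<lambda>_. lborel)) (Pi\<^sub>M {..<Suc k} (\<lambda>_. lborel))
     (\<lambda>(s, x). restrict (insert_coord j s x) {..<Suc k}) = Pi\<^sub>M {..<Suc k} (\<lambda>_. lborel :: real measure)"
    (is "distr ?P ?Q ?f = ?Q")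
proof (rule lborel_product.PiM_eqI)
  show "finite {..<Suc k}" "sets (distr ?P ?Q ?f) = sets ?Q" by simp_all
  interpret fin: finite_product_sigma_finite "\<lambda>_::nat. lborel :: real measure" "{..<k}"
    by standard simp
  note f = insert_coord_measurable[OF assms]
  let ?g = "\<lambda>i. if i < j then i else Suc i"
  fix A :: "nat \<Rightarrow> real set" assume A: "\<And>i. i \<in> {..<Suc k} \<Longrightarrow> A i \<in> sets lborel"
  have pre: "?f -` (Pi\<^sub>E {..<Suc k} A) \<inter> space ?P = A j \<times> Pi\<^sub>E {..<k} (\<lambda>i. A (?g i))"
  proof (intro equalityI subsetI)
    fix w assume w: "w \<in> ?f -` (Pi\<^sub>E {..<Suc k} A) \<inter> space ?P"
    obtain s x where sx: "w = (s, x)" by (cases w)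
    have x: "x \<in> extensional {..<k}" using w sx by (auto simp: space_pair_measure space_PiM PiE_def)
    have m: "insert_coord j s x i \<in> A i" if "i \<le> k" for i
      using w that unfolding sx by (auto simp: PiE_iff restrict_def dest!: bspec[of _ _ i])
    have "s \<in> A j" using m[of j] assms by (simp add: insert_coord_def)
    moreover have "x i \<in> A (?g i)" if "i < k" for i
      using m[of "?g i"] that by (cases "i < j") (auto simp: insert_coord_def)
    ultimately show "w \<in> A j \<times> Pi\<^sub>E {..<k} (\<lambda>i. A (?g i))"
      using x by (auto simp: sx PiE_iff)
  next
    fix w assume w: "w \<in> A j \<times> Pi\<^sub>E {..<k} (\<lambda>i. A (?g i))"
    obtain s x where sx: "w = (s, x)" by (cases w)
    have s: "s \<in> A j" and x: "\<And>i. i < k \<Longrightarrow> x i \<in> A (?g i)" "x \<in> extensional {..<k}"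
      using w by (auto simp: sx PiE_iff)
    have "insert_coord j s x i \<in> A i" if "i < Suc k" for i
      using s x(1)[of i] x(1)[of "i - 1"] that assms
      by (cases i j rule: linorder_cases; cases i) (auto simp: insert_coord_def)
    then show "w \<in> ?f -` (Pi\<^sub>E {..<Suc k} A) \<inter> space ?P"
      using x(2) by (auto simp: sx space_pair_measure space_PiM PiE_iff)
  qed
  have bij: "bij_betw ?g {..<k} ({..<Suc k} - {j})"
  proof (rule bij_betw_byWitness[where f'="\<lambda>b. if b < j then b else b - 1"])
  qed (use assms in auto)
  have As: "(\<Pi>\<^sub>E i\<in>{..<k}. A (?g i)) \<in> sets (Pi\<^sub>M {..<k} (\<lambda>_. lborel))"
    using A by (intro sets_PiM_I_finite) auto
  have "emeasure (distr ?P ?Q ?f) (Pi\<^sub>E {..<Suc k} A) = emeasure ?P (A j \<times> Pi\<^sub>E {..<k} (\<lambda>i. A (?g i)))"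
    using A by (subst emeasure_distr[OF f]) (auto simp: pre intro!: sets_PiM_I_finite)
  also have "\<dots> = emeasure lborel (A j) * emeasure (Pi\<^sub>M {..<k} (\<lambda>_. lborel)) (Pi\<^sub>E {..<k} (\<lambda>i. A (?g i)))"
    using A[of j] assms As by (intro fin.emeasure_pair_measure_Times) auto
  also have "\<dots> = emeasure lborel (A j) * (\<Prod>i<k. emeasure lborel (A (?g i)))"
    using A by (subst lborel_product.emeasure_PiM) auto
  also have "(\<Prod>i<k. emeasure lborel (A (?g i))) = (\<Prod>i\<in>{..<Suc k} - {j}. emeasure lborel (A i))"
    by (rule prod.reindex_bij_betw[OF bij])
  also have "emeasure lborel (A j) * \<dots> = (\<Prod>i<Suc k. emeasure lborel (A i))"
    using assms by (subst prod.remove[of "{..<Suc k}" j]) auto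
  finally show "emeasure (distr ?P ?Q ?f) (Pi\<^sub>E {..<Suc k} A) = (\<Prod>i<Suc k. emeasure lborel (A i))" .
qed

lemma pad_measurable: "pad k \<in> Pi\<^sub>M {..<k} (\<lambda>_. lborel) \<rightarrow>\<^sub>M borel"
proof (rule measurable_coordinatewise_then_product)
  fix i show "(\<lambda>x. pad k x i) \<in> Pi\<^sub>M {..<k} (\<lambda>_. lborel) \<rightarrow>\<^sub>M borel"
  proof (cases "i < k")
    case True
    then have "(\<lambda>x. x i) \<in> Pi\<^sub>M {..<k} (\<lambda>_. lborel :: real measure) \<rightarrow>\<^sub>M lborel"
      by (intro measurable_component_singleton) auto
    then show ?thesis using True by (simp add: pad_def)
  qed (simp add: pad_def)
qed

lemma pad_coords: "pad k x \<in> coords k"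
  by (auto simp: pad_def coords_def)

lemma space_integral_fubini:
  assumes j: "j \<le> k" and f: "f \<in> borel_measurable borel"
    and i: "integrable (Pi\<^sub>M {..<Suc k} (\<lambda>_. lborel)) (\<lambda>x. f (pad (Suc k) x))"
  shows "space_integral (Suc k) f = space_integral k (\<lambda>y. \<integral>s. f (insert_coord j s y) \<partial>lborel)"
proof -
  let ?P = "lborel \<Otimes>\<^sub>M Pi\<^sub>M {..<k} (\<lambda>_. lborel :: real measure)" and ?Q = "Pi\<^sub>M {..<Suc k} (\<lambda>_. lborel :: real measure)"
  let ?f = "\<lambda>(s, x). restrict (insert_coord j s x) {..<Suc k}"
  interpret fin: finite_product_sigma_finite "\<lambda>_::nat. lborel :: real measure" "{..<k}"
    by standard simp
  interpret pair: pair_sigma_finite "lborel :: real measure" "Pi\<^sub>M {..<k} (\<lambda>_. lborel :: real measure)"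
    by standard
  note fm = insert_coord_measurable[OF j]
  have gm: "(\<lambda>x. f (pad (Suc k) x)) \<in> borel_measurable ?Q"
    by (rule measurable_compose[OF pad_measurable f])
  have p: "pad (Suc k) (restrict (insert_coord j s x) {..<Suc k}) = insert_coord j s (pad k x)" for s x
    by (rule ext) (use j in \<open>auto simp: pad_def insert_coord_def restrict_def\<close>)
  have "integrable (distr ?P ?Q ?f) (\<lambda>x. f (pad (Suc k) x))" using i by (simp add: distr_insert_coord[OF j])
  then have int: "integrable ?P (\<lambda>(s, x). f (insert_coord j s (pad k x)))"
    by (subst (asm) integrable_distr_eq[OF fm gm]) (simp add: p split_beta' del: restrict_apply)
  have "space_integral (Suc k) f = (\<integral>x. f (pad (Suc k) x) \<partial>distr ?P ?Q ?f)"
    by (simp add: space_integral_def distr_insert_coord[OF j])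
  also have "\<dots> = (\<integral>w. f (pad (Suc k) (?f w)) \<partial>?P)"
    by (rule integral_distr[OF fm gm])
  also have "\<dots> = (\<integral>(s, x). f (insert_coord j s (pad k x)) \<partial>?P)"
    by (intro Bochner_Integration.integral_cong refl) (use p in \<open>auto simp del: restrict_apply\<close>)
  also have "\<dots> = (\<integral>x. (\<integral>s. f (insert_coord j s (pad k x)) \<partial>lborel) \<partial>Pi\<^sub>M {..<k} (\<lambda>_. lborel))"
    by (rule pair.integral_snd[OF int, symmetric])
  finally show ?thesis by (simp add: space_integral_def)
qed

section \<open>Integrals of continuous functions over the simplex\<close>

lemma compact_coord_simplex: "compact (coord_simplex k k)"
proof -
  have "compact (standard_simplex k :: (nat \<Rightarrow> real) set)"
    using compactin_standard_simplex[of k] by (simp add: euclidean_product_topology compactin_euclidean_iff)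
  moreover have "continuous_on (standard_simplex k) (cmap (simplex_chart k))"
  proof (rule continuous_on_coordinatewise_then_product)
    have c: "continuous_on (standard_simplex k) (\<lambda>y::nat \<Rightarrow> real. y j)" for j
      by (rule continuous_on_subset[OF continuous_on_product_coordinates]) auto
    show "continuous_on (standard_simplex k) (\<lambda>x. cmap (simplex_chart k) x i)" for i
      using c by (cases "i < k") auto
  qed
  ultimately show ?thesis unfolding simplex_chart_image[symmetric] by (rule compact_continuous_image[rotated])
qed

lemma on_simplex_measurable:
  assumes "continuous_on (coord_simplex k k) f"
  shows "on_simplex k f \<in> borel_measurable borel"
proof -
  have "coord_simplex k k \<in> sets borel"
    using compact_coord_simplex by (simp add: borel_closed compact_imp_closed)
  then have "(\<lambda>x. indicator (coord_simplex k k) x *\<^sub>R f x) \<in> borel_measurable borel"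
    using assms by (rule borel_measurable_continuous_on_indicator)
  moreover have "on_simplex k f = (\<lambda>x. indicator (coord_simplex k k) x *\<^sub>R f x)"
    by (auto simp: on_simplex_def)
  ultimately show ?thesis by simp
qed

lemma coord_simplex_le_1: "y \<in> coord_simplex k d \<Longrightarrow> i < k \<Longrightarrow> y i \<le> 1"
  using member_le_sum[of i "{..<k}" y] by (auto simp: coord_simplex_def)

text \<open>The function is bounded, as \<open>f\<close> is continuous on a compact set, and
  vanishes outside the unit cube, which has measure \<open>1\<close>.\<close>

lemma on_simplex_integrable:
  assumes "continuous_on (coord_simplex k k) f"
  shows "integrable (Pi\<^sub>M {..<k} (\<lambda>_. lborel)) (\<lambda>x. on_simplex k f (pad k x))"
proof -
  have "compact (f ` coord_simplex k k)" using assms compact_coord_simplex by (rule compact_continuous_image)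
  then obtain B where B: "\<forall>y\<in>coord_simplex k k. norm (f y) \<le> B"
    using compact_imp_bounded[of "f ` coord_simplex k k"] by (auto simp: bounded_iff)
  let ?C = "Pi\<^sub>E {..<k} (\<lambda>_. {0..1}) :: (nat \<Rightarrow> real) set"
  have C: "?C \<in> sets (Pi\<^sub>M {..<k} (\<lambda>_. lborel))" by (intro sets_PiM_I_finite) auto
  have eC: "emeasure (Pi\<^sub>M {..<k} (\<lambda>_. lborel)) ?C = 1" by (subst lborel_product.emeasure_PiM) auto
  show ?thesis
  proof (rule integrableI_bounded_set[OF C])
    show "(\<lambda>x. on_simplex k f (pad k x)) \<in> borel_measurable (Pi\<^sub>M {..<k} (\<lambda>_. lborel))"
      by (rule measurable_compose[OF pad_measurable on_simplex_measurable[OF assms]])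
    show "emeasure (Pi\<^sub>M {..<k} (\<lambda>_. lborel)) ?C < \<infinity>" by (simp add: eC)
    show "AE x in Pi\<^sub>M {..<k} (\<lambda>_. lborel). x \<in> ?C \<longrightarrow> norm (on_simplex k f (pad k x)) \<le> max B 0"
      using B by (auto simp: on_simplex_def le_max_iff_disj)
    have "x \<in> ?C" if "x \<in> space (Pi\<^sub>M {..<k} (\<lambda>_. lborel))" "on_simplex k f (pad k x) \<noteq> 0" for x
    proof -
      have "pad k x \<in> coord_simplex k k" using that(2) by (auto simp: on_simplex_def split: if_splits)
      then have "0 \<le> x i \<and> x i \<le> 1" if "i < k" for i
        using coord_simplex_le_1[of "pad k x" k k i] that by (auto simp: coord_simplex_def pad_def)
      then show ?thesis using that(1) by (auto simp: space_PiM PiE_iff)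
    qed
    then show "AE x in Pi\<^sub>M {..<k} (\<lambda>_. lborel). x \<notin> ?C \<longrightarrow> on_simplex k f (pad k x) = 0"
      by (intro AE_I2) auto
  qed
qed

lemma
  assumes "continuous_on (coord_simplex k k) f" "continuous_on (coord_simplex k k) g"
  shows space_integral_add: "space_integral k (on_simplex k (\<lambda>y. f y + g y))
      = space_integral k (on_simplex k f) + space_integral k (on_simplex k g)"
    and space_integral_diff: "space_integral k (on_simplex k (\<lambda>y. f y - g y))
      = space_integral k (on_simplex k f) - space_integral k (on_simplex k g)"
proof -
  have "on_simplex k (\<lambda>y. f y + g y) z = on_simplex k f z + on_simplex k g z"
    "on_simplex k (\<lambda>y. f y - g y) z = on_simplex k f z - on_simplex k g z" for z
    by (auto simp: on_simplex_def)
  then show "space_integral k (on_simplex k (\<lambda>y. f y + g y))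
      = space_integral k (on_simplex k f) + space_integral k (on_simplex k g)"
    "space_integral k (on_simplex k (\<lambda>y. f y - g y))
      = space_integral k (on_simplex k f) - space_integral k (on_simplex k g)"
    unfolding space_integral_def using assms[THEN on_simplex_integrable] by simp_all
qed

lemma space_integral_sum:
  assumes "\<And>i. i \<in> I \<Longrightarrow> continuous_on (coord_simplex k k) (f i)"
  shows "space_integral k (on_simplex k (\<lambda>y. \<Sum>i\<in>I. a i * f i y)) = (\<Sum>i\<in>I. a i * space_integral k (on_simplex k (f i)))"
proof -
  have "on_simplex k (\<lambda>y. \<Sum>i\<in>I. a i * f i y) z = (\<Sum>i\<in>I. a i * on_simplex k (f i) z)" for z
    by (auto simp: on_simplex_def)
  then show ?thesis
    unfolding space_integral_def using on_simplex_integrable[OF assms] by simp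
qed

section \<open>Integration along one coordinate direction of the simplex\<close>

lemma sum_insert_coord:
  assumes "j \<le> k" shows "(\<Sum>i<Suc k. insert_coord j s y i) = s + (\<Sum>i<k. y i)"
proof -
  let ?g = "\<lambda>i. if i < j then i else Suc i"
  have bij: "bij_betw ?g {..<k} ({..<Suc k} - {j})"
  proof (rule bij_betw_byWitness[where f'="\<lambda>b. if b < j then b else b - 1"])
  qed (use assms in auto)
  have "(\<Sum>i<Suc k. insert_coord j s y i) = insert_coord j s y j + (\<Sum>i\<in>{..<Suc k} - {j}. insert_coord j s y i)"
    using assms by (intro sum.remove) auto
  also have "(\<Sum>i\<in>{..<Suc k} - {j}. insert_coord j s y i) = (\<Sum>i<k. insert_coord j s y (?g i))"
    by (rule sum.reindex_bij_betw[OF bij, symmetric])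
  also have "\<dots> = (\<Sum>i<k. y i)" by (rule sum.cong) (auto simp: insert_coord_def)
  finally show ?thesis by (simp add: insert_coord_def)
qed

text \<open>The fibre of the simplex in direction \<open>j\<close> over a point \<open>y\<close> of
  the lower simplex is an interval; its ends lie on the face where coordinate \<open>j\<close>
  vanishes and on the slanted face where the coordinates sum to \<open>1\<close>.\<close>

lemma insert_coord_simplex:
  assumes "j \<le> k" "y \<in> coords k"
  shows "insert_coord j s y \<in> coord_simplex (Suc k) (Suc k) \<longleftrightarrow>
     y \<in> coord_simplex k k \<and> 0 \<le> s \<and> s \<le> 1 - (\<Sum>i<k. y i)"
proof
  assume L: "insert_coord j s y \<in> coord_simplex (Suc k) (Suc k)"
  have nn: "0 \<le> insert_coord j s y i" if "i < Suc k" for i using L that by (auto simp: coord_simplex_def)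
  have s: "0 \<le> s" using nn[of j] assms by (simp add: insert_coord_def)
  moreover have "0 \<le> y i" if "i < k" for i
    using nn[of i] nn[of "Suc i"] that by (cases "i < j") (auto simp: insert_coord_def)
  moreover have "s + (\<Sum>i<k. y i) \<le> 1" using L sum_insert_coord[OF assms(1), of s y] by (simp add: coord_simplex_def)
  ultimately show "y \<in> coord_simplex k k \<and> 0 \<le> s \<and> s \<le> 1 - (\<Sum>i<k. y i)"
    using assms by (auto simp: coord_simplex_def)
next
  assume R: "y \<in> coord_simplex k k \<and> 0 \<le> s \<and> s \<le> 1 - (\<Sum>i<k. y i)"
  have "insert_coord j s y \<in> coords (Suc k)" using assms by (auto simp: coords_def insert_coord_def)
  moreover have "0 \<le> insert_coord j s y i" if "i < Suc k" for i
    using R that assms by (auto simp: insert_coord_def coord_simplex_def)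
  moreover have "(\<Sum>i<Suc k. insert_coord j s y i) \<le> 1" 
    using R unfolding sum_insert_coord[OF assms(1)] by simp
  ultimately show "insert_coord j s y \<in> coord_simplex (Suc k) (Suc k)" by (auto simp: coord_simplex_def)
qed

abbreviation coord_sum :: "nat \<Rightarrow> (nat \<Rightarrow> real) \<Rightarrow> real" where
  "coord_sum k y \<equiv> \<Sum>i<k. y i"

lemma space_integral_cong:
  assumes "\<And>y. y \<in> coords k \<Longrightarrow> f y = g y" shows "space_integral k f = space_integral k g"
  unfolding space_integral_def by (intro Bochner_Integration.integral_cong refl assms pad_coords)

lemma continuous_on_coordinate: "continuous_on S (\<lambda>y::nat \<Rightarrow> real. y j)"
  by (rule continuous_on_subset[OF continuous_on_product_coordinates]) auto

lemma continuous_on_insert_coord: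
  assumes "continuous_on S s" shows "continuous_on S (\<lambda>y. insert_coord j (s y) y)"
proof (rule continuous_on_coordinatewise_then_product)
  show "continuous_on S (\<lambda>y. insert_coord j (s y) y i)" for i
    by (cases i j rule: linorder_cases) (auto simp: insert_coord_def assms continuous_on_coordinate)
qed

lemma continuous_on_coord_sum: "continuous_on S (coord_sum k)"
  by (intro continuous_on_sum continuous_on_coordinate)

lemma coord_simplexD: "y \<in> coord_simplex k k \<Longrightarrow> y \<in> coords k" "y \<in> coord_simplex k k \<Longrightarrow> coord_sum k y \<le> 1"
  by (auto simp: coord_simplex_def)

lemma continuous_on_face:
  assumes h: "continuous_on (coord_simplex (Suc k) (Suc k)) h" and j: "j \<le> k"
    and s: "continuous_on (coord_simplex k k) s"
      "\<And>y. y \<in> coord_simplex k k \<Longrightarrow> 0 \<le> s y \<and> s y \<le> 1 - coord_sum k y"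
  shows "continuous_on (coord_simplex k k) (\<lambda>y. h (insert_coord j (s y) y))"
  using h continuous_on_insert_coord[OF s(1)]
proof (rule continuous_on_compose2)
  show "(\<lambda>y. insert_coord j (s y) y) ` coord_simplex k k \<subseteq> coord_simplex (Suc k) (Suc k)"
    using insert_coord_simplex[OF j coord_simplexD(1)] s(2) by auto
qed

lemma on_simplex_insert_coord:
  assumes "j \<le> k" "y \<in> coords k"
  shows "on_simplex (Suc k) f (insert_coord j s y)
     = on_simplex k (\<lambda>y. indicator {0..1 - coord_sum k y} s *\<^sub>R f (insert_coord j s y)) y"
  using insert_coord_simplex[OF assms, of s] by (auto simp: on_simplex_def)

text \<open>Fubini with coordinate \<open>j\<close> innermost, followed by the fundamental theorem
  of calculus on each fibre, which leaves the difference of the values at its two ends.\<close>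

lemma space_integral_partial:
  assumes j: "j \<le> k" and h: "smooth_on_subset (Suc k) (coord_simplex (Suc k) (Suc k)) h"
  shows "space_integral (Suc k) (on_simplex (Suc k) (partial_on (Suc k) (coord_simplex (Suc k) (Suc k)) j h))
    = space_integral k (on_simplex k (\<lambda>y. h (insert_coord j (1 - coord_sum k y) y) - h (insert_coord j 0 y)))"
proof -
  let ?A = "coord_simplex (Suc k) (Suc k)"
  let ?D = "partial_on (Suc k) ?A j h"
  have r: "regular (Suc k) ?A" by (rule regular_coord_simplex) simp
  have cD: "continuous_on ?A ?D"
    using j by (intro smooth_on_subset_continuous[OF smooth_on_subset_partial_on[OF h r]]) simp
  have ftc: "(\<integral>s. indicator {0..1 - coord_sum k y} s *\<^sub>R ?D (insert_coord j s y) \<partial>lborel)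
      = h (insert_coord j (1 - coord_sum k y) y) - h (insert_coord j 0 y)" if y: "y \<in> coord_simplex k k" for y
  proof (rule integral_FTC_atLeastAtMost)
    let ?I = "{0..1 - coord_sum k y}"
    have inA: "insert_coord j s y \<in> ?A" if "s \<in> ?I" for s
      using insert_coord_simplex[OF j coord_simplexD(1)[OF y], of s] y that by auto
    show "0 \<le> 1 - coord_sum k y" using y coord_simplexD(2) by simp
    show "continuous_on ?I (\<lambda>s. ?D (insert_coord j s y))"
    proof (rule continuous_on_compose2[OF cD])
      show "continuous_on ?I (\<lambda>s. insert_coord j s y)"
      proof (rule continuous_on_coordinatewise_then_product)
        show "continuous_on ?I (\<lambda>s. insert_coord j s y i)" for i
          by (cases i j rule: linorder_cases) (auto simp: insert_coord_def)
      qed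
    qed (use inA in auto)
    fix s assume "0 \<le> s" "s \<le> 1 - coord_sum k y"
    then have s: "s \<in> ?I" by simp
    \<comment> \<open>At the ends of the fibre only the local extension \<open>g\<close> is known to
      be differentiable from both sides. Its derivative is restricted to the interval, where
      \<open>g\<close> equals \<open>h\<close>.\<close>
    obtain W g where W: "insert_coord j s y \<in> W" "smooth_on_open (Suc k) W g" "\<And>x. x \<in> ?A \<inter> W \<Longrightarrow> h x = g x"
      by (rule smooth_on_subsetE[OF h inA[OF s]]) (rule that)
    have e: "(insert_coord j s y)(j := t) = insert_coord j t y" for t by (auto simp: insert_coord_def)
    have "j < Suc k" using j by simp
    have D: "?D (insert_coord j s y) = partial j g (insert_coord j s y)"
      by (rule partial_on_eq[OF r inA[OF s] \<open>j < Suc k\<close> W(2,1,3)])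
    have "has_partial j g (partial j g (insert_coord j s y)) (insert_coord j s y)"
      by (rule smooth_on_open_has_partial[OF W(2,1) \<open>j < Suc k\<close>])
    then have "((\<lambda>t. g (insert_coord j t y)) has_vector_derivative ?D (insert_coord j s y)) (at s)"
      by (simp add: has_partial_def e D) (simp add: insert_coord_def)
    then have "((\<lambda>t. g (insert_coord j t y)) has_vector_derivative ?D (insert_coord j s y)) (at s within ?I)"
      by (rule has_vector_derivative_at_within)
    moreover have "\<forall>\<^sub>F t in at s within ?I. g (insert_coord j t y) = h (insert_coord j t y)"
    proof -
      have "\<forall>\<^sub>F t in nhds s. insert_coord j t y \<in> W"
        using line_in_open[OF smooth_on_open_openin[OF W(2)] W(1) \<open>j < Suc k\<close>] by (simp add: e) (simp add: insert_coord_def)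
      then show ?thesis unfolding eventually_at_filter
        by (rule eventually_mono) (use W(3) inA in auto)
    qed
    ultimately show "((\<lambda>t. h (insert_coord j t y)) has_vector_derivative ?D (insert_coord j s y)) (at s within ?I)"
      using W(3) inA[OF s] W(1) s unfolding has_vector_derivative_def
      by (elim has_derivative_transform_eventually) auto
  qed
  have "space_integral (Suc k) (on_simplex (Suc k) ?D)
      = space_integral k (\<lambda>y. \<integral>s. on_simplex (Suc k) ?D (insert_coord j s y) \<partial>lborel)"
    by (rule space_integral_fubini[OF j on_simplex_measurable[OF cD] on_simplex_integrable[OF cD]])
  also have "\<dots> = space_integral k (on_simplex k (\<lambda>y. h (insert_coord j (1 - coord_sum k y) y) - h (insert_coord j 0 y)))"
  proof (rule space_integral_cong)
    fix y assume y: "y \<in> coords k"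
    show "(\<integral>s. on_simplex (Suc k) ?D (insert_coord j s y) \<partial>lborel)
        = on_simplex k (\<lambda>y. h (insert_coord j (1 - coord_sum k y) y) - h (insert_coord j 0 y)) y"
      unfolding on_simplex_insert_coord[OF j y] using ftc by (auto simp: on_simplex_def)
  qed
  finally show ?thesis .
qed

text \<open>Omitting another coordinate on the face \<open>t\<^sub>0 = 0\<close> amounts to a reflection in one variable.\<close>

lemma space_integral_slanted_face:
  assumes h: "continuous_on (coord_simplex (Suc k) (Suc k)) h" and j: "j \<le> k"
  shows "space_integral k (on_simplex k (\<lambda>y. h (insert_coord j (1 - coord_sum k y) y)))
    = space_integral k (on_simplex k (\<lambda>y. h (insert_coord 0 (1 - coord_sum k y) y)))"
  using j
proof (induction j)
  case (Suc j)
  then obtain m where k: "k = Suc m" "j \<le> m" by (cases k) auto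
  let ?f = "\<lambda>i y. h (insert_coord i (1 - coord_sum k y) y)"
  have c: "continuous_on (coord_simplex k k) (?f i)" if "i \<le> k" for i
    using coord_simplexD(2) sum_nonneg
    by (intro continuous_on_face[OF h that] continuous_intros continuous_on_coord_sum) (auto simp: coord_simplex_def)
  have fub: "space_integral k (on_simplex k (?f i))
      = space_integral m (\<lambda>z. \<integral>s. on_simplex k (?f i) (insert_coord j s z) \<partial>lborel)" if "i \<le> k" for i
    unfolding k(1)
    by (rule space_integral_fubini[OF k(2)])
       (use on_simplex_measurable[OF c[OF that]] on_simplex_integrable[OF c[OF that]] in \<open>simp_all add: k(1)\<close>)
  have cs: "coord_sum (Suc m) (insert_coord j s z) = s + coord_sum m z" for s z
    by (rule sum_insert_coord[OF k(2)])
  have swap: "insert_coord (Suc j) s (insert_coord j t z) = insert_coord j t (insert_coord j s z)" for s t z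
    by (rule ext) (auto simp: insert_coord_def)
  have "space_integral k (on_simplex k (?f (Suc j)))
      = space_integral m (\<lambda>z. \<integral>s. on_simplex k (?f (Suc j)) (insert_coord j s z) \<partial>lborel)"
    by (rule fub[OF Suc.prems])
  also have "\<dots> = space_integral m (\<lambda>z. \<integral>s. on_simplex k (?f j) (insert_coord j s z) \<partial>lborel)"
  proof (rule space_integral_cong)
    fix z assume z: "z \<in> coords m"
    let ?c = "1 - coord_sum m z"
    \<comment> \<open>The reflection \<open>s \<mapsto> ?c - s\<close> exchanges the inserted
      coordinate with the remaining slack: in both integrands \<open>h\<close> is then evaluated at
      the point with \<open>s\<close> in place \<open>j\<close> and \<open>?c - s\<close> in place
      \<open>Suc j\<close>.\<close>
    have "(\<integral>s. on_simplex k (?f j) (insert_coord j s z) \<partial>lborel)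
        = (\<integral>s. on_simplex k (?f j) (insert_coord j (?c + (-1) * s) z) \<partial>lborel)"
      by (subst lborel_integral_real_affine[of "-1" _ ?c]) simp_all
    also have "\<dots> = (\<integral>s. on_simplex k (?f (Suc j)) (insert_coord j s z) \<partial>lborel)"
    proof (intro Bochner_Integration.integral_cong refl)
      fix s
      show "on_simplex k (?f j) (insert_coord j (?c + (-1) * s) z) = on_simplex k (?f (Suc j)) (insert_coord j s z)"
        unfolding k(1) on_simplex_insert_coord[OF k(2) z]
        by (auto simp: on_simplex_def cs swap algebra_simps indicator_def simp del: sum.lessThan_Suc)
    qed
    finally show "(\<integral>s. on_simplex k (?f (Suc j)) (insert_coord j s z) \<partial>lborel)
        = (\<integral>s. on_simplex k (?f j) (insert_coord j s z) \<partial>lborel)" by simp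
  qed
  also have "\<dots> = space_integral k (on_simplex k (?f j))"
    using fub[of j] Suc.prems by simp
  finally show ?case using Suc by simp
qed simp

text \<open>Here \<open>h j\<close> is the coefficient of a \<open>k\<close>-form with the
  differential of coordinate \<open>j\<close> omitted, and the second hypothesis says that the form
  is closed. Each summand is integrated in its own direction \<open>j\<close>, and the resulting
  slanted-face terms are all brought to the parametrisation that inserts coordinate
  \<open>0\<close>.\<close>

lemma stokes_coords:
  assumes h: "\<And>j. j \<le> k \<Longrightarrow> smooth_on_subset (Suc k) (coord_simplex (Suc k) (Suc k)) (h j)"
    and cl: "\<And>y. y \<in> coord_simplex (Suc k) (Suc k) \<Longrightarrow>
      (\<Sum>j\<le>k. (-1) ^ j * partial_on (Suc k) (coord_simplex (Suc k) (Suc k)) j (h j) y) = 0"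
  shows "space_integral k (on_simplex k (\<lambda>y. \<Sum>j\<le>k. (-1) ^ j * h j (insert_coord 0 (1 - coord_sum k y) y)))
    = (\<Sum>j\<le>k. (-1) ^ j * space_integral k (on_simplex k (\<lambda>y. h j (insert_coord j 0 y))))"
proof -
  let ?A = "coord_simplex (Suc k) (Suc k)"
  have r: "regular (Suc k) ?A" by (rule regular_coord_simplex) simp
  have c: "continuous_on ?A (h j)" if "j \<le> k" for j by (rule smooth_on_subset_continuous[OF h[OF that]])
  have cD: "continuous_on ?A (partial_on (Suc k) ?A j (h j))" if "j \<le> k" for j
    using that by (intro smooth_on_subset_continuous[OF smooth_on_subset_partial_on[OF h[OF that] r]]) simp
  have cf: "continuous_on (coord_simplex k k) (\<lambda>y. h j (insert_coord i (1 - coord_sum k y) y))"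
    "continuous_on (coord_simplex k k) (\<lambda>y. h j (insert_coord i 0 y))" if "j \<le> k" "i \<le> k" for i j
  proof -
    show "continuous_on (coord_simplex k k) (\<lambda>y. h j (insert_coord i (1 - coord_sum k y) y))"
      by (rule continuous_on_face[OF c[OF that(1)] that(2)])
         (auto intro!: continuous_on_diff continuous_on_const continuous_on_coord_sum simp: coord_simplexD(2))
    show "continuous_on (coord_simplex k k) (\<lambda>y. h j (insert_coord i 0 y))"
      by (rule continuous_on_face[OF c[OF that(1)] that(2)]) (auto simp: coord_simplexD(2))
  qed
  have "0 = space_integral (Suc k) (on_simplex (Suc k) (\<lambda>y. \<Sum>j\<in>{..k}. (-1) ^ j * partial_on (Suc k) ?A j (h j) y))"
    using cl by (simp add: space_integral_def on_simplex_def cong: if_cong)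
  also have "\<dots> = (\<Sum>j\<le>k. (-1) ^ j * space_integral (Suc k) (on_simplex (Suc k) (partial_on (Suc k) ?A j (h j))))"
    using cD by (intro space_integral_sum) auto
  also have "\<dots> = (\<Sum>j\<le>k. (-1) ^ j * (space_integral k (on_simplex k (\<lambda>y. h j (insert_coord 0 (1 - coord_sum k y) y)))
      - space_integral k (on_simplex k (\<lambda>y. h j (insert_coord j 0 y)))))"
  proof (intro sum.cong refl arg_cong2[where f="(*)"])
    fix j assume "j \<in> {..k}"
    then have j: "j \<le> k" by simp
    show "space_integral (Suc k) (on_simplex (Suc k) (partial_on (Suc k) ?A j (h j)))
      = space_integral k (on_simplex k (\<lambda>y. h j (insert_coord 0 (1 - coord_sum k y) y)))
        - space_integral k (on_simplex k (\<lambda>y. h j (insert_coord j 0 y)))"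
      unfolding space_integral_partial[OF j h[OF j]] space_integral_diff[OF cf(1)[OF j j] cf(2)[OF j j]]
        space_integral_slanted_face[OF c[OF j] j] ..
  qed
  also have "\<dots> = (\<Sum>j\<le>k. (-1) ^ j * space_integral k (on_simplex k (\<lambda>y. h j (insert_coord 0 (1 - coord_sum k y) y))))
      - (\<Sum>j\<le>k. (-1) ^ j * space_integral k (on_simplex k (\<lambda>y. h j (insert_coord j 0 y))))"
    by (simp add: right_diff_distrib sum_subtractf)
  also have "(\<Sum>j\<le>k. (-1) ^ j * space_integral k (on_simplex k (\<lambda>y. h j (insert_coord 0 (1 - coord_sum k y) y))))
      = space_integral k (on_simplex k (\<lambda>y. \<Sum>j\<le>k. (-1) ^ j * h j (insert_coord 0 (1 - coord_sum k y) y)))"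
    using cf by (intro space_integral_sum[symmetric]) auto
  finally show ?thesis by simp
qed

text \<open>In the multilinear expansion every term with \<open>v0\<close> in two places vanishes,
  which leaves the term without \<open>v0\<close> and those with exactly one.\<close>

lemma (in alternating) difference_entries:
  assumes "length xs + length ys = k" "set xs \<subseteq> coords d" "set ys \<subseteq> coords d" "v0 \<in> coords d"
  shows "\<phi> (xs @ map (\<lambda>v j. 1 * v j + (-1) * v0 j) ys) = \<phi> (xs @ ys) - (\<Sum>b<length ys. \<phi> (xs @ ys[b := v0]))"
  using assms(1-3)
proof (induction ys arbitrary: xs)
  case (Cons y ys)
  let ?m = "map (\<lambda>v j. 1 * v j + (-1) * v0 j) ys"
  have m: "set ?m \<subseteq> coords d" using Cons.prems assms(4) by (auto simp: coords_def)
  have z: "\<phi> (xs @ v0 # ys[b := v0]) = 0" if b: "b < length ys" for b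
  proof -
    have "ys[b := v0] = take b ys @ v0 # drop (Suc b) ys" using b by (rule upd_conv_take_nth_drop)
    then show ?thesis
      using repeated[of xs "take b ys" "drop (Suc b) ys" v0] Cons.prems assms(4) b
        set_take_subset[of b ys] set_drop_subset[of "Suc b" ys] by auto
  qed
  have "\<phi> (xs @ (\<lambda>j. 1 * y j + (-1) * v0 j) # ?m) = \<phi> ((xs @ [y]) @ ?m) - \<phi> ((xs @ [v0]) @ ?m)"
    using linear[of xs ?m y v0 1 "-1"] Cons.prems assms(4) m by simp
  also have "\<phi> ((xs @ [y]) @ ?m) = \<phi> (xs @ y # ys) - (\<Sum>b<length ys. \<phi> (xs @ y # ys[b := v0]))"
    using Cons.IH[of "xs @ [y]"] Cons.prems by simp
  also have "\<phi> ((xs @ [v0]) @ ?m) = \<phi> (xs @ v0 # ys)"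
    using Cons.IH[of "xs @ [v0]"] Cons.prems assms(4) z by simp
  finally show ?case
    by (simp add: sum.lessThan_Suc_shift del: sum.lessThan_Suc)
qed simp

text \<open>The tangent vectors of the slanted face are differences \<open>e_(a+1) - e_0\<close>.
  This expresses the coefficient of a form restricted to that face by the coefficients with one
  basis vector omitted.\<close>

lemma (in alternating) slanted_entries:
  assumes "length vs = k" "set vs \<subseteq> coords d" "v0 \<in> coords d"
  shows "\<phi> (map (\<lambda>v j. 1 * v j + (-1) * v0 j) vs) = (\<Sum>j\<le>k. (-1) ^ j * \<phi> (omit_nth j (v0 # vs)))"
proof -
  \<comment> \<open>Moving \<open>v0\<close> from position \<open>b\<close> to the front costs
    \<open>(-1) ^ b\<close>; the leading \<open>v0\<close> shifts the omitted index by one, which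
    gives the remaining minus sign.\<close>
  have e: "(-1) ^ Suc b * \<phi> (omit_nth (Suc b) (v0 # vs)) = - \<phi> (vs[b := v0])" if b: "b < k" for b
  proof -
    have "omit_nth (Suc b) (v0 # vs) = [] @ v0 # take b vs @ drop (Suc b) vs" by (simp add: omit_nth_def)
    moreover have "vs[b := v0] = [] @ take b vs @ v0 # drop (Suc b) vs"
      using b assms(1) by (simp add: upd_conv_take_nth_drop)
    moreover have "\<phi> ([] @ v0 # take b vs @ drop (Suc b) vs) = (-1) ^ length (take b vs) * \<phi> ([] @ take b vs @ v0 # drop (Suc b) vs)"
      using b assms set_take_subset[of b vs] set_drop_subset[of "Suc b" vs] by (intro move_entry) auto
    moreover have "(-1::complex) ^ b * (-1) ^ b = 1" by (simp flip: power_mult_distrib)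
    ultimately show ?thesis using b assms(1) by (simp flip: mult.assoc)
  qed
  have "(\<Sum>j\<le>k. (-1) ^ j * \<phi> (omit_nth j (v0 # vs))) = \<phi> vs + (\<Sum>b<k. (-1) ^ Suc b * \<phi> (omit_nth (Suc b) (v0 # vs)))"
    by (subst sum.atMost_shift) (simp add: omit_nth_def)
  also have "\<dots> = \<phi> vs - (\<Sum>b<k. \<phi> (vs[b := v0]))"
    using e by (simp add: sum_negf)
  finally show ?thesis using difference_entries[of "[]" vs v0] assms by simp
qed

section \<open>Faces of the simplex in coordinates, and Stokes' theorem for singular
  simplices\<close>

lemma smooth_map_face: "i \<le> Suc k \<Longrightarrow> smooth_map (simplex_space k) (simplex_space (Suc k)) (simplical_face i)"
  by (rule smooth_map_simplex[OF simplex_map_smooth_face])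

text \<open>The chart forgets barycentric coordinate \<open>0\<close>. Hence face \<open>0\<close>
  is the slanted one, while on face \<open>i > 0\<close> the coordinate with index
  \<open>i - 1\<close> vanishes.\<close>

lemma face_coords:
  assumes i: "i \<le> Suc k" and y: "y \<in> coord_simplex k k"
  shows "cmap (simplex_chart (Suc k)) (simplical_face i (barycentric k y))
    = (if i = 0 then insert_coord 0 (1 - coord_sum k y) y else insert_coord (i - 1) 0 y)"
proof
  fix l
  have "y l' = 0" if "k \<le> l'" for l' using coords_ge[OF coord_simplexD(1)[OF y] that] .
  then show "cmap (simplex_chart (Suc k)) (simplical_face i (barycentric k y)) l
    = (if i = 0 then insert_coord 0 (1 - coord_sum k y) y else insert_coord (i - 1) 0 y) l"
    using i by (auto simp: simplical_face_def barycentric_def insert_coord_def)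
qed

lemma face_diff:
  assumes i: "i \<le> Suc k" and y: "y \<in> coord_simplex k k" and a: "a < k"
  shows "coord_diff (simplex_chart k) (simplex_chart (Suc k)) (simplical_face i) (barycentric k y) (unit_vec a)
    = (if i = 0 then (\<lambda>j. 1 * unit_vec (Suc a) j + (-1) * unit_vec 0 j)
       else unit_vec (if a < i - 1 then a else Suc a))"
proof
  let ?A = "coord_simplex k k"
  have r: "regular k ?A" by (rule regular_coord_simplex) simp
  note Ac = coord_simplex_coords[of k k]
  fix l
  let ?f = "\<lambda>y. cmap (simplex_chart (Suc k)) (simplical_face i (chart_inv (simplex_chart k) y)) l"
  have dom: "cmap (simplex_chart k) ` (cdom (simplex_chart k) \<inter> simplical_face i -` cdom (simplex_chart (Suc k))) = ?A"
  proof -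
    have "standard_simplex k \<inter> simplical_face i -` standard_simplex (Suc k) = standard_simplex k"
      using simplical_face_in_standard_simplex[of "Suc k" i] i by auto
    then show ?thesis using simplex_chart_image by simp
  qed
  have c: "partial_on k ?A a ?f y = partial_on k ?A a (\<lambda>y. (if i = 0 then insert_coord 0 (1 - coord_sum k y) y
      else insert_coord (i - 1) 0 y) l) y"
    by (rule partial_on_cong) (simp only: chart_inv_simplex face_coords[OF i])
  have p0: "partial_on k ?A a (\<lambda>y. 1 - coord_sum k y) y = -1"
  proof -
    have s: "smooth_on_open k (coords k) (\<lambda>y. 1 + (-1) * coord_sum k y)"
      using openin_topspace[of "Euclidean_space k"] unfolding topspace_coords
      by (intro smooth_on_open_add smooth_on_open_mult smooth_on_open_sum smooth_on_open_const smooth_on_open_coord)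
    have "((\<lambda>t. 1 + (-1) * (\<Sum>j<k. (y(a := t)) j)) has_vector_derivative 0 + (-1) * (\<Sum>j<k. if j = a then 1 else 0)) (at (y a))"
    proof (intro has_vector_derivative_add has_vector_derivative_const has_vector_derivative_mult_right has_vector_derivative_sum)
      show "((\<lambda>t. (y(a := t)) j) has_vector_derivative (if j = a then 1 else 0)) (at (y a))" for j
        by auto
    qed
    then have "has_partial a (\<lambda>y. 1 + (-1) * coord_sum k y) (-1) y" using a by (simp add: has_partial_def)
    then have "partial a (\<lambda>y. 1 + (-1) * coord_sum k y) y = -1" by (rule has_partial_imp)
    then show ?thesis
      using partial_on_eq[OF r y a s, of "\<lambda>y. 1 - coord_sum k y"] y Ac by auto
  qed
  have pc: "partial_on k ?A a (\<lambda>y. y j) y = (if a = j then 1 else 0)" for j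
    by (rule partial_on_coord[OF r y a])
  have pz: "partial_on k ?A a (\<lambda>y. 0::real) y = 0" by (rule partial_on_const[OF r y a])
  have "partial_on k ?A a ?f y = (if i = 0 then (\<lambda>j. 1 * unit_vec (Suc a) j + (-1) * unit_vec 0 j)
       else unit_vec (if a < i - 1 then a else Suc a)) l"
  proof (cases "i = 0")
    case True
    then show ?thesis unfolding c using p0 pc[of "l - 1"]
      by (cases l) (auto simp: insert_coord_def unit_vec_def)
  next
    case False
    consider "l < i - 1" | "l = i - 1" | "l > i - 1" by linarith
    then show ?thesis unfolding c using False pc[of l] pc[of "l - 1"] pz
      by cases (auto simp: insert_coord_def unit_vec_def)
  qed
  moreover have "cmap (simplex_chart k) (barycentric k y) = y" by (rule simplex_chart_barycentric[OF y])
  moreover have "(if i = 0 then (\<lambda>j. 1 * unit_vec (Suc a) j + (-1) * unit_vec 0 j)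
       else unit_vec (if a < i - 1 then a else Suc a)) l = 0" if "\<not> l < Suc k"
    using that a i by (auto simp: unit_vec_def)
  moreover have "a < cdim (simplex_chart k)" using a by simp
  ultimately show "coord_diff (simplex_chart k) (simplex_chart (Suc k)) (simplical_face i) (barycentric k y) (unit_vec a) l
    = (if i = 0 then (\<lambda>j. 1 * unit_vec (Suc a) j + (-1) * unit_vec 0 j)
       else unit_vec (if a < i - 1 then a else Suc a)) l"
    unfolding coord_diff_unit[OF \<open>a < cdim (simplex_chart k)\<close>] dom simplex_chart_simps(2) by presburger
qed

lemma omit_nth_units:
  assumes "j \<le> k"
  shows "omit_nth j (map unit_vec [0..<Suc k]) = map (\<lambda>a. unit_vec (if a < j then a else Suc a)) [0..<k]"
proof (rule nth_equalityI)
  fix a assume "a < length (omit_nth j (map unit_vec [0..<Suc k]))"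
  then have "a < k" using assms by (simp add: length_omit_nth del: upt_Suc)
  then show "omit_nth j (map unit_vec [0..<Suc k]) ! a = map (\<lambda>a. unit_vec (if a < j then a else Suc a)) [0..<k] ! a"
    using assms by (subst nth_omit_nth) (auto simp del: upt_Suc)
qed (use assms in \<open>simp add: length_omit_nth del: upt_Suc\<close>)

text \<open>The Jacobian of a face inclusion has columns that are basis vectors, except on face
  \<open>0\<close>, where they are differences of basis vectors and \<open>slanted_entries\<close>
  turns the coefficient into an alternating sum.\<close>

lemma local_rep_face:
  fixes \<eta> :: "(nat \<Rightarrow> real) form"
  assumes i: "i \<le> Suc k" and y: "y \<in> coord_simplex k k"
    and alt: "\<And>z. z \<in> coord_simplex (Suc k) (Suc k) \<Longrightarrow>
      alternating k (Suc k) (\<lambda>us. local_rep (simplex_space (Suc k)) (simplex_chart (Suc k)) \<eta> us z)"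
  shows "local_rep (simplex_space k) (simplex_chart k)
      (pullback_form (simplex_space k) (simplex_space (Suc k)) k (simplical_face i) \<eta>) (map unit_vec [0..<k]) y
    = (if i = 0 then (\<Sum>j\<le>k. (-1) ^ j * local_rep (simplex_space (Suc k)) (simplex_chart (Suc k)) \<eta>
         (omit_nth j (map unit_vec [0..<Suc k])) (insert_coord 0 (1 - coord_sum k y) y))
       else local_rep (simplex_space (Suc k)) (simplex_chart (Suc k)) \<eta>
         (omit_nth (i - 1) (map unit_vec [0..<Suc k])) (insert_coord (i - 1) 0 y))"
proof -
  let ?p = "barycentric k y"
  let ?R = "local_rep (simplex_space (Suc k)) (simplex_chart (Suc k)) \<eta>"
  have inv: "chart_inv (simplex_chart k) y = ?p" by (rule chart_inv_simplex[OF y])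
  have "simplical_face i ?p \<in> standard_simplex (Suc k)"
    using simplical_face_in_standard_simplex[of "Suc k" i ?p] i barycentric_in[OF y] by simp
  then have c': "simplex_chart (Suc k) \<in> charts_at (simplex_space (Suc k)) (simplical_face i (chart_inv (simplex_chart k) y))"
    by (simp add: charts_at_def inv)
  have "local_rep (simplex_space k) (simplex_chart k)
      (pullback_form (simplex_space k) (simplex_space (Suc k)) k (simplical_face i) \<eta>) (map unit_vec [0..<k]) y
    = ?R (map (coord_diff (simplex_chart k) (simplex_chart (Suc k)) (simplical_face i) ?p) (map unit_vec [0..<k]))
        (cmap (simplex_chart (Suc k)) (simplical_face i ?p))"
  proof -
    have "simplex_chart k \<in> atlas (simplex_space k)" "y \<in> cmap (simplex_chart k) ` cdom (simplex_chart k)"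
      using y simplex_chart_image[of k] by simp_all
    moreover have "length (map unit_vec [0..<k]) = k" "set (map unit_vec [0..<k]) \<subseteq> coords (cdim (simplex_chart k))"
      using unit_vec_coords by auto
    ultimately show ?thesis
      using local_rep_pullback[where f="simplical_face i" and c="simplex_chart k" and y=y and \<omega>=\<eta>,
          OF corner_space_simplex corner_space_simplex smooth_map_face[OF i] _ _ c', of "map unit_vec [0..<k]" k]
        inv by (simp del: map_map)
  qed
  also have "\<dots> = (if i = 0 then (\<Sum>j\<le>k. (-1) ^ j * ?R (omit_nth j (map unit_vec [0..<Suc k])) (insert_coord 0 (1 - coord_sum k y) y))
       else ?R (omit_nth (i - 1) (map unit_vec [0..<Suc k])) (insert_coord (i - 1) 0 y))"
  proof (cases "i = 0")
    case True
    have z: "insert_coord 0 (1 - coord_sum k y) y \<in> coord_simplex (Suc k) (Suc k)"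
      using insert_coord_simplex[of 0 k y "1 - coord_sum k y"] y coord_simplexD[OF y] by simp
    interpret alternating k "Suc k" "\<lambda>us. ?R us (insert_coord 0 (1 - coord_sum k y) y)" by (rule alt[OF z])
    have m1: "map (coord_diff (simplex_chart k) (simplex_chart (Suc k)) (simplical_face i) ?p) (map unit_vec [0..<k])
        = map (\<lambda>v j. 1 * v j + (-1) * unit_vec 0 j) (map (\<lambda>a. unit_vec (Suc a)) [0..<k])"
      using True y by (auto simp: face_diff[of 0 k y])
    have m2: "map unit_vec [0..<Suc k] = unit_vec 0 # map (\<lambda>a. unit_vec (Suc a)) [0..<k]"
      by (simp add: upt_conv_Cons map_Suc_upt[symmetric] o_def del: upt_Suc)
    show ?thesis
      unfolding m1 m2 face_coords[OF i y] if_P[OF True]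
      by (rule slanted_entries) (auto simp: unit_vec_coords)
  next
    case False
    have "map (coord_diff (simplex_chart k) (simplex_chart (Suc k)) (simplical_face i) ?p) (map unit_vec [0..<k])
        = map (\<lambda>a. unit_vec (if a < i - 1 then a else Suc a)) [0..<k]"
      using False by (auto simp: face_diff[OF i y])
    moreover have "i - 1 \<le> k" using i by simp
    ultimately show ?thesis
      unfolding face_coords[OF i y] if_not_P[OF False] by (simp only: omit_nth_units)
  qed
  finally show ?thesis .
qed

text \<open>The form is pulled back along \<sigma> to the simplex, where
  \<open>pullback_closed\<close> supplies the hypothesis of \<open>stokes_coords\<close>;
  functoriality identifies the restrictions to the faces. The maps \<tau> are prescribed on the
  simplex only, to fit \<open>singular_face\<close>.\<close>

lemma stokes_singular:
  assumes N: "corner_space N" and \<sigma>: "smooth_map (simplex_space (Suc k)) N \<sigma>"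
    and \<omega>: "smooth_form N k \<omega>" and cl: "ext_deriv N k \<omega> = (\<lambda>p vs. 0)"
    and \<tau>: "\<And>i x. i \<le> Suc k \<Longrightarrow> x \<in> standard_simplex k \<Longrightarrow> \<tau> i x = \<sigma> (simplical_face i x)"
  shows "(\<Sum>i\<le>Suc k. (-1) ^ i * integral_simplex k (pullback_form (simplex_space k) N k (\<tau> i) \<omega>)) = 0"
proof -
  let ?S = "simplex_space (Suc k)" and ?s = "simplex_chart (Suc k)"
  let ?A = "coord_simplex (Suc k) (Suc k)"
  define \<eta> where "\<eta> = pullback_form ?S N k \<sigma> \<omega>"
  define h where "h j = local_rep ?S ?s \<eta> (omit_nth j (map unit_vec [0..<Suc k]))" for j
  have img: "cmap ?s ` cdom ?s = ?A" using simplex_chart_image by simp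
  have us: "length (omit_nth j (map unit_vec [0..<Suc k])) = k"
    "set (omit_nth j (map unit_vec [0..<Suc k])) \<subseteq> coords (cdim ?s)" if "j \<le> k" for j
    using that set_omit_nth[of j "map unit_vec [0..<Suc k]"] unit_vec_coords
    by (auto simp: length_omit_nth simp del: upt_Suc)
  have alt: "alternating k (Suc k) (\<lambda>us. local_rep ?S ?s \<eta> us z)" if "z \<in> ?A" for z
    using alternating_local_rep_pullback[OF corner_space_simplex N \<sigma> \<omega>, of ?s z] that img by (simp add: \<eta>_def)
  have h: "smooth_on_subset (Suc k) ?A (h j)" if "j \<le> k" for j
    using smooth_on_subset_local_rep_pullback[OF corner_space_simplex N \<sigma> \<omega> _ us[OF that]] img
    by (simp add: h_def \<eta>_def)
  have closed: "(\<Sum>j\<le>k. (-1) ^ j * partial_on (Suc k) ?A j (h j) y) = 0" if y: "y \<in> ?A" for y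
  proof -
    have "(\<Sum>j\<le>k. (-1) ^ j * partial_on (cdim ?s) (cmap ?s ` cdom ?s) ([0..<Suc k] ! j)
      (local_rep ?S ?s (pullback_form ?S N k \<sigma> \<omega>) (omit_nth j (map unit_vec [0..<Suc k]))) y) = 0"
      using y img by (intro pullback_closed[OF corner_space_simplex N \<sigma> \<omega> cl]) auto
    then show ?thesis
      unfolding img unfolding simplex_chart_simps(2) h_def \<eta>_def by (simp del: upt_Suc)
  qed
  have pb: "integral_simplex k (pullback_form (simplex_space k) N k (\<tau> i) \<omega>)
      = space_integral k (on_simplex k (if i = 0 then (\<lambda>y. \<Sum>j\<le>k. (-1) ^ j * h j (insert_coord 0 (1 - coord_sum k y) y))
         else (\<lambda>y. h (i - 1) (insert_coord (i - 1) 0 y))))" if i: "i \<le> Suc k" for i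
  proof -
    have "pullback_form (simplex_space k) N k (\<tau> i) \<omega> = pullback_form (simplex_space k) ?S k (simplical_face i) \<eta>"
      unfolding \<eta>_def using \<tau>[OF i]
      by (intro pullback_form_compose[OF corner_space_simplex corner_space_simplex N smooth_map_face[OF i] \<sigma>]) simp
    then show ?thesis
      unfolding integral_simplex_eq using local_rep_face[OF i _ alt]
      by (auto simp: on_simplex_def h_def intro!: arg_cong[where f="space_integral k"] simp del: upt_Suc)
  qed
  \<comment> \<open>Face \<open>0\<close> yields the left-hand side of \<open>stokes_coords\<close>;
    face \<open>Suc j\<close> belongs to \<open>h j\<close> and has the sign opposite to
    \<open>(-1) ^ j\<close>, so the sum is the difference of the two sides.\<close>
  have "(\<Sum>i\<le>Suc k. (-1) ^ i * integral_simplex k (pullback_form (simplex_space k) N k (\<tau> i) \<omega>))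
      = integral_simplex k (pullback_form (simplex_space k) N k (\<tau> 0) \<omega>)
        + (\<Sum>j\<le>k. (-1) ^ Suc j * integral_simplex k (pullback_form (simplex_space k) N k (\<tau> (Suc j)) \<omega>))"
    by (subst sum.atMost_shift) (simp add: lessThan_Suc_atMost)
  also have "\<dots> = 0"
    using stokes_coords[OF h closed] by (simp add: pb sum_negf)
  finally show ?thesis .
qed

section \<open>Additivity of integration and of the exterior derivative\<close>

lemma integral_simplex_pullback_add:
  assumes N: "corner_space N" and \<sigma>: "smooth_map (simplex_space k) N \<sigma>"
    and \<omega>: "smooth_form N k \<omega>" and \<eta>: "smooth_form N k \<eta>"
  shows "integral_simplex k (pullback_form (simplex_space k) N k \<sigma> (\<lambda>p vs. \<omega> p vs + \<eta> p vs))
    = integral_simplex k (pullback_form (simplex_space k) N k \<sigma> \<omega>)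
      + integral_simplex k (pullback_form (simplex_space k) N k \<sigma> \<eta>)"
proof -
  let ?s = "simplex_chart k"
  let ?R = "\<lambda>\<omega>. local_rep (simplex_space k) ?s (pullback_form (simplex_space k) N k \<sigma> \<omega>) (map unit_vec [0..<k])"
  have c: "continuous_on (coord_simplex k k) (?R \<omega>)" if "smooth_form N k \<omega>" for \<omega>
  proof -
    have "smooth_on_subset (cdim ?s) (cmap ?s ` cdom ?s) (?R \<omega>)"
      using unit_vec_coords
      by (intro smooth_on_subset_local_rep_pullback[OF corner_space_simplex N \<sigma> that]) auto
    then show ?thesis using smooth_on_subset_continuous simplex_chart_image by (metis simplex_chart_simps(1))
  qed
  have "?R (\<lambda>p vs. \<omega> p vs + \<eta> p vs) = (\<lambda>y. ?R \<omega> y + ?R \<eta> y)"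
    by (auto simp: local_rep_def pullback_form_def)
  then show ?thesis
    unfolding integral_simplex_eq using space_integral_add[OF c[OF \<omega>] c[OF \<eta>]] by simp
qed

lemma smooth_form_add:
  assumes "smooth_form M k \<omega>" "smooth_form M k \<eta>"
  shows "smooth_form M k (\<lambda>p vs. \<omega> p vs + \<eta> p vs)"
  unfolding smooth_form_def
proof (intro conjI ballI allI impI)
  fix p assume p: "p \<in> points M"
  show "multilinear_form M k p (\<lambda>vs. \<omega> p vs + \<eta> p vs)"
    using smooth_formD(1)[OF assms(1) p] smooth_formD(1)[OF assms(2) p]
    by (simp add: multilinear_form_def algebra_simps)
  show "alternating_form M k p (\<lambda>vs. \<omega> p vs + \<eta> p vs)"
    using smooth_formD(2)[OF assms(1) p] smooth_formD(2)[OF assms(2) p]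
    unfolding alternating_form_def by fastforce
next
  fix c us assume c: "c \<in> atlas M" "length us = k \<and> set us \<subseteq> topspace (Euclidean_space (cdim c))"
  have "smooth_on_subset (cdim c) (cmap c ` cdom c) (\<lambda>y. local_rep M c \<omega> us y + local_rep M c \<eta> us y)"
    using c by (intro smooth_on_subset_add smooth_formD(3)[OF assms(1)] smooth_formD(3)[OF assms(2)]) (auto simp: topspace_coords)
  then show "smooth_on_subset (cdim c) (cmap c ` cdom c) (local_rep M c (\<lambda>p vs. \<omega> p vs + \<eta> p vs) us)"
    by (rule smooth_on_subset_cong) (simp add: local_rep_def)
next
  fix p vs assume "\<not> (p \<in> points M \<and> vs \<in> tangent_lists M k p)"
  then show "\<omega> p vs + \<eta> p vs = 0" using assms unfolding smooth_form_def by simp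
qed

lemma smooth_form_cmult:
  assumes "smooth_form M k \<omega>"
  shows "smooth_form M k (\<lambda>p vs. a * \<omega> p vs)"
  unfolding smooth_form_def
proof (intro conjI ballI allI impI)
  fix p assume p: "p \<in> points M"
  show "multilinear_form M k p (\<lambda>vs. a * \<omega> p vs)"
    using smooth_formD(1)[OF assms p] by (simp add: multilinear_form_def algebra_simps)
  show "alternating_form M k p (\<lambda>vs. a * \<omega> p vs)"
    using smooth_formD(2)[OF assms p] unfolding alternating_form_def by fastforce
next
  fix c us assume c: "c \<in> atlas M" "length us = k \<and> set us \<subseteq> topspace (Euclidean_space (cdim c))"
  then have s: "smooth_on_subset (cdim c) (cmap c ` cdom c) (local_rep M c \<omega> us)"
    using smooth_formD(3)[OF assms] by (simp add: topspace_coords)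
  have "smooth_on_subset (cdim c) (cmap c ` cdom c) (\<lambda>y. a * local_rep M c \<omega> us y)"
    by (intro smooth_on_subset_mult s smooth_on_subset_const smooth_on_subset_coords[OF s])
  then show "smooth_on_subset (cdim c) (cmap c ` cdom c) (local_rep M c (\<lambda>p vs. a * \<omega> p vs) us)"
    by (rule smooth_on_subset_cong) (simp add: local_rep_def)
next
  fix p vs assume "\<not> (p \<in> points M \<and> vs \<in> tangent_lists M k p)"
  then show "a * \<omega> p vs = 0" using assms unfolding smooth_form_def by simp
qed

lemma smooth_form_zero:
  assumes "corner_space M" shows "smooth_form M k (\<lambda>p vs. 0)"
proof -
  have "smooth_on_subset (cdim c) (cmap c ` cdom c) (local_rep M c (\<lambda>p vs. 0) us)" if "c \<in> atlas M" for c us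
    using smooth_on_subset_const[of "cmap c ` cdom c" "cdim c" "0::complex"] corner_spaceD(2)[OF assms that]
    by (simp add: regular_def local_rep_def[abs_def])
  then show ?thesis by (simp add: smooth_form_def multilinear_form_def alternating_form_def)
qed

lemma ext_deriv_add:
  assumes M: "corner_space M" and \<omega>: "smooth_form M k \<omega>" and \<eta>: "smooth_form M k \<eta>"
  shows "ext_deriv M k (\<lambda>p vs. \<omega> p vs + \<eta> p vs) = (\<lambda>p vs. ext_deriv M k \<omega> p vs + ext_deriv M k \<eta> p vs)"
proof (intro ext)
  fix p vs
  show "ext_deriv M k (\<lambda>p vs. \<omega> p vs + \<eta> p vs) p vs = ext_deriv M k \<omega> p vs + ext_deriv M k \<eta> p vs"
  proof (cases "p \<in> points M \<and> vs \<in> tangent_lists M (Suc k) p")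
    case True
    let ?c = "chart_at M p"
    note c = chart_at_in[OF M, of p]
    have ca: "?c \<in> atlas M" "p \<in> cdom ?c" "?c \<in> charts_at M p" using True c charts_atD by auto
    have e: "partial_on (cdim ?c) (cmap ?c ` cdom ?c) i
          (local_rep M ?c (\<lambda>p vs. \<omega> p vs + \<eta> p vs) (map (\<lambda>v. v ?c) (omit_nth j vs))) (cmap ?c p)
        = partial_on (cdim ?c) (cmap ?c ` cdom ?c) i (local_rep M ?c \<omega> (map (\<lambda>v. v ?c) (omit_nth j vs))) (cmap ?c p)
        + partial_on (cdim ?c) (cmap ?c ` cdom ?c) i (local_rep M ?c \<eta> (map (\<lambda>v. v ?c) (omit_nth j vs))) (cmap ?c p)"
      if j: "j \<le> k" and i: "i < cdim ?c" for i j
    proof -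
      let ?us = "map (\<lambda>v. v ?c) (omit_nth j vs)"
      have "length vs = Suc k" "set vs \<subseteq> tangent_space M p" using True by (auto simp: tangent_lists_def)
      then have us: "length ?us = k" "set ?us \<subseteq> coords (cdim ?c)"
        using j set_omit_nth[of j vs] tangent_space_coords[OF _ ca(3)] by (auto simp: length_omit_nth)
      have "local_rep M ?c (\<lambda>p vs. \<omega> p vs + \<eta> p vs) ?us = (\<lambda>y. local_rep M ?c \<omega> ?us y + local_rep M ?c \<eta> ?us y)"
        by (auto simp: local_rep_def)
      then show ?thesis
        using partial_on_add[OF smooth_formD(3)[OF \<omega> ca(1) us] smooth_formD(3)[OF \<eta> ca(1) us] corner_spaceD(2)[OF M ca(1)] _ i]
          ca(2) by simp
    qed
    show ?thesis using True
      by (simp add: ext_deriv_def Let_def e distrib_left sum.distrib)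
  next
    case False
    then show ?thesis unfolding ext_deriv_def if_not_P[OF False] by simp
  qed
qed

section \<open>Smooth singular cochains\<close>

lemma smooth_simplex_map:
  assumes M: "corner_space M" and N: "corner_space N" and f: "smooth_map M N f" and \<sigma>: "smooth_simplex k M \<sigma>"
  shows "smooth_simplex k N (simplex_map k f \<sigma>)"
  unfolding smooth_simplex_def
proof
  show "singular_simplex k (top_of N) (simplex_map k f \<sigma>)"
    using \<sigma> f by (auto simp: smooth_simplex_def smooth_map_def intro: singular_simplex_simplex_map)
  show "smooth_map (simplex_space k) N (simplex_map k f \<sigma>)"
    using \<sigma> by (intro smooth_map_compose[OF corner_space_simplex M N _ f])
      (auto simp: smooth_simplex_def simplex_map_def)
qed

lemma smooth_simplex_face:
  assumes M: "corner_space M" and \<sigma>: "smooth_simplex (Suc k) M \<sigma>" and i: "i \<le> Suc k"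
  shows "smooth_simplex k M (singular_face (Suc k) i \<sigma>)"
  unfolding smooth_simplex_def
proof
  show "singular_simplex k (top_of M) (singular_face (Suc k) i \<sigma>)"
    using \<sigma> i singular_simplex_singular_face[of "Suc k" "top_of M" \<sigma> i] by (simp add: smooth_simplex_def)
  show "smooth_map (simplex_space k) M (singular_face (Suc k) i \<sigma>)"
    using \<sigma> by (intro smooth_map_compose[OF corner_space_simplex corner_space_simplex M smooth_map_face[OF i]])
      (auto simp: smooth_simplex_def singular_face_def)
qed

lemma face_simplex_map:
  assumes "i \<le> Suc k"
  shows "singular_face (Suc k) i (simplex_map (Suc k) f \<sigma>) = simplex_map k f (singular_face (Suc k) i \<sigma>)"
proof
  fix x show "singular_face (Suc k) i (simplex_map (Suc k) f \<sigma>) x = simplex_map k f (singular_face (Suc k) i \<sigma>) x"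
    using simplical_face_in_standard_simplex[of "Suc k" i x] assms
    by (auto simp: singular_face_def simplex_map_def)
qed

text \<open>The coboundary in additive notation. The multiplicatively written coboundaries with
  values in the complex numbers, in \<Lambda> and in the quotient are all expressed by it.\<close>

definition face_sum ::
    "nat \<Rightarrow> 'a smooth_space \<Rightarrow> ('a, complex) cochain \<Rightarrow> ('a, complex) cochain" where
  "face_sum k M c = (\<lambda>\<sigma>. if smooth_simplex (Suc k) M \<sigma>
     then (\<Sum>i\<le>Suc k. (-1) ^ i * c (singular_face (Suc k) i \<sigma>)) else 0)"

text \<open>The pair \<open>(i, j)\<close> with \<open>i \<le> j\<close> is matched with
  \<open>(Suc j, i)\<close>; the values agree and the signs are opposite.\<close>

lemma sum_alternating_pairs:
  fixes F :: "nat \<Rightarrow> nat \<Rightarrow> complex"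
  assumes F: "\<And>i j. j < i \<Longrightarrow> i \<le> Suc m \<Longrightarrow> F i j = F j (i - 1)"
  shows "(\<Sum>i\<le>Suc m. (-1) ^ i * (\<Sum>j\<le>m. (-1) ^ j * F i j)) = 0"
proof -
  let ?g = "\<lambda>(i, j). (-1) ^ i * ((-1) ^ j * F i j)"
  let ?L = "{(i, j). j < i \<and> i \<le> Suc m}" and ?U = "{(i, j). i \<le> j \<and> j \<le> m}"
  have fin: "finite ?L" "finite ?U"
    by (rule finite_subset[of _ "{..Suc m} \<times> {..Suc m}"]; auto)+
  have dec: "{..Suc m} \<times> {..m} = ?L \<union> ?U" "?L \<inter> ?U = {}" by auto
  have bij: "bij_betw (\<lambda>(i, j). (Suc j, i)) ?U ?L"
    by (rule bij_betw_byWitness[where f'="\<lambda>(i, j). (j, i - 1)"]) auto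
  have "(\<Sum>i\<le>Suc m. (-1) ^ i * (\<Sum>j\<le>m. (-1) ^ j * F i j)) = (\<Sum>p\<in>{..Suc m} \<times> {..m}. ?g p)"
    unfolding sum_distrib_left sum.cartesian_product by simp
  also have "\<dots> = (\<Sum>p\<in>?L. ?g p) + (\<Sum>p\<in>?U. ?g p)"
    unfolding dec(1) by (rule sum.union_disjoint[OF fin dec(2)])
  also have "(\<Sum>p\<in>?L. ?g p) = (\<Sum>p\<in>?U. ?g (case p of (i, j) \<Rightarrow> (Suc j, i)))"
    by (rule sum.reindex_bij_betw[OF bij, symmetric])
  also have "\<dots> = (\<Sum>p\<in>?U. - ?g p)"
  proof (rule sum.cong[OF refl])
    fix p assume "p \<in> ?U"
    then obtain i j where p: "p = (i, j)" "i \<le> j" "j \<le> m" by auto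
    then have "F (Suc j) i = F i j" using F[of i "Suc j"] by simp
    then show "?g (case p of (i, j) \<Rightarrow> (Suc j, i)) = - ?g p" by (simp add: p)
  qed
  also have "\<dots> = - (\<Sum>p\<in>?U. ?g p)" by (rule sum_negf)
  finally show ?thesis by simp
qed

lemma singular_face_face:
  assumes "j < i" "i \<le> Suc (Suc k)"
  shows "singular_face (Suc k) j (singular_face (Suc (Suc k)) i \<sigma>)
    = singular_face (Suc k) (i - 1) (singular_face (Suc (Suc k)) j \<sigma>)"
proof
  fix t
  show "singular_face (Suc k) j (singular_face (Suc (Suc k)) i \<sigma>) t
    = singular_face (Suc k) (i - 1) (singular_face (Suc (Suc k)) j \<sigma>) t"
  proof (cases "t \<in> standard_simplex k")
    case True
    have "simplical_face j t \<in> standard_simplex (Suc k)" "simplical_face (i - 1) t \<in> standard_simplex (Suc k)"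
      using True assms by (auto intro!: simplical_face_in_standard_simplex)
    moreover have "simplical_face i (simplical_face j t) = simplical_face j (simplical_face (i - 1) t)"
    proof
      fix l show "simplical_face i (simplical_face j t) l = simplical_face j (simplical_face (i - 1) t) l"
        using assms by (auto simp: simplical_face_def)
    qed
    ultimately show ?thesis using True by (simp add: singular_face_def)
  qed (simp add: singular_face_def)
qed

lemma face_sum_face_sum:
  assumes M: "corner_space M"
  shows "face_sum (Suc k) M (face_sum k M c) = (\<lambda>\<sigma>. 0)"
proof
  fix \<sigma> show "face_sum (Suc k) M (face_sum k M c) \<sigma> = 0"
  proof (cases "smooth_simplex (Suc (Suc k)) M \<sigma>")
    case True
    let ?F = "\<lambda>i j. c (singular_face (Suc k) j (singular_face (Suc (Suc k)) i \<sigma>))"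
    have "face_sum (Suc k) M (face_sum k M c) \<sigma> = (\<Sum>i\<le>Suc (Suc k). (-1) ^ i * (\<Sum>j\<le>Suc k. (-1) ^ j * ?F i j))"
      using True smooth_simplex_face[OF M True] by (auto simp: face_sum_def simp del: sum.atMost_Suc intro!: sum.cong)
    also have "\<dots> = 0" by (rule sum_alternating_pairs) (simp add: singular_face_face)
    finally show ?thesis .
  qed (simp add: face_sum_def)
qed

subsection \<open>Coefficient groups\<close>

lemma complex_group_simps [simp]:
  "carrier complex_group = UNIV" "x \<otimes>\<^bsub>complex_group\<^esub> y = x + y" "\<one>\<^bsub>complex_group\<^esub> = 0"
  by (simp_all add: complex_group_def)

lemma comm_group_complex: "comm_group complex_group"
proof (rule comm_groupI)
  fix x assume "x \<in> carrier complex_group"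
  show "\<exists>y\<in>carrier complex_group. y \<otimes>\<^bsub>complex_group\<^esub> x = \<one>\<^bsub>complex_group\<^esub>"
    by (intro bexI[of _ "- x"]) auto
qed (auto simp: algebra_simps)

lemma complex_group_inv [simp]: "inv\<^bsub>complex_group\<^esub> x = - x"
  using group.inv_equality[of complex_group "- x" x] comm_group.axioms(2)[OF comm_group_complex] by simp

locale coeff_subgroup =
  fixes \<Lambda> :: "complex set"
  assumes subgroup: "subgroup \<Lambda> complex_group"
begin

lemma zero: "0 \<in> \<Lambda>" using subgroup.one_closed[OF subgroup] by simp
lemma add: "x \<in> \<Lambda> \<Longrightarrow> y \<in> \<Lambda> \<Longrightarrow> x + y \<in> \<Lambda>" using subgroup.m_closed[OF subgroup] by simp
lemma neg: "x \<in> \<Lambda> \<Longrightarrow> - x \<in> \<Lambda>" using subgroup.m_inv_closed[OF subgroup] by simp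
lemma neg_iff: "- x \<in> \<Lambda> \<longleftrightarrow> x \<in> \<Lambda>" using neg[of x] neg[of "- x"] by auto
lemma diff: "x \<in> \<Lambda> \<Longrightarrow> y \<in> \<Lambda> \<Longrightarrow> x - y \<in> \<Lambda>" using add[of x "- y"] neg by simp
lemma sign: "x \<in> \<Lambda> \<Longrightarrow> (-1) ^ (n::nat) * x \<in> \<Lambda>" by (cases "even n") (auto simp: neg)

lemma normal: "\<Lambda> \<lhd> complex_group"
  by (rule comm_group.subgroup_imp_normal[OF comm_group_complex subgroup])

definition sub :: "complex monoid" where "sub = complex_group\<lparr>carrier := \<Lambda>\<rparr>"

lemma sub_simps [simp]: "carrier sub = \<Lambda>" "x \<otimes>\<^bsub>sub\<^esub> y = x + y" "\<one>\<^bsub>sub\<^esub> = 0"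
  by (simp_all add: sub_def)

lemma comm_group_sub: "comm_group sub"
proof (rule comm_groupI)
  fix x assume "x \<in> carrier sub"
  then show "\<exists>y\<in>carrier sub. y \<otimes>\<^bsub>sub\<^esub> x = \<one>\<^bsub>sub\<^esub>"
    by (intro bexI[of _ "- x"]) (auto simp: neg)
qed (auto simp: add zero)

lemma sub_inv: "x \<in> \<Lambda> \<Longrightarrow> inv\<^bsub>sub\<^esub> x = - x"
  using group.inv_equality[of sub "- x" x] comm_group.axioms(2)[OF comm_group_sub] neg by simp

definition quot :: "complex set monoid" where "quot = complex_group Mod \<Lambda>"

definition coset :: "complex \<Rightarrow> complex set" where "coset z = \<Lambda> #>\<^bsub>complex_group\<^esub> z"

lemma comm_group_quot: "comm_group quot"
  unfolding quot_def by (rule comm_group.abelian_FactGroup[OF comm_group_complex subgroup])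

lemma coset_eq: "coset a = coset b \<longleftrightarrow> a - b \<in> \<Lambda>"
proof
  assume "coset a = coset b"
  moreover have "a \<in> coset a" using zero by (auto simp: coset_def r_coset_def)
  ultimately obtain l where "l \<in> \<Lambda>" "a = l + b" by (auto simp: coset_def r_coset_def)
  then show "a - b \<in> \<Lambda>" by simp
next
  assume ab: "a - b \<in> \<Lambda>"
  have "l + a \<in> coset b" if "l \<in> \<Lambda>" for l
    using add[OF that ab] by (auto simp: coset_def r_coset_def intro!: bexI[of _ "l + (a - b)"])
  moreover have "l + b \<in> coset a" if "l \<in> \<Lambda>" for l
    using diff[OF that ab] by (auto simp: coset_def r_coset_def intro!: bexI[of _ "l - (a - b)"])
  ultimately show "coset a = coset b" by (auto simp: coset_def r_coset_def)
qed

lemma quot_simps [simp]: "carrier quot = range coset" "\<one>\<^bsub>quot\<^esub> = coset 0" "coset a \<otimes>\<^bsub>quot\<^esub> coset b = coset (a + b)"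
proof -
  show "carrier quot = range coset" by (simp add: quot_def carrier_FactGroup coset_def[abs_def])
  have "coset 0 = \<Lambda>" by (auto simp: coset_def r_coset_def)
  then show "\<one>\<^bsub>quot\<^esub> = coset 0" by (simp add: quot_def)
  show "coset a \<otimes>\<^bsub>quot\<^esub> coset b = coset (a + b)"
    using normal.rcos_sum[OF normal, of a b] by (simp add: quot_def coset_def)
qed

lemma quot_inv [simp]: "inv\<^bsub>quot\<^esub> (coset a) = coset (- a)"
  using group.inv_equality[of quot "coset (- a)" "coset a"] comm_group.axioms(2)[OF comm_group_quot] by simp

text \<open>A set-theoretic section of \<open>\<complex> \<rightarrow> \<complex>/\<Lambda>\<close>.  Composition with it preserves compatibility of
  cochains, which is a condition on values at pairs of simplices.\<close>

definition coset_rep :: "complex set \<Rightarrow> complex" where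
  "coset_rep S = (if S = coset 0 then 0 else SOME z. coset z = S)"

lemma coset_coset_rep: "S \<in> range coset \<Longrightarrow> coset (coset_rep S) = S"
proof -
  assume "S \<in> range coset"
  then have "\<exists>z. coset z = S" by blast
  then have "coset (SOME z. coset z = S) = S" by (rule someI_ex)
  then show ?thesis by (simp add: coset_rep_def)
qed

text \<open>Cochains take the neutral value off the smooth simplices, so a lift is again a cochain
  only if the section sends the neutral coset to \<open>0\<close>.\<close>

lemma coset_rep_zero [simp]: "coset_rep (coset 0) = 0"
  by (simp add: coset_rep_def)

text \<open>The coset map is a homomorphism, so the alternating product in the quotient is the coset
  of the alternating sum.\<close>

lemma coboundary_quot:
  "coboundary quot M k (\<lambda>\<sigma>. coset (c \<sigma>)) = (\<lambda>\<sigma>. coset (face_sum k M c \<sigma>))"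
proof -
  interpret Q: comm_group quot by (rule comm_group_quot)
  have f: "finprod quot (\<lambda>i. if even i then coset (g i) else inv\<^bsub>quot\<^esub> coset (g i)) I = coset (\<Sum>i\<in>I. (-1) ^ i * g i)"
    if "finite I" for g and I :: "nat set"
    using that by (induction I rule: finite_induct) (simp_all add: Pi_def)
  show ?thesis
    by (simp only: coboundary_def face_sum_def f[OF finite_atMost] quot_simps if_distrib[of coset])
qed

lemma coboundary_sub:
  assumes "\<And>\<sigma>. c \<sigma> \<in> \<Lambda>"
  shows "coboundary sub M k c = face_sum k M c"
proof -
  interpret Q: comm_group sub by (rule comm_group_sub)
  have f: "finprod sub (\<lambda>i. if even i then g i else inv\<^bsub>sub\<^esub> g i) I = (\<Sum>i\<in>I. (-1) ^ i * g i)"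
    if "finite I" "\<And>i. g i \<in> \<Lambda>" for g and I :: "nat set"
    using that by (induction I rule: finite_induct) (simp_all add: sub_inv Pi_def neg)
  show ?thesis
    by (simp only: coboundary_def face_sum_def f[OF finite_atMost assms] sub_simps)
qed

end

lemma coboundary_complex: "coboundary complex_group M k c = face_sum k M c"
proof -
  \<comment> \<open>The group of all complex numbers is treated as the subgroup \<open>UNIV\<close>,
    which reduces the claim to \<open>coboundary_sub\<close>.\<close>
  interpret coeff_subgroup UNIV
    by unfold_locales auto
  have "sub = complex_group" by (simp add: sub_def complex_group_def)
  then show ?thesis using coboundary_sub[of c M k] by simp
qed

subsection \<open>Compatible cochains of a simplicial manifold\<close>

text \<open>Off the smooth simplices both pullbacks are neutral, so compatibility is an equation
  between values at pairs of simplices. In this form it passes through any map of coefficients that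
  keeps the neutral element.\<close>

lemma compatible_cochains_iff:
  "c \<in> compatible_cochains R X k \<longleftrightarrow> (\<forall>n. smooth_cochain R k (total_space X n) (c n)) \<and>
     (\<forall>n i \<sigma>. i \<le> Suc n \<longrightarrow> smooth_simplex k (simplex_times n (level X (Suc n))) \<sigma> \<longrightarrow>
        c (Suc n) (simplex_map k (face_incl i) \<sigma>) = c n (simplex_map k (face_proj X n i) \<sigma>))"
  unfolding compatible_cochains_def pullback_cochain_def fun_eq_iff by auto

locale simplicial_manifold =
  fixes X :: "'a simplicial_space"
  assumes simplicial: "simplicial_smooth_manifold X"
begin

lemma level: "smooth_manifold (level X n)"
  using simplicial by (simp add: simplicial_smooth_manifold_def)

lemma corner: "corner_space (simplex_times n (level X m))"
  by (rule corner_space_simplex_times[OF level])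

lemma smooth_face_incl:
  "i \<le> Suc n \<Longrightarrow> smooth_map (simplex_times n (level X (Suc n))) (total_space X (Suc n)) (face_incl i)"
  unfolding face_incl_def
  by (intro smooth_map_map_prod level simplex_map_smooth_face)
     (use level[of "Suc n"] in \<open>auto simp: smooth_map_def smooth_manifold_def\<close>)

lemma smooth_face_proj:
  "i \<le> Suc n \<Longrightarrow> smooth_map (simplex_times n (level X (Suc n))) (total_space X n) (face_proj X n i)"
  unfolding face_proj_def
  by (intro smooth_map_map_prod level simplex_map_smooth_id)
     (use simplicial in \<open>simp add: simplicial_smooth_manifold_def\<close>)

definition \<delta> :: "int \<Rightarrow> (nat \<Rightarrow> ((nat \<Rightarrow> real) \<times> 'a, complex) cochain) \<Rightarrow> nat \<Rightarrow> ((nat \<Rightarrow> real) \<times> 'a, complex) cochain" where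
  "\<delta> k c = (\<lambda>n. if k < 0 then (\<lambda>\<sigma>. 0) else face_sum (nat k) (total_space X n) (c n))"

definition CC :: "int \<Rightarrow> (nat \<Rightarrow> ((nat \<Rightarrow> real) \<times> 'a, complex) cochain) set" where
  "CC k = carrier (grp (cochains complex_group X) k)"

lemma CC_iff: "c \<in> CC k \<longleftrightarrow> (if k < 0 then c = (\<lambda>n \<sigma>. 0) else
     (\<forall>n \<sigma>. \<not> smooth_simplex (nat k) (total_space X n) \<sigma> \<longrightarrow> c n \<sigma> = 0) \<and>
     (\<forall>n i \<sigma>. i \<le> Suc n \<longrightarrow> smooth_simplex (nat k) (simplex_times n (level X (Suc n))) \<sigma> \<longrightarrow>
        c (Suc n) (simplex_map (nat k) (face_incl i) \<sigma>) = c n (simplex_map (nat k) (face_proj X n i) \<sigma>)))"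
  by (auto simp: CC_def cochains_def compatible_cochains_iff smooth_cochain_def)

lemma diff_complex: "diff (cochains complex_group X) k c = \<delta> k c"
  by (auto simp: cochains_def \<delta>_def coboundary_complex)

lemma CC_zero: "(\<lambda>n \<sigma>. 0) \<in> CC k" by (auto simp: CC_iff)
lemma CC_add: "a \<in> CC k \<Longrightarrow> b \<in> CC k \<Longrightarrow> (\<lambda>n \<sigma>. a n \<sigma> + b n \<sigma>) \<in> CC k" by (auto simp: CC_iff split: if_splits)
lemma CC_cmult: "a \<in> CC k \<Longrightarrow> (\<lambda>n \<sigma>. s * a n \<sigma>) \<in> CC k" by (auto simp: CC_iff split: if_splits)

lemma \<delta>_add: "\<delta> k (\<lambda>n \<sigma>. a n \<sigma> + b n \<sigma>) = (\<lambda>n \<sigma>. \<delta> k a n \<sigma> + \<delta> k b n \<sigma>)"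
  by (auto simp: \<delta>_def face_sum_def distrib_left sum.distrib fun_eq_iff simp del: sum.atMost_Suc)

lemma \<delta>_cmult: "\<delta> k (\<lambda>n \<sigma>. s * a n \<sigma>) = (\<lambda>n \<sigma>. s * \<delta> k a n \<sigma>)"
  by (auto simp: \<delta>_def face_sum_def sum_distrib_left mult.left_commute fun_eq_iff simp del: sum.atMost_Suc)

lemma \<delta>_\<delta>: "\<delta> (k + 1) (\<delta> k c) = (\<lambda>n \<sigma>. 0)"
proof (cases "k < 0")
  case True
  then have "\<delta> k c = (\<lambda>n \<sigma>. 0)" by (simp add: \<delta>_def)
  moreover have "\<delta> (k + 1) (\<lambda>n \<sigma>. 0) = (\<lambda>n \<sigma>. 0)" by (auto simp: \<delta>_def face_sum_def fun_eq_iff)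
  ultimately show ?thesis by simp
next
  case False
  then have "nat (k + 1) = Suc (nat k)" "\<not> k + 1 < 0" by simp_all
  then show ?thesis using False by (simp add: \<delta>_def face_sum_face_sum[OF corner])
qed

text \<open>Taking faces commutes with \<open>simplex_map\<close>, so compatibility of the
  coboundary at a simplex reduces to compatibility of \<open>c\<close> at its faces.\<close>

lemma \<delta>_closed:
  assumes "c \<in> CC k" shows "\<delta> k c \<in> CC (k + 1)"
proof (cases "k < 0")
  case True
  then have "\<delta> k c = (\<lambda>n \<sigma>. 0)" by (simp add: \<delta>_def)
  then show ?thesis using CC_zero by simp
next
  case False
  then have nk: "nat (k + 1) = Suc (nat k)" by simp
  have c: "c (Suc n) (simplex_map (nat k) (face_incl i) \<sigma>) = c n (simplex_map (nat k) (face_proj X n i) \<sigma>)"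
    if "i \<le> Suc n" "smooth_simplex (nat k) (simplex_times n (level X (Suc n))) \<sigma>" for n i \<sigma>
    using assms that False by (simp add: CC_iff)
  have "\<delta> k c (Suc n) (simplex_map (Suc (nat k)) (face_incl i) \<sigma>) = \<delta> k c n (simplex_map (Suc (nat k)) (face_proj X n i) \<sigma>)"
    if i: "i \<le> Suc n" and \<sigma>: "smooth_simplex (Suc (nat k)) (simplex_times n (level X (Suc n))) \<sigma>" for n i \<sigma>
  proof -
    have "smooth_simplex (Suc (nat k)) (total_space X (Suc n)) (simplex_map (Suc (nat k)) (face_incl i) \<sigma>)"
      "smooth_simplex (Suc (nat k)) (total_space X n) (simplex_map (Suc (nat k)) (face_proj X n i) \<sigma>)"
      using smooth_simplex_map[OF corner corner _ \<sigma>] smooth_face_incl[OF i] smooth_face_proj[OF i] by blast+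
    moreover have "c (Suc n) (singular_face (Suc (nat k)) l (simplex_map (Suc (nat k)) (face_incl i) \<sigma>))
        = c n (singular_face (Suc (nat k)) l (simplex_map (Suc (nat k)) (face_proj X n i) \<sigma>))" if "l \<le> Suc (nat k)" for l
      using c[OF i smooth_simplex_face[OF corner \<sigma> that]] that by (simp add: face_simplex_map)
    ultimately show ?thesis using False by (simp add: \<delta>_def face_sum_def del: sum.atMost_Suc)
  qed
  then show ?thesis using False nk by (simp add: CC_iff) (simp add: \<delta>_def face_sum_def)
qed

definition \<Omega> :: "int \<Rightarrow> (nat \<Rightarrow> ((nat \<Rightarrow> real) \<times> 'a) form) set" where
  "\<Omega> k = carrier (grp (de_rham_complex X) k)"

abbreviation d :: "int \<Rightarrow> (nat \<Rightarrow> ((nat \<Rightarrow> real) \<times> 'a) form) \<Rightarrow> nat \<Rightarrow> ((nat \<Rightarrow> real) \<times> 'a) form" where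
  "d \<equiv> diff (de_rham_complex X)"

abbreviation I :: "int \<Rightarrow> (nat \<Rightarrow> ((nat \<Rightarrow> real) \<times> 'a) form) \<Rightarrow> nat \<Rightarrow> ((nat \<Rightarrow> real) \<times> 'a, complex) cochain" where
  "I \<equiv> integration_map X"

lemma \<Omega>_iff: "\<omega> \<in> \<Omega> k \<longleftrightarrow> (if k < 0 then \<omega> = (\<lambda>n p vs. 0) else \<omega> \<in> compatible_forms X (nat k))"
  by (simp add: \<Omega>_def de_rham_complex_def)

lemma d_eq: "d k \<omega> = (\<lambda>n. if k < 0 then (\<lambda>p vs. 0) else ext_deriv (total_space X n) (nat k) (\<omega> n))"
  by (simp add: de_rham_complex_def)

lemma \<Omega>_smooth: "\<omega> \<in> \<Omega> k \<Longrightarrow> 0 \<le> k \<Longrightarrow> smooth_form (total_space X n) (nat k) (\<omega> n)"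
  by (simp add: \<Omega>_iff compatible_forms_def)

lemma \<Omega>_zero: "(\<lambda>n p vs. 0) \<in> \<Omega> k"
  using smooth_form_zero[OF corner] by (auto simp: \<Omega>_iff compatible_forms_def pullback_form_def)

lemma pullback_form_add:
  "pullback_form M N k f (\<lambda>p vs. \<omega> p vs + \<eta> p vs) = (\<lambda>p vs. pullback_form M N k f \<omega> p vs + pullback_form M N k f \<eta> p vs)"
  by (auto simp: pullback_form_def fun_eq_iff)

lemma pullback_form_cmult:
  "pullback_form M N k f (\<lambda>p vs. a * \<omega> p vs) = (\<lambda>p vs. a * pullback_form M N k f \<omega> p vs)"
  by (auto simp: pullback_form_def fun_eq_iff)

lemma \<Omega>_add: "\<omega> \<in> \<Omega> k \<Longrightarrow> \<eta> \<in> \<Omega> k \<Longrightarrow> (\<lambda>n p vs. \<omega> n p vs + \<eta> n p vs) \<in> \<Omega> k"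
  by (auto simp: \<Omega>_iff compatible_forms_def pullback_form_add intro: smooth_form_add split: if_splits)

lemma \<Omega>_cmult: "\<omega> \<in> \<Omega> k \<Longrightarrow> (\<lambda>n p vs. a * \<omega> n p vs) \<in> \<Omega> k"
  by (auto simp: \<Omega>_iff compatible_forms_def pullback_form_cmult intro: smooth_form_cmult split: if_splits)

lemma d_add: "\<omega> \<in> \<Omega> k \<Longrightarrow> \<eta> \<in> \<Omega> k \<Longrightarrow> d k (\<lambda>n p vs. \<omega> n p vs + \<eta> n p vs) = (\<lambda>n p vs. d k \<omega> n p vs + d k \<eta> n p vs)"
  by (cases "k < 0") (auto simp: d_eq fun_eq_iff ext_deriv_add[OF corner \<Omega>_smooth \<Omega>_smooth])

lemma d_zero: "d k (\<lambda>n p vs. 0) = (\<lambda>n p vs. 0)"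
  using d_add[OF \<Omega>_zero \<Omega>_zero, of k] by (simp add: fun_eq_iff)

text \<open>Both values integrate the pullback along \<sigma> of one and the same form, namely the
  common pullback in the compatibility condition for \<omega>.\<close>

lemma I_closed:
  assumes "\<omega> \<in> \<Omega> k" shows "I k \<omega> \<in> CC k"
proof (cases "k < 0")
  case False
  let ?k = "nat k"
  have c: "pullback_form (simplex_times n (level X (Suc n))) (total_space X (Suc n)) ?k (face_incl i) (\<omega> (Suc n))
      = pullback_form (simplex_times n (level X (Suc n))) (total_space X n) ?k (face_proj X n i) (\<omega> n)" if "i \<le> Suc n" for n i
    using assms False that by (simp add: \<Omega>_iff compatible_forms_def)
  have "I k \<omega> (Suc n) (simplex_map ?k (face_incl i) \<sigma>) = I k \<omega> n (simplex_map ?k (face_proj X n i) \<sigma>)"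
    if i: "i \<le> Suc n" and \<sigma>: "smooth_simplex ?k (simplex_times n (level X (Suc n))) \<sigma>" for n i \<sigma>
  proof -
    have ss: "smooth_simplex ?k (total_space X (Suc n)) (simplex_map ?k (face_incl i) \<sigma>)"
      "smooth_simplex ?k (total_space X n) (simplex_map ?k (face_proj X n i) \<sigma>)"
      using smooth_simplex_map[OF corner corner _ \<sigma>] smooth_face_incl[OF i] smooth_face_proj[OF i] by blast+
    have s: "smooth_map (simplex_space ?k) (simplex_times n (level X (Suc n))) \<sigma>" using \<sigma> by (simp add: smooth_simplex_def)
    have "pullback_form (simplex_space ?k) (total_space X (Suc n)) ?k (simplex_map ?k (face_incl i) \<sigma>) (\<omega> (Suc n))
      = pullback_form (simplex_space ?k) (simplex_times n (level X (Suc n))) ?k \<sigma>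
          (pullback_form (simplex_times n (level X (Suc n))) (total_space X (Suc n)) ?k (face_incl i) (\<omega> (Suc n)))"
      by (rule pullback_form_compose[OF corner_space_simplex corner corner s smooth_face_incl[OF i]]) (simp add: simplex_map_def)
    also have "\<dots> = pullback_form (simplex_space ?k) (total_space X n) ?k (simplex_map ?k (face_proj X n i) \<sigma>) (\<omega> n)"
      unfolding c[OF i]
      by (rule pullback_form_compose[OF corner_space_simplex corner corner s smooth_face_proj[OF i], symmetric]) (simp add: simplex_map_def)
    finally show ?thesis using ss False by (simp add: integration_map_def)
  qed
  then show ?thesis using False by (simp add: CC_iff) (simp add: integration_map_def)
qed (simp add: CC_iff integration_map_def)

lemma I_add: "\<omega> \<in> \<Omega> k \<Longrightarrow> \<eta> \<in> \<Omega> k \<Longrightarrow> I k (\<lambda>n p vs. \<omega> n p vs + \<eta> n p vs) = (\<lambda>n \<sigma>. I k \<omega> n \<sigma> + I k \<eta> n \<sigma>)"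
  using integral_simplex_pullback_add[OF corner _ \<Omega>_smooth \<Omega>_smooth]
  by (auto simp: integration_map_def fun_eq_iff smooth_simplex_def)

lemma I_zero: "I k (\<lambda>n p vs. 0) = (\<lambda>n \<sigma>. 0)"
  using I_add[OF \<Omega>_zero \<Omega>_zero, of k] by (simp add: fun_eq_iff)

lemma \<delta>_I:
  assumes \<omega>: "\<omega> \<in> \<Omega> k" and cl: "d k \<omega> = (\<lambda>n p vs. 0)"
  shows "\<delta> k (I k \<omega>) = (\<lambda>n \<sigma>. 0)"
proof (cases "k < 0")
  case True then show ?thesis by (simp add: \<delta>_def)
next
  case False
  let ?k = "nat k"
  have "face_sum ?k (total_space X n) (I k \<omega> n) \<sigma> = 0" for n \<sigma>
  proof (cases "smooth_simplex (Suc ?k) (total_space X n) \<sigma>")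
    case True
    then have s: "smooth_map (simplex_space (Suc ?k)) (total_space X n) \<sigma>" by (simp add: smooth_simplex_def)
    have "ext_deriv (total_space X n) ?k (\<omega> n) = (\<lambda>p vs. 0)"
      using cl False by (simp add: d_eq fun_eq_iff)
    then have "(\<Sum>i\<le>Suc ?k. (-1) ^ i * integral_simplex ?k
        (pullback_form (simplex_space ?k) (total_space X n) ?k (singular_face (Suc ?k) i \<sigma>) (\<omega> n))) = 0"
      using \<Omega>_smooth[OF \<omega>] False by (intro stokes_singular[OF corner s]) (auto simp: singular_face_def)
    then show ?thesis
      using True False smooth_simplex_face[OF corner True]
      by (simp add: face_sum_def integration_map_def del: sum.atMost_Suc)
  qed (simp add: face_sum_def)
  then show ?thesis using False by (auto simp: \<delta>_def)
qed

end

section \<open>The isomorphism\<close>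

text \<open>The first isomorphism theorem for \<open>x \<mapsto> B1 #> \<phi> x\<close>, which is
  onto the quotient and has the preimage of \<open>B1\<close> as its kernel. It reduces an
  isomorphism of cohomology groups to a surjection of cycles under which boundaries are exactly the
  preimage of boundaries.\<close>

lemma FactGroup_preimage_iso:
  assumes H1: "comm_group H1" and H2: "comm_group H2" and \<phi>: "\<phi> \<in> hom H2 H1" "\<phi> ` carrier H2 = carrier H1"
    and B1: "subgroup B1 H1" and B2: "B2 = {x \<in> carrier H2. \<phi> x \<in> B1}"
  shows "H1 Mod B1 \<cong> H2 Mod B2"
proof -
  interpret H1: comm_group H1 by (rule H1)
  interpret H2: comm_group H2 by (rule H2)
  interpret N: normal B1 H1 by (rule H1.subgroup_imp_normal[OF B1])
  let ?\<psi> = "\<lambda>x. B1 #>\<^bsub>H1\<^esub> \<phi> x"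
  have \<phi>c: "\<phi> x \<in> carrier H1" if "x \<in> carrier H2" for x using \<phi>(2) that by blast
  have "?\<psi> \<in> hom H2 (H1 Mod B1)"
  proof (rule homI)
    show "?\<psi> x \<in> carrier (H1 Mod B1)" if "x \<in> carrier H2" for x
      using \<phi>c[OF that] by (auto simp: carrier_FactGroup)
    show "?\<psi> (x \<otimes>\<^bsub>H2\<^esub> y) = ?\<psi> x \<otimes>\<^bsub>H1 Mod B1\<^esub> ?\<psi> y" if "x \<in> carrier H2" "y \<in> carrier H2" for x y
      using N.rcos_sum[OF \<phi>c[OF that(1)] \<phi>c[OF that(2)]] hom_mult[OF \<phi>(1) that] by simp
  qed
  then interpret h: group_hom H2 "H1 Mod B1" ?\<psi>
    by (intro group_hom.intro group_hom_axioms.intro H2.group_axioms N.factorgroup_is_group)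
  have "?\<psi> ` carrier H2 = carrier (H1 Mod B1)"
    by (simp add: carrier_FactGroup \<phi>(2)[symmetric] image_image)
  moreover have "kernel H2 (H1 Mod B1) ?\<psi> = B2"
    using H1.coset_join1[OF _ _ B1] H1.coset_join2[OF _ B1] \<phi>c by (auto simp: kernel_def B2)
  ultimately have "(\<lambda>X. the_elem (?\<psi> ` X)) \<in> iso (H2 Mod B2) (H1 Mod B1)"
    using h.FactGroup_iso_set by simp
  then have "H2 Mod B2 \<cong> H1 Mod B1" by (auto simp: is_iso_def)
  moreover have "group (H2 Mod B2)"
    using \<open>kernel H2 (H1 Mod B1) ?\<psi> = B2\<close> normal.factorgroup_is_group[OF h.normal_kernel] by simp
  ultimately show ?thesis by (metis group.iso_sym)
qed

locale simplicial_manifold_coeff = simplicial_manifold X + coeff_subgroup \<Lambda>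
  for X :: "'a simplicial_space" and \<Lambda> :: "complex set"
begin

abbreviation "cochC \<equiv> cochains complex_group X"
abbreviation "cochL \<equiv> cochains sub X"
abbreviation "cochQ \<equiv> cochains quot X"

definition proj :: "(nat \<Rightarrow> ((nat \<Rightarrow> real) \<times> 'a, complex) cochain) \<Rightarrow> nat \<Rightarrow> ((nat \<Rightarrow> real) \<times> 'a, complex set) cochain" where
  "proj c = (\<lambda>n \<sigma>. coset (c n \<sigma>))"

lemma proj_eq: "proj a = proj b \<longleftrightarrow> (\<forall>n \<sigma>. a n \<sigma> - b n \<sigma> \<in> \<Lambda>)"
  by (simp add: proj_def fun_eq_iff coset_eq)

lemma grpC [simp]: "carrier (grp cochC k) = CC k" "a \<otimes>\<^bsub>grp cochC k\<^esub> b = (\<lambda>n \<sigma>. a n \<sigma> + b n \<sigma>)" "\<one>\<^bsub>grp cochC k\<^esub> = (\<lambda>n \<sigma>. 0)"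
  by (simp_all add: CC_def) (simp_all add: cochains_def)

lemma grpL: "carrier (grp cochL k) = {c \<in> CC k. \<forall>n \<sigma>. c n \<sigma> \<in> \<Lambda>}"
proof -
  have "c \<in> carrier (grp cochL k) \<longleftrightarrow> c \<in> CC k \<and> (\<forall>n \<sigma>. c n \<sigma> \<in> \<Lambda>)" for c
  proof (cases "k < 0")
    case True then show ?thesis using zero by (auto simp: CC_iff cochains_def)
  next
    case False
    have "smooth_cochain sub (nat k) (total_space X n) (c n) \<longleftrightarrow>
       smooth_cochain complex_group (nat k) (total_space X n) (c n) \<and> (\<forall>\<sigma>. c n \<sigma> \<in> \<Lambda>)" for n
      using zero unfolding smooth_cochain_def by (auto split: if_splits) metis
    then show ?thesis using False by (auto simp: CC_def cochains_def compatible_cochains_iff)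
  qed
  then show ?thesis by blast
qed

lemma grpL_ops [simp]: "a \<otimes>\<^bsub>grp cochL k\<^esub> b = (\<lambda>n \<sigma>. a n \<sigma> + b n \<sigma>)" "\<one>\<^bsub>grp cochL k\<^esub> = (\<lambda>n \<sigma>. 0)"
  by (simp_all add: cochains_def)

lemma diffL: "c \<in> carrier (grp cochL k) \<Longrightarrow> diff cochL k c = \<delta> k c"
  unfolding grpL by (auto simp: cochains_def \<delta>_def coboundary_sub)

text \<open>The first equation says that reduction of compatible cochains modulo \<Lambda> is onto.
  It allows every cochain with values in the quotient to be handled through a complex
  representative.\<close>

lemma grpQ [simp]: "carrier (grp cochQ k) = proj ` CC k" "proj a \<otimes>\<^bsub>grp cochQ k\<^esub> proj b = proj (\<lambda>n \<sigma>. a n \<sigma> + b n \<sigma>)"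
  "\<one>\<^bsub>grp cochQ k\<^esub> = proj (\<lambda>n \<sigma>. 0)"
proof -
  show "proj a \<otimes>\<^bsub>grp cochQ k\<^esub> proj b = proj (\<lambda>n \<sigma>. a n \<sigma> + b n \<sigma>)" "\<one>\<^bsub>grp cochQ k\<^esub> = proj (\<lambda>n \<sigma>. 0)"
    by (simp_all add: cochains_def proj_def)
  show "carrier (grp cochQ k) = proj ` CC k"
  proof (cases "k < 0")
    case True
    then have "CC k = {\<lambda>n \<sigma>. 0}" by (auto simp: CC_iff)
    then show ?thesis using True by (simp add: cochains_def proj_def)
  next
    case False
    show ?thesis
    proof (intro equalityI subsetI)
      fix c assume "c \<in> carrier (grp cochQ k)"
      then have c: "c \<in> compatible_cochains quot X (nat k)" using False by (simp add: cochains_def)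
      have r: "c n \<sigma> \<in> range coset" for n \<sigma>
        using c unfolding compatible_cochains_iff smooth_cochain_def by (metis quot_simps(1,2) rangeI)
      \<comment> \<open>Lifting every value by the fixed section preserves the compatibility
        equations, because equal cosets receive equal representatives.\<close>
      have "c = proj (\<lambda>n \<sigma>. coset_rep (c n \<sigma>))" using coset_coset_rep[OF r] by (simp add: proj_def)
      moreover have "(\<lambda>n \<sigma>. coset_rep (c n \<sigma>)) \<in> CC k"
        using c False unfolding compatible_cochains_iff smooth_cochain_def CC_iff by auto
      ultimately show "c \<in> proj ` CC k" by blast
    next
      fix c assume "c \<in> proj ` CC k"
      then obtain b where b: "b \<in> CC k" "c = proj b" by blast
      then show "c \<in> carrier (grp cochQ k)"
        using False unfolding CC_iff by (simp add: cochains_def compatible_cochains_iff smooth_cochain_def proj_def)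
    qed
  qed
qed

lemma diffQ [simp]: "diff cochQ k (proj c) = proj (\<delta> k c)"
  by (auto simp: cochains_def proj_def \<delta>_def coboundary_quot)

lemma reduce_mod_proj: "reduce_mod \<Lambda> c = proj c"
  by (simp add: reduce_mod_def proj_def coset_def)

lemma grp\<Omega> [simp]: "carrier (grp (de_rham_complex X) k) = \<Omega> k"
  "\<omega> \<otimes>\<^bsub>grp (de_rham_complex X) k\<^esub> \<eta> = (\<lambda>n p vs. \<omega> n p vs + \<eta> n p vs)" "\<one>\<^bsub>grp (de_rham_complex X) k\<^esub> = (\<lambda>n p vs. 0)"
  by (simp_all add: \<Omega>_def) (simp_all add: de_rham_complex_def)

lemma CC_neg: "a \<in> CC k \<Longrightarrow> (\<lambda>n \<sigma>. - a n \<sigma>) \<in> CC k" using CC_cmult[of a k "-1"] by simp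
lemma CC_diff: "a \<in> CC k \<Longrightarrow> b \<in> CC k \<Longrightarrow> (\<lambda>n \<sigma>. a n \<sigma> - b n \<sigma>) \<in> CC k" using CC_add[of a k "\<lambda>n \<sigma>. - b n \<sigma>"] CC_neg by simp
lemma \<Omega>_neg: "\<omega> \<in> \<Omega> k \<Longrightarrow> (\<lambda>n p vs. - \<omega> n p vs) \<in> \<Omega> k" using \<Omega>_cmult[of \<omega> k "-1"] by simp
lemma \<delta>_neg: "\<delta> k (\<lambda>n \<sigma>. - a n \<sigma>) = (\<lambda>n \<sigma>. - \<delta> k a n \<sigma>)" using \<delta>_cmult[of k "-1" a] by simp
lemma \<delta>_zero: "\<delta> k (\<lambda>n \<sigma>. 0) = (\<lambda>n \<sigma>. 0)" using \<delta>_cmult[of k 0] by simp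
lemma \<delta>_\<delta>': "\<delta> k (\<delta> (k - 1) c) = (\<lambda>n \<sigma>. 0)" using \<delta>_\<delta>[of "k - 1" c] by simp
lemma \<delta>_closed': "c \<in> CC (k - 1) \<Longrightarrow> \<delta> (k - 1) c \<in> CC k" using \<delta>_closed[of c "k - 1"] by simp

lemma \<delta>_\<delta>'': "\<delta> (k - 1) (\<delta> (k - 2) c) = (\<lambda>n \<sigma>. 0)" using \<delta>_\<delta>[of "k - 2" c] by simp
lemma \<delta>_closed'': "c \<in> CC (k - 2) \<Longrightarrow> \<delta> (k - 2) c \<in> CC (k - 1)" using \<delta>_closed[of c "k - 2"] by simp

lemma d_neg: assumes "\<omega> \<in> \<Omega> k" shows "d k (\<lambda>n p vs. - \<omega> n p vs) = (\<lambda>n p vs. - d k \<omega> n p vs)"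
  using d_add[OF assms \<Omega>_neg[OF assms]] d_zero[of k] by (simp add: fun_eq_iff add_eq_0_iff)

lemma I_neg: assumes "\<omega> \<in> \<Omega> k" shows "I k (\<lambda>n p vs. - \<omega> n p vs) = (\<lambda>n \<sigma>. - I k \<omega> n \<sigma>)"
  using I_add[OF assms \<Omega>_neg[OF assms]] I_zero[of k] by (simp add: fun_eq_iff add_eq_0_iff)

lemma group_C: "group (grp cochC k)"
proof (rule groupI)
  fix x assume "x \<in> carrier (grp cochC k)"
  then show "\<exists>y\<in>carrier (grp cochC k). y \<otimes>\<^bsub>grp cochC k\<^esub> x = \<one>\<^bsub>grp cochC k\<^esub>"
    using CC_neg by (intro bexI[of _ "\<lambda>n \<sigma>. - x n \<sigma>"]) auto
qed (auto simp: CC_add CC_zero add.assoc)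

lemma inv_C: "x \<in> CC k \<Longrightarrow> inv\<^bsub>grp cochC k\<^esub> x = (\<lambda>n \<sigma>. - x n \<sigma>)"
  by (rule group.inv_equality[OF group_C]) (auto simp: CC_neg)

lemma group_Q: "group (grp cochQ k)"
proof (rule groupI)
  fix x assume "x \<in> carrier (grp cochQ k)"
  then obtain a where "a \<in> CC k" "x = proj a" by auto
  then show "\<exists>y\<in>carrier (grp cochQ k). y \<otimes>\<^bsub>grp cochQ k\<^esub> x = \<one>\<^bsub>grp cochQ k\<^esub>"
    using CC_neg by (intro bexI[of _ "proj (\<lambda>n \<sigma>. - a n \<sigma>)"]) auto
qed (auto simp: CC_add CC_zero add.assoc)

lemma inv_Q: "x \<in> CC k \<Longrightarrow> inv\<^bsub>grp cochQ k\<^esub> (proj x) = proj (\<lambda>n \<sigma>. - x n \<sigma>)"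
  by (rule group.inv_equality[OF group_Q]) (auto simp: CC_neg)

text \<open>Turns the conditional inverse in the cone differential into multiplication by a scalar,
  so that the linearity rules for \<open>CC\<close> and \<delta> apply to it.\<close>

definition cone_sign :: "int \<Rightarrow> complex" where "cone_sign k = (if even k then 1 else - 1)"

lemma cone_sign_simps: "cone_sign k * cone_sign k = 1" "cone_sign (k + 1) = - cone_sign k" "cone_sign k * (cone_sign k * x) = x"
  by (auto simp: cone_sign_def)

lemma cone_sign_mem: "cone_sign k * x \<in> \<Lambda> \<longleftrightarrow> x \<in> \<Lambda>" using neg_iff by (auto simp: cone_sign_def)

section \<open>The two cones, their cycles and boundaries\<close>

definition "coneQ r = mapping_cone (truncation r (de_rham_complex X)) cochQ (\<lambda>k \<omega>. reduce_mod \<Lambda> (I k \<omega>))"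

definition "coneC r = mapping_cone (direct_sum cochL (truncation r (de_rham_complex X))) cochC
    (\<lambda>k (c, \<omega>) m \<sigma>. c m \<sigma> - I k \<omega> m \<sigma>)"

lemma diff_coneQ:
  assumes "\<omega> \<in> \<Omega> k"
  shows "diff (coneQ r) k (\<omega>, proj b) = (d k \<omega>, proj (\<lambda>n \<sigma>. cone_sign (k + 1) * I k \<omega> n \<sigma> + \<delta> (k - 1) b n \<sigma>))"
  using I_closed[OF assms] by (auto simp: coneQ_def mapping_cone_def truncation_def reduce_mod_proj inv_Q cone_sign_def)

lemma diff_coneC:
  assumes "c \<in> carrier (grp cochL k)" "\<omega> \<in> \<Omega> k"
  shows "diff (coneC r) k ((c, \<omega>), b) = ((\<delta> k c, d k \<omega>), (\<lambda>n \<sigma>. cone_sign (k + 1) * (c n \<sigma> - I k \<omega> n \<sigma>) + \<delta> (k - 1) b n \<sigma>))"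
proof -
  have "(\<lambda>n \<sigma>. c n \<sigma> - I k \<omega> n \<sigma>) \<in> CC k" using assms I_closed by (auto simp: grpL intro: CC_diff)
  then show ?thesis
    using diffL[OF assms(1)]
    by (auto simp: coneC_def mapping_cone_def truncation_def direct_sum_def inv_C cone_sign_def diff_complex fun_eq_iff)
qed

lemma carrier_coneQ: "carrier (grp (coneQ r) r) = \<Omega> r \<times> proj ` CC (r - 1)"
  "carrier (grp (coneQ r) (r - 1)) = {\<lambda>n p vs. 0} \<times> proj ` CC (r - 2)"
  by (simp_all add: coneQ_def mapping_cone_def truncation_def)

lemma carrier_coneC: "carrier (grp (coneC r) r) = (carrier (grp cochL r) \<times> \<Omega> r) \<times> CC (r - 1)"
  "carrier (grp (coneC r) (r - 1)) = (carrier (grp cochL (r - 1)) \<times> {\<lambda>n p vs. 0}) \<times> CC (r - 2)"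
  by (simp_all add: coneC_def mapping_cone_def truncation_def direct_sum_def)

lemma ops_coneQ:
  "(\<omega>, proj b) \<otimes>\<^bsub>grp (coneQ r) r\<^esub> (\<omega>', proj b') = ((\<lambda>n p vs. \<omega> n p vs + \<omega>' n p vs), proj (\<lambda>n \<sigma>. b n \<sigma> + b' n \<sigma>))"
  "\<one>\<^bsub>grp (coneQ r) r\<^esub> = ((\<lambda>n p vs. 0), proj (\<lambda>n \<sigma>. 0))"
  "\<one>\<^bsub>grp (coneQ r) (r + 1)\<^esub> = ((\<lambda>n p vs. 0), proj (\<lambda>n \<sigma>. 0))"
  by (simp_all add: coneQ_def mapping_cone_def truncation_def)

lemma ops_coneC:
  "((c, \<omega>), b) \<otimes>\<^bsub>grp (coneC r) r\<^esub> ((c', \<omega>'), b')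
     = (((\<lambda>n \<sigma>. c n \<sigma> + c' n \<sigma>), (\<lambda>n p vs. \<omega> n p vs + \<omega>' n p vs)), (\<lambda>n \<sigma>. b n \<sigma> + b' n \<sigma>))"
  "\<one>\<^bsub>grp (coneC r) r\<^esub> = (((\<lambda>n \<sigma>. 0), (\<lambda>n p vs. 0)), (\<lambda>n \<sigma>. 0))"
  "\<one>\<^bsub>grp (coneC r) (r + 1)\<^esub> = (((\<lambda>n \<sigma>. 0), (\<lambda>n p vs. 0)), (\<lambda>n \<sigma>. 0))"
  by (simp_all add: coneC_def mapping_cone_def truncation_def direct_sum_def)

definition "cyclesQ r = kernel (grp (coneQ r) r) (grp (coneQ r) (r + 1)) (diff (coneQ r) r)"
definition "cyclesC r = kernel (grp (coneC r) r) (grp (coneC r) (r + 1)) (diff (coneC r) r)"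
definition "boundariesQ r = diff (coneQ r) (r - 1) ` carrier (grp (coneQ r) (r - 1))"
definition "boundariesC r = diff (coneC r) (r - 1) ` carrier (grp (coneC r) (r - 1))"

lemma cyclesQ_iff:
  assumes "\<omega> \<in> \<Omega> r" "b \<in> CC (r - 1)"
  shows "(\<omega>, proj b) \<in> cyclesQ r \<longleftrightarrow> d r \<omega> = (\<lambda>n p vs. 0) \<and> (\<forall>n \<sigma>. cone_sign (r + 1) * I r \<omega> n \<sigma> + \<delta> (r - 1) b n \<sigma> \<in> \<Lambda>)"
  using assms by (simp add: cyclesQ_def kernel_def carrier_coneQ diff_coneQ ops_coneQ proj_eq imageI)

lemma cyclesQE:
  assumes "x \<in> cyclesQ r"
  obtains \<omega> b where "x = (\<omega>, proj b)" "\<omega> \<in> \<Omega> r" "b \<in> CC (r - 1)"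
  using assms by (auto simp: cyclesQ_def kernel_def carrier_coneQ)

lemma cyclesC_iff:
  "((c, \<omega>), b) \<in> cyclesC r \<longleftrightarrow> c \<in> CC r \<and> (\<forall>n \<sigma>. c n \<sigma> \<in> \<Lambda>) \<and> \<omega> \<in> \<Omega> r \<and> b \<in> CC (r - 1) \<and>
     \<delta> r c = (\<lambda>n \<sigma>. 0) \<and> d r \<omega> = (\<lambda>n p vs. 0) \<and>
     (\<forall>n \<sigma>. cone_sign (r + 1) * (c n \<sigma> - I r \<omega> n \<sigma>) + \<delta> (r - 1) b n \<sigma> = 0)"
proof (cases "c \<in> carrier (grp cochL r) \<and> \<omega> \<in> \<Omega> r \<and> b \<in> CC (r - 1)")
  case True
  then show ?thesis
    using diff_coneC[of c r \<omega> r b] by (auto simp: cyclesC_def kernel_def carrier_coneC ops_coneC grpL fun_eq_iff)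
next
  case False
  then show ?thesis by (auto simp: cyclesC_def kernel_def carrier_coneC grpL)
qed

lemma boundariesQ_eq: "boundariesQ r = {((\<lambda>n p vs. 0), proj (\<delta> (r - 2) g)) |g. g \<in> CC (r - 2)}"
  unfolding boundariesQ_def carrier_coneQ
  by (auto simp: diff_coneQ[OF \<Omega>_zero] d_zero I_zero image_iff)

lemma boundariesC_eq: "boundariesC r = {((\<delta> (r - 1) c, (\<lambda>n p vs. 0)), (\<lambda>n \<sigma>. cone_sign r * c n \<sigma> + \<delta> (r - 2) g n \<sigma>)) |c g.
    c \<in> CC (r - 1) \<and> (\<forall>n \<sigma>. c n \<sigma> \<in> \<Lambda>) \<and> g \<in> CC (r - 2)}"
  (is "_ = ?R")
proof -
  have D: "diff (coneC r) (r - 1) ((c, (\<lambda>n p vs. 0)), g)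
     = ((\<delta> (r - 1) c, (\<lambda>n p vs. 0)), (\<lambda>n \<sigma>. cone_sign r * c n \<sigma> + \<delta> (r - 2) g n \<sigma>))"
    if "c \<in> carrier (grp cochL (r - 1))" for c g
    using diff_coneC[OF that \<Omega>_zero, of r g] by (simp add: d_zero I_zero)
  show ?thesis
  proof (intro equalityI subsetI)
    fix x assume "x \<in> boundariesC r"
    then obtain c g where "c \<in> carrier (grp cochL (r - 1))" "g \<in> CC (r - 2)"
      "x = diff (coneC r) (r - 1) ((c, (\<lambda>n p vs. 0)), g)"
      unfolding boundariesC_def carrier_coneC by auto
    then show "x \<in> ?R" using D by (auto simp: grpL)
  next
    fix x assume "x \<in> ?R"
    then obtain c g where "c \<in> carrier (grp cochL (r - 1))" "g \<in> CC (r - 2)"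
      "x = ((\<delta> (r - 1) c, (\<lambda>n p vs. 0)), (\<lambda>n \<sigma>. cone_sign r * c n \<sigma> + \<delta> (r - 2) g n \<sigma>))"
      by (auto simp: grpL)
    then show "x \<in> boundariesC r"
      unfolding boundariesC_def carrier_coneC by (intro image_eqI[of _ _ "((c, (\<lambda>n p vs. 0)), g)"]) (auto simp: D)
  qed
qed

lemma cyclesQ_mult:
  assumes "x \<in> cyclesQ r" "y \<in> cyclesQ r" shows "x \<otimes>\<^bsub>grp (coneQ r) r\<^esub> y \<in> cyclesQ r"
proof -
  obtain \<omega> b where x: "x = (\<omega>, proj b)" "\<omega> \<in> \<Omega> r" "b \<in> CC (r - 1)" using assms(1) by (rule cyclesQE)
  obtain \<eta> c where y: "y = (\<eta>, proj c)" "\<eta> \<in> \<Omega> r" "c \<in> CC (r - 1)" using assms(2) by (rule cyclesQE)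
  have "cone_sign (r + 1) * (I r \<omega> n \<sigma> + I r \<eta> n \<sigma>) + (\<delta> (r - 1) b n \<sigma> + \<delta> (r - 1) c n \<sigma>) \<in> \<Lambda>" for n \<sigma>
    using add[of "cone_sign (r + 1) * I r \<omega> n \<sigma> + \<delta> (r - 1) b n \<sigma>" "cone_sign (r + 1) * I r \<eta> n \<sigma> + \<delta> (r - 1) c n \<sigma>"]
      assms x y cyclesQ_iff by (simp add: algebra_simps)
  then show ?thesis
    using assms x y cyclesQ_iff by (simp add: ops_coneQ cyclesQ_iff \<Omega>_add CC_add d_add I_add \<delta>_add)
qed

lemma cyclesQ_neg:
  assumes "(\<omega>, proj b) \<in> cyclesQ r" "\<omega> \<in> \<Omega> r" "b \<in> CC (r - 1)"
  shows "((\<lambda>n p vs. - \<omega> n p vs), proj (\<lambda>n \<sigma>. - b n \<sigma>)) \<in> cyclesQ r"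
proof -
  have "- (cone_sign (r + 1) * I r \<omega> n \<sigma>) - \<delta> (r - 1) b n \<sigma> \<in> \<Lambda>" for n \<sigma>
    using neg[of "cone_sign (r + 1) * I r \<omega> n \<sigma> + \<delta> (r - 1) b n \<sigma>"] assms cyclesQ_iff by simp
  then show ?thesis
    using assms cyclesQ_iff by (simp add: cyclesQ_iff \<Omega>_neg CC_neg d_neg I_neg \<delta>_neg)
qed

lemma comm_group_cyclesQ: "comm_group ((grp (coneQ r) r)\<lparr>carrier := cyclesQ r\<rparr>)" (is "comm_group ?H")
proof (rule comm_groupI)
  show "x \<otimes>\<^bsub>?H\<^esub> y \<in> carrier ?H" if "x \<in> carrier ?H" "y \<in> carrier ?H" for x y
    using that cyclesQ_mult by simp
  show "\<one>\<^bsub>?H\<^esub> \<in> carrier ?H"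
    using cyclesQ_iff[OF \<Omega>_zero CC_zero] zero by (simp add: ops_coneQ d_zero I_zero \<delta>_zero)
  show "x \<otimes>\<^bsub>?H\<^esub> y \<otimes>\<^bsub>?H\<^esub> z = x \<otimes>\<^bsub>?H\<^esub> (y \<otimes>\<^bsub>?H\<^esub> z)" if "x \<in> carrier ?H" "y \<in> carrier ?H" "z \<in> carrier ?H" for x y z
    using that by (auto elim!: cyclesQE simp: ops_coneQ add.assoc)
  show "x \<otimes>\<^bsub>?H\<^esub> y = y \<otimes>\<^bsub>?H\<^esub> x" if "x \<in> carrier ?H" "y \<in> carrier ?H" for x y
    using that by (auto elim!: cyclesQE simp: ops_coneQ add.commute)
  show "\<one>\<^bsub>?H\<^esub> \<otimes>\<^bsub>?H\<^esub> x = x" if "x \<in> carrier ?H" for x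
    using that by (auto elim!: cyclesQE simp: ops_coneQ)
  fix x assume x: "x \<in> carrier ?H"
  then obtain \<omega> b where "x = (\<omega>, proj b)" "\<omega> \<in> \<Omega> r" "b \<in> CC (r - 1)" by (auto elim!: cyclesQE)
  then show "\<exists>y\<in>carrier ?H. y \<otimes>\<^bsub>?H\<^esub> x = \<one>\<^bsub>?H\<^esub>"
    using x cyclesQ_neg by (intro bexI[of _ "((\<lambda>n p vs. - \<omega> n p vs), proj (\<lambda>n \<sigma>. - b n \<sigma>))"]) (auto simp: ops_coneQ)
qed

lemma comm_group_cyclesC: "comm_group ((grp (coneC r) r)\<lparr>carrier := cyclesC r\<rparr>)" (is "comm_group ?H")
proof (rule comm_groupI)
  show "x \<otimes>\<^bsub>?H\<^esub> y \<in> carrier ?H" if xy: "x \<in> carrier ?H" "y \<in> carrier ?H" for x y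
  proof -
    obtain c \<omega> b c' \<omega>' b' where e: "x = ((c, \<omega>), b)" "y = ((c', \<omega>'), b')" by (metis surj_pair)
    have "cone_sign (r + 1) * (c n \<sigma> - I r \<omega> n \<sigma>) + \<delta> (r - 1) b n \<sigma> = 0"
      "cone_sign (r + 1) * (c' n \<sigma> - I r \<omega>' n \<sigma>) + \<delta> (r - 1) b' n \<sigma> = 0" for n \<sigma>
      using xy unfolding e by (simp_all add: cyclesC_iff)
    moreover have "cone_sign (r + 1) * ((c n \<sigma> + c' n \<sigma>) - (I r \<omega> n \<sigma> + I r \<omega>' n \<sigma>)) + (\<delta> (r - 1) b n \<sigma> + \<delta> (r - 1) b' n \<sigma>)
      = (cone_sign (r + 1) * (c n \<sigma> - I r \<omega> n \<sigma>) + \<delta> (r - 1) b n \<sigma>) + (cone_sign (r + 1) * (c' n \<sigma> - I r \<omega>' n \<sigma>) + \<delta> (r - 1) b' n \<sigma>)" for n \<sigma>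
      by (simp add: algebra_simps)
    ultimately have "cone_sign (r + 1) * ((c n \<sigma> + c' n \<sigma>) - (I r \<omega> n \<sigma> + I r \<omega>' n \<sigma>)) + (\<delta> (r - 1) b n \<sigma> + \<delta> (r - 1) b' n \<sigma>) = 0" for n \<sigma>
      by (simp only: add_0_left)
    then show ?thesis
      using xy unfolding e by (simp add: ops_coneC cyclesC_iff \<Omega>_add CC_add d_add I_add \<delta>_add add)
  qed
  show "\<one>\<^bsub>?H\<^esub> \<in> carrier ?H"
    by (simp add: ops_coneC cyclesC_iff zero CC_zero \<Omega>_zero d_zero I_zero \<delta>_zero)
  show "x \<otimes>\<^bsub>?H\<^esub> y \<otimes>\<^bsub>?H\<^esub> z = x \<otimes>\<^bsub>?H\<^esub> (y \<otimes>\<^bsub>?H\<^esub> z)" for x y z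
    by (cases x; cases "fst x"; cases y; cases "fst y"; cases z; cases "fst z") (simp add: ops_coneC add.assoc)
  show "x \<otimes>\<^bsub>?H\<^esub> y = y \<otimes>\<^bsub>?H\<^esub> x" for x y
    by (cases x; cases "fst x"; cases y; cases "fst y") (simp add: ops_coneC add.commute)
  show "\<one>\<^bsub>?H\<^esub> \<otimes>\<^bsub>?H\<^esub> x = x" for x
    by (cases x; cases "fst x") (simp add: ops_coneC)
  fix x assume x: "x \<in> carrier ?H"
  obtain c \<omega> b where e: "x = ((c, \<omega>), b)" by (metis surj_pair)
  let ?y = "(((\<lambda>n \<sigma>. - c n \<sigma>), (\<lambda>n p vs. - \<omega> n p vs)), (\<lambda>n \<sigma>. - b n \<sigma>))"
  have "cone_sign (r + 1) * (c n \<sigma> - I r \<omega> n \<sigma>) + \<delta> (r - 1) b n \<sigma> = 0" for n \<sigma>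
    using x unfolding e by (simp add: cyclesC_iff)
  moreover have "cone_sign (r + 1) * (I r \<omega> n \<sigma> - c n \<sigma>) - \<delta> (r - 1) b n \<sigma>
      = - (cone_sign (r + 1) * (c n \<sigma> - I r \<omega> n \<sigma>) + \<delta> (r - 1) b n \<sigma>)" for n \<sigma>
    by (simp add: algebra_simps)
  ultimately have "cone_sign (r + 1) * (I r \<omega> n \<sigma> - c n \<sigma>) - \<delta> (r - 1) b n \<sigma> = 0" for n \<sigma>
    by (simp only: minus_zero)
  then have "?y \<in> carrier ?H"
    using x unfolding e by (simp add: cyclesC_iff \<Omega>_neg CC_neg d_neg I_neg \<delta>_neg neg)
  then show "\<exists>y\<in>carrier ?H. y \<otimes>\<^bsub>?H\<^esub> x = \<one>\<^bsub>?H\<^esub>"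
    by (rule bexI[rotated]) (simp add: e ops_coneC)
qed

text \<open>A cycle satisfies \<open>s * (c - I \<omega>) + \<delta> b = 0\<close> with
  \<open>s\<close> the cone sign. Hence \<open>s * I \<omega> + \<delta> (- b) = s * c\<close>,
  which is \<Lambda>-valued, and this is the cycle condition of the other cone for
  \<open>- b\<close>.\<close>

definition comparison ::
    "((nat \<Rightarrow> ((nat \<Rightarrow> real) \<times> 'a, complex) cochain) \<times> (nat \<Rightarrow> ((nat \<Rightarrow> real) \<times> 'a) form)) \<times> (nat \<Rightarrow> ((nat \<Rightarrow> real) \<times> 'a, complex) cochain)
      \<Rightarrow> (nat \<Rightarrow> ((nat \<Rightarrow> real) \<times> 'a) form) \<times> (nat \<Rightarrow> ((nat \<Rightarrow> real) \<times> 'a, complex set) cochain)" where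
  "comparison = (\<lambda>((c, \<omega>), b). (\<omega>, proj (\<lambda>n \<sigma>. - b n \<sigma>)))"

lemma comparison_surj: "comparison ` cyclesC r = cyclesQ r"
proof (intro equalityI subsetI)
  fix y assume "y \<in> comparison ` cyclesC r"
  then obtain c \<omega> b where x: "((c, \<omega>), b) \<in> cyclesC r" "y = (\<omega>, proj (\<lambda>n \<sigma>. - b n \<sigma>))"
    by (auto simp: comparison_def)
  have e: "cone_sign (r + 1) * I r \<omega> n \<sigma> - \<delta> (r - 1) b n \<sigma> = cone_sign (r + 1) * c n \<sigma>" for n \<sigma>
    using x(1) unfolding cyclesC_iff by (simp add: algebra_simps add_eq_0_iff)
  show "y \<in> cyclesQ r"
    unfolding x(2) using x(1) e by (subst cyclesQ_iff) (auto simp: cyclesC_iff CC_neg \<delta>_neg cone_sign_mem)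
next
  fix y assume y: "y \<in> cyclesQ r"
  then obtain \<omega> b where yb: "y = (\<omega>, proj b)" "\<omega> \<in> \<Omega> r" "b \<in> CC (r - 1)" by (rule cyclesQE)
  then have cl: "d r \<omega> = (\<lambda>n p vs. 0)" and m: "\<And>n \<sigma>. cone_sign (r + 1) * I r \<omega> n \<sigma> + \<delta> (r - 1) b n \<sigma> \<in> \<Lambda>"
    using y cyclesQ_iff by auto
  \<comment> \<open>The cycle equation solved for \<open>c\<close>, using that the sign squares to
    \<open>1\<close>; the last component of the preimage is the negative of the lift
    \<open>b\<close>.\<close>
  define c where "c = (\<lambda>n \<sigma>. I r \<omega> n \<sigma> + cone_sign (r + 1) * \<delta> (r - 1) b n \<sigma>)"
  have "c n \<sigma> = cone_sign (r + 1) * (cone_sign (r + 1) * I r \<omega> n \<sigma> + \<delta> (r - 1) b n \<sigma>)" for n \<sigma>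
    by (simp add: c_def distrib_left cone_sign_simps(3))
  then have "c n \<sigma> \<in> \<Lambda>" for n \<sigma> using m by (simp add: cone_sign_mem)
  moreover have "c \<in> CC r"
    unfolding c_def by (intro CC_add CC_cmult I_closed \<delta>_closed' yb)
  moreover have "\<delta> r c = (\<lambda>n \<sigma>. 0)"
    unfolding c_def by (simp add: \<delta>_add \<delta>_cmult \<delta>_\<delta>' \<delta>_I[OF yb(2) cl])
  moreover have "cone_sign (r + 1) * (c n \<sigma> - I r \<omega> n \<sigma>) - \<delta> (r - 1) b n \<sigma> = 0" for n \<sigma>
    by (simp add: c_def cone_sign_simps(3))
  ultimately have "((c, \<omega>), (\<lambda>n \<sigma>. - b n \<sigma>)) \<in> cyclesC r"
    using yb cl by (simp add: cyclesC_iff CC_neg \<delta>_neg)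
  moreover have "comparison ((c, \<omega>), (\<lambda>n \<sigma>. - b n \<sigma>)) = y" by (simp add: comparison_def yb)
  ultimately show "y \<in> comparison ` cyclesC r" by force
qed

text \<open>From left to right, the \<Lambda>-valued part of \<open>b\<close> dies in the quotient.
  Conversely, if the image is a boundary, then \<omega> is \<open>0\<close> and \<open>b\<close> is
  a \<Lambda>-valued cochain \<open>l\<close> up to a coboundary; the cycle equation then forces
  \<open>c\<close> to be the coboundary of \<open>l\<close> up to sign.\<close>

lemma boundaries_comparison: "boundariesC r = {x \<in> cyclesC r. comparison x \<in> boundariesQ r}"
proof (intro equalityI subsetI)
  fix x assume "x \<in> boundariesC r"
  then obtain c g where x: "x = ((\<delta> (r - 1) c, (\<lambda>n p vs. 0)), (\<lambda>n \<sigma>. cone_sign r * c n \<sigma> + \<delta> (r - 2) g n \<sigma>))"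
    and c: "c \<in> CC (r - 1)" "\<And>n \<sigma>. c n \<sigma> \<in> \<Lambda>" and g: "g \<in> CC (r - 2)"
    unfolding boundariesC_eq by auto
  have "\<delta> (r - 1) c n \<sigma> \<in> \<Lambda>" for n \<sigma>
  proof -
    have "(\<Sum>i\<in>A. (-1) ^ i * c n (f i)) \<in> \<Lambda>" for A :: "nat set" and f
      by (induction A rule: infinite_finite_induct) (auto intro: zero add sign c(2))
    then show ?thesis by (simp add: \<delta>_def face_sum_def zero del: sum.atMost_Suc)
  qed
  then have "x \<in> cyclesC r"
    unfolding x cyclesC_iff using c(1) g
    by (simp add: \<delta>_closed' \<delta>_closed'' \<Omega>_zero CC_add CC_cmult d_zero I_zero \<delta>_add \<delta>_cmult \<delta>_\<delta>' \<delta>_\<delta>'' cone_sign_simps(2))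
  moreover have "comparison x = ((\<lambda>n p vs. 0), proj (\<delta> (r - 2) (\<lambda>n \<sigma>. - g n \<sigma>)))"
    unfolding x comparison_def using neg_iff[of "cone_sign r * c _ _"] c(2) by (simp add: proj_eq \<delta>_neg cone_sign_mem)
  ultimately show "x \<in> {x \<in> cyclesC r. comparison x \<in> boundariesQ r}"
    using CC_neg[OF g] by (auto simp: boundariesQ_eq)
next
  fix x assume "x \<in> {x \<in> cyclesC r. comparison x \<in> boundariesQ r}"
  then have x: "x \<in> cyclesC r" "comparison x \<in> boundariesQ r" by auto
  obtain c \<omega> b where e: "x = ((c, \<omega>), b)" by (metis surj_pair)
  obtain g where g: "g \<in> CC (r - 2)" "\<omega> = (\<lambda>n p vs. 0)" "proj (\<lambda>n \<sigma>. - b n \<sigma>) = proj (\<delta> (r - 2) g)"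
    using x(2) by (auto simp: e comparison_def boundariesQ_eq)
  have b: "b \<in> CC (r - 1)" and cb: "\<And>n \<sigma>. cone_sign (r + 1) * c n \<sigma> + \<delta> (r - 1) b n \<sigma> = 0"
    using x(1) unfolding e cyclesC_iff by (auto simp: g(2) I_zero)
  \<comment> \<open>By \<open>g(3)\<close> the cochains \<open>- b\<close> and
    \<open>\<delta> (r - 2) g\<close> agree modulo \<Lambda>; \<open>l\<close> is minus their
    difference.\<close>
  define l where "l = (\<lambda>n \<sigma>. b n \<sigma> + \<delta> (r - 2) g n \<sigma>)"
  have "- b n \<sigma> - \<delta> (r - 2) g n \<sigma> \<in> \<Lambda>" for n \<sigma> using g(3) by (simp add: proj_eq)
  then have l\<Lambda>: "l n \<sigma> \<in> \<Lambda>" for n \<sigma> using neg_iff[of "l n \<sigma>"] by (simp add: l_def)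
  have lC: "l \<in> CC (r - 1)" unfolding l_def by (intro CC_add b \<delta>_closed'' g)
  have "\<delta> (r - 1) l n \<sigma> = \<delta> (r - 1) b n \<sigma>" for n \<sigma>
    unfolding l_def by (simp add: \<delta>_add \<delta>_\<delta>'')
  then have "c n \<sigma> = cone_sign r * \<delta> (r - 1) l n \<sigma>" for n \<sigma>
    using cb[of n \<sigma>] by (simp add: cone_sign_simps(2)) (simp add: cone_sign_simps(1))
  then have "c = \<delta> (r - 1) (\<lambda>n \<sigma>. cone_sign r * l n \<sigma>)" by (simp add: \<delta>_cmult fun_eq_iff)
  \<comment> \<open>This exhibits \<open>x\<close> as the boundary of
    \<open>cone_sign r * l\<close>, the zero form and \<open>- g\<close>; the two signs in front of
    \<open>l\<close> cancel.\<close>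
  moreover have "b = (\<lambda>n \<sigma>. cone_sign r * (cone_sign r * l n \<sigma>) + \<delta> (r - 2) (\<lambda>n \<sigma>. - g n \<sigma>) n \<sigma>)"
    by (simp add: cone_sign_simps l_def \<delta>_neg)
  ultimately show "x \<in> boundariesC r"
    unfolding boundariesC_eq e g(2) using l\<Lambda> CC_cmult[OF lC, of "cone_sign r"] CC_neg[OF g(1)] cone_sign_mem by blast
qed

lemma subgroup_boundariesQ: "subgroup (boundariesQ r) ((grp (coneQ r) r)\<lparr>carrier := cyclesQ r\<rparr>)" (is "subgroup _ ?H")
proof -
  interpret H: comm_group ?H by (rule comm_group_cyclesQ)
  have sub: "boundariesQ r \<subseteq> cyclesQ r"
  proof
    fix y assume "y \<in> boundariesQ r"
    then obtain g where g: "y = ((\<lambda>n p vs. 0), proj (\<delta> (r - 2) g))" "g \<in> CC (r - 2)"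
      unfolding boundariesQ_eq by auto
    then show "y \<in> cyclesQ r"
      using zero by (simp add: cyclesQ_iff[OF \<Omega>_zero \<delta>_closed''] d_zero I_zero \<delta>_\<delta>'')
  qed
  show ?thesis
  proof (rule H.subgroupI)
    show "boundariesQ r \<subseteq> carrier ?H" using sub by simp
    show "boundariesQ r \<noteq> {}" unfolding boundariesQ_eq using CC_zero by blast
    fix x assume x: "x \<in> boundariesQ r"
    then obtain g where g: "x = ((\<lambda>n p vs. 0), proj (\<delta> (r - 2) g))" "g \<in> CC (r - 2)"
      unfolding boundariesQ_eq by auto
    let ?y = "((\<lambda>n p vs. 0) :: nat \<Rightarrow> ((nat \<Rightarrow> real) \<times> 'a) form, proj (\<delta> (r - 2) (\<lambda>n \<sigma>. - g n \<sigma>)))"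
    have y: "?y \<in> boundariesQ r" unfolding boundariesQ_eq using CC_neg[OF g(2)] by blast
    have "inv\<^bsub>?H\<^esub> x = ?y"
      using x y sub by (intro H.inv_equality) (auto simp: g(1) ops_coneQ \<delta>_neg)
    then show "inv\<^bsub>?H\<^esub> x \<in> boundariesQ r" using y by simp
    fix z assume "z \<in> boundariesQ r"
    then obtain g' where g': "z = ((\<lambda>n p vs. 0), proj (\<delta> (r - 2) g'))" "g' \<in> CC (r - 2)"
      unfolding boundariesQ_eq by auto
    have "x \<otimes>\<^bsub>?H\<^esub> z = ((\<lambda>n p vs. 0), proj (\<delta> (r - 2) (\<lambda>n \<sigma>. g n \<sigma> + g' n \<sigma>)))"
      by (simp add: g(1) g'(1) ops_coneQ \<delta>_add)
    then show "x \<otimes>\<^bsub>?H\<^esub> z \<in> boundariesQ r"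
      unfolding boundariesQ_eq using CC_add[OF g(2) g'(2)] by blast
  qed
qed

lemma cohomology_iso: "cohomology (coneQ r) r \<cong> cohomology (coneC r) r"
  unfolding cohomology_def cyclesQ_def[symmetric] cyclesC_def[symmetric] boundariesQ_def[symmetric] boundariesC_def[symmetric]
proof (rule FactGroup_preimage_iso[OF comm_group_cyclesQ comm_group_cyclesC _ _ subgroup_boundariesQ])
  show "comparison \<in> hom ((grp (coneC r) r)\<lparr>carrier := cyclesC r\<rparr>) ((grp (coneQ r) r)\<lparr>carrier := cyclesQ r\<rparr>)"
  proof (rule homI)
    show "comparison x \<in> carrier ((grp (coneQ r) r)\<lparr>carrier := cyclesQ r\<rparr>)"
      if "x \<in> carrier ((grp (coneC r) r)\<lparr>carrier := cyclesC r\<rparr>)" for x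
      using that comparison_surj by auto
    fix x y
    show "comparison (x \<otimes>\<^bsub>(grp (coneC r) r)\<lparr>carrier := cyclesC r\<rparr>\<^esub> y)
        = comparison x \<otimes>\<^bsub>(grp (coneQ r) r)\<lparr>carrier := cyclesQ r\<rparr>\<^esub> comparison y"
      by (cases x; cases "fst x"; cases y; cases "fst y") (simp add: ops_coneC ops_coneQ comparison_def)
  qed
qed (use comparison_surj boundaries_comparison in simp_all)

end

theorem corollary2p5:
  fixes X :: "'a simplicial_space" and \<Lambda> :: "complex set" and r :: int
  assumes "simplicial_smooth_manifold X"
    and "subgroup \<Lambda> complex_group"
  shows "differential_characters X \<Lambda> (r - 1)
           \<cong> multiplicative_cohomology X \<Lambda> (truncation_filtration X) r r"
proof -
  interpret simplicial_manifold_coeff X \<Lambda>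
    by (intro simplicial_manifold_coeff.intro simplicial_manifold.intro coeff_subgroup.intro assms)
  have "differential_characters X \<Lambda> (r - 1) = cohomology (coneQ r) r"
    by (simp add: differential_characters_def coneQ_def quot_def)
  moreover have "multiplicative_cohomology X \<Lambda> (truncation_filtration X) r r = cohomology (coneC r) r"
    by (simp add: multiplicative_cohomology_def truncation_filtration_def coneC_def sub_def)
  ultimately show ?thesis using cohomology_iso by simp
qed

end
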